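(* Let $\Sigma$ be a quotient of the torus $\mathbb T^2$ equipped with a flat metric, and let $\Phi_\Sigma$ be the geodesic flow on $T^1\Sigma$. Then any two disjoint null-homologous collections $\gamma,\gamma'$ of periodic orbits of $\Phi_\Sigma$ whose projections on $\Sigma$ intersect have a negative linking number: $\mathrm{Lk}(\gamma,\gamma')<0$.
   Context: Here $\Sigma$ is an orientable $2$-orbifold $\mathbb R^2/\Gamma$ finitely covered by a flat torus, with $\Gamma$ a discrete group of orientation-preserving isometries of $\mathbb R^2$. Its unit tangent bundle is $T^1\Sigma=(T^1\mathbb R^2)/\Gamma$, a $3$-manifold oriented by the orientation of $\Sigma$. The geodesic flow sends $(p,v)$ after time $t$ to the unit tangent vector at distance $t$ along the oriented geodesic determined by $(p,v)$. A collection is a finite nonempty family of periodic orbits, oriented by the flow; it is null-homologous if its class in $H_1(T^1\Sigma;\mathbb Q)$ is $0$. For two disjoint null-homologous links $K,K'$ in an oriented $3$-manifold, $\mathrm{Lk}(K,K')$ is the algebraic intersection number of $K'$ with any (rational) $2$-chain with boundary $K$ transverse to $K'$. The projection of a collection on $\Sigma$ is the union of the underlying geodesics of $\Sigma$.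
   Formalization: "Projections intersect" is taken to mean that they meet at some point in non-parallel directions; if they only overlap along common or parallel geodesics the linking number is 0, so the claim as literally worded fails there. *)

theory Defs
  imports
    "HOL-Analysis.Analysis"
    "HOL-Homology.Homology"
    "HOL-Library.Multiset"
begin

section \<open>Flat orbifolds covered by a torus\<close>

text \<open>The Euclidean plane is \<^typ>\<open>complex\<close>, with its usual metric and orientation; the
  orientation-preserving isometries are the maps \<open>z \<mapsto> a z + b\<close> with \<open>\<bar>a\<bar> = 1\<close>.\<close>

definition rigid_motion :: "(complex \<Rightarrow> complex) \<Rightarrow> bool" where
  "rigid_motion g \<longleftrightarrow> (\<exists>a b. cmod a = 1 \<and> g = (\<lambda>z. a * z + b))"

definition translation_lattice :: "(complex \<Rightarrow> complex) set \<Rightarrow> bool" where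
  "translation_lattice \<Lambda> \<longleftrightarrow>
     (\<exists>w\<^sub>1 w\<^sub>2. w\<^sub>1 \<noteq> w\<^sub>2 \<and> independent {w\<^sub>1, w\<^sub>2} \<and>
        \<Lambda> = {\<lambda>z. z + of_int m * w\<^sub>1 + of_int n * w\<^sub>2 | m n :: int. True})"

text \<open>Orbifold fundamental groups \<open>\<Gamma>\<close> of the orientable flat orbifolds \<open>\<Sigma> = \<complex>/\<Gamma>\<close> that are
  finitely covered by a flat torus \<open>\<complex>/\<Lambda>\<close>. Discreteness refers to the topology of the isometry
  group, with \<open>z \<mapsto> a z + b\<close> parametrised by \<open>(a, b)\<close>.\<close>

definition flat_orbifold_group :: "(complex \<Rightarrow> complex) set \<Rightarrow> bool" where
  "flat_orbifold_group \<Gamma> \<longleftrightarrow>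
     (\<forall>g\<in>\<Gamma>. rigid_motion g) \<and>
     id \<in> \<Gamma> \<and> (\<forall>g\<in>\<Gamma>. \<forall>h\<in>\<Gamma>. g \<circ> h \<in> \<Gamma>) \<and> (\<forall>g\<in>\<Gamma>. inv_into UNIV g \<in> \<Gamma>) \<and>
     discrete {(a, b). (\<lambda>z. a * z + b) \<in> \<Gamma>} \<and>
     (\<exists>\<Lambda>. translation_lattice \<Lambda> \<and> \<Lambda> \<subseteq> \<Gamma> \<and> finite ((\<lambda>g. (\<lambda>h. g \<circ> h) ` \<Lambda>) ` \<Gamma>))"

section \<open>The unit tangent bundle and the geodesic flow\<close>

definition unit_tangent_plane :: "(complex \<times> complex) set" where
  "unit_tangent_plane = {(p, v). cmod v = 1}"

text \<open>A rigid motion is affine, so its differential at every point is \<open>v \<mapsto> g v - g 0\<close>.\<close>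

definition tangent_action :: "(complex \<Rightarrow> complex) \<Rightarrow> complex \<times> complex \<Rightarrow> complex \<times> complex" where
  "tangent_action g = (\<lambda>(p, v). (g p, g v - g 0))"

text \<open>Points of \<open>T\<^sup>1\<Sigma>\<close> are the \<open>\<Gamma>\<close>-orbits in the unit tangent bundle of the plane.\<close>

definition tangent_class ::
    "(complex \<Rightarrow> complex) set \<Rightarrow> complex \<times> complex \<Rightarrow> (complex \<times> complex) set" where
  "tangent_class \<Gamma> x = (\<lambda>g. tangent_action g x) ` \<Gamma>"

definition unit_tangent_bundle :: "(complex \<Rightarrow> complex) set \<Rightarrow> (complex \<times> complex) set topology" where
  "unit_tangent_bundle \<Gamma> = topology (\<lambda>U.
     U \<subseteq> tangent_class \<Gamma> ` unit_tangent_plane \<and>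
     openin (top_of_set unit_tangent_plane) {x \<in> unit_tangent_plane. tangent_class \<Gamma> x \<in> U})"

lemma openin_unit_tangent_bundle:
  "openin (unit_tangent_bundle \<Gamma>) U \<longleftrightarrow>
     U \<subseteq> tangent_class \<Gamma> ` unit_tangent_plane \<and>
     openin (top_of_set unit_tangent_plane) {x \<in> unit_tangent_plane. tangent_class \<Gamma> x \<in> U}"
proof -
  let ?P = "\<lambda>U. {x \<in> unit_tangent_plane. tangent_class \<Gamma> x \<in> U}"
  have inter: "?P (S \<inter> T) = ?P S \<inter> ?P T" for S T by auto
  have union: "?P (\<Union>\<K>) = (\<Union>K\<in>\<K>. ?P K)" for \<K> by auto
  have "istopology (\<lambda>U. U \<subseteq> tangent_class \<Gamma> ` unit_tangent_plane \<and>
     openin (top_of_set unit_tangent_plane) (?P U))"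
    unfolding istopology_def inter union by (blast intro: openin_Int)
  then show ?thesis
    unfolding unit_tangent_bundle_def by (simp add: topology_inverse')
qed

lemma topspace_unit_tangent_bundle:
  "topspace (unit_tangent_bundle \<Gamma>) = tangent_class \<Gamma> ` unit_tangent_plane"
proof
  show "topspace (unit_tangent_bundle \<Gamma>) \<subseteq> tangent_class \<Gamma> ` unit_tangent_plane"
    using openin_topspace[of "unit_tangent_bundle \<Gamma>"] openin_unit_tangent_bundle by blast
  have "{x \<in> unit_tangent_plane. tangent_class \<Gamma> x \<in> tangent_class \<Gamma> ` unit_tangent_plane}
      = unit_tangent_plane" by auto
  then show "tangent_class \<Gamma> ` unit_tangent_plane \<subseteq> topspace (unit_tangent_bundle \<Gamma>)"
    by (intro openin_subset) (simp add: openin_unit_tangent_bundle)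
qed

lemma quotient_map_tangent_class:
  "quotient_map (top_of_set unit_tangent_plane) (unit_tangent_bundle \<Gamma>) (tangent_class \<Gamma>)"
  by (auto simp: quotient_map_def topspace_unit_tangent_bundle openin_unit_tangent_bundle)

definition plane_flow :: "real \<Rightarrow> complex \<times> complex \<Rightarrow> complex \<times> complex" where
  "plane_flow t = (\<lambda>(p, v). (p + of_real t * v, v))"

text \<open>The flow of the plane commutes with \<open>\<Gamma>\<close>, so it maps \<open>\<Gamma>\<close>-orbits onto \<open>\<Gamma>\<close>-orbits.\<close>

definition geodesic_flow :: "real \<Rightarrow> (complex \<times> complex) set \<Rightarrow> (complex \<times> complex) set" where
  "geodesic_flow t X = plane_flow t ` X"

definition periodic_orbit ::
    "(complex \<Rightarrow> complex) set \<Rightarrow> (complex \<times> complex) set set \<Rightarrow> bool" where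
  "periodic_orbit \<Gamma> \<gamma> \<longleftrightarrow>
     (\<exists>X \<in> topspace (unit_tangent_bundle \<Gamma>).
        (\<exists>T>0. geodesic_flow T X = X) \<and> \<gamma> = range (\<lambda>t. geodesic_flow t X))"

text \<open>A collection is a finite nonempty family of periodic orbits, that is, a nonempty multiset.\<close>

type_synonym orbit_collection = "(complex \<times> complex) set set multiset"

definition periodic_collection :: "(complex \<Rightarrow> complex) set \<Rightarrow> orbit_collection \<Rightarrow> bool" where
  "periodic_collection \<Gamma> K \<longleftrightarrow> K \<noteq> {#} \<and> (\<forall>\<gamma>\<in>#K. periodic_orbit \<Gamma> \<gamma>)"

definition support :: "orbit_collection \<Rightarrow> (complex \<times> complex) set set" where
  "support K = \<Union>(set_mset K)"

text \<open>The projections on \<open>\<Sigma>\<close> cross: over some point \<open>p\<close> of the plane there are a line of a lift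
  of \<open>K\<close> and a line of a lift of \<open>K'\<close> through \<open>p\<close> that are distinct. Mere overlapping of geodesics
  does not count: in a torus, take \<open>K\<close> to consist of a closed geodesic \<open>l\<^sub>1\<close> and the reverse of a
  parallel one \<open>l\<^sub>2\<close>, and \<open>K'\<close> of the reverse of \<open>l\<^sub>1\<close> and a third parallel \<open>l\<^sub>3\<close>. These are disjoint
  and null-homologous with overlapping projections, but have linking number \<open>0\<close>.\<close>

definition projections_cross :: "orbit_collection \<Rightarrow> orbit_collection \<Rightarrow> bool" where
  "projections_cross K K' \<longleftrightarrow>
     (\<exists>X \<in> support K. \<exists>X' \<in> support K'. \<exists>p v v'.
        (p, v) \<in> X \<and> (p, v') \<in> X' \<and> v' \<noteq> v \<and> v' \<noteq> - v)"

section \<open>Rational singular chains\<close>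

type_synonym 'a rat_chain = "((nat \<Rightarrow> real) \<Rightarrow> 'a) \<Rightarrow>\<^sub>0 rat"

definition rat_singular_chain :: "nat \<Rightarrow> 'a topology \<Rightarrow> 'a rat_chain \<Rightarrow> bool" where
  "rat_singular_chain p X c \<longleftrightarrow> Poly_Mapping.keys c \<subseteq> singular_simplex_set p X"

definition rat_chain_boundary :: "nat \<Rightarrow> 'a rat_chain \<Rightarrow> 'a rat_chain" where
  "rat_chain_boundary p c =
     (if p = 0 then 0 else
      \<Sum>\<sigma>\<in>Poly_Mapping.keys c. \<Sum>k\<le>p.
        Poly_Mapping.single (singular_face p k \<sigma>) ((-1) ^ k * Poly_Mapping.lookup c \<sigma>))"

definition period :: "(complex \<times> complex) set \<Rightarrow> real" where
  "period X = Inf {T. 0 < T \<and> geodesic_flow T X = X}"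

text \<open>The orbit of \<open>X\<close>, run through once in the direction of the flow, as a singular \<open>1\<close>-simplex:
  \<open>s 1\<close> increases from the zeroth to the first vertex.\<close>

definition orbit_loop :: "(complex \<times> complex) set \<Rightarrow> (nat \<Rightarrow> real) \<Rightarrow> (complex \<times> complex) set" where
  "orbit_loop X = restrict (\<lambda>s. geodesic_flow (period X * s 1) X) (standard_simplex 1)"

text \<open>The base points are irrelevant: another choice changes the cycle by the boundary of a chain
  contained in the orbits.\<close>

definition fundamental_cycle :: "orbit_collection \<Rightarrow> (complex \<times> complex) set rat_chain" where
  "fundamental_cycle K = (\<Sum>\<gamma>\<in>#K. Poly_Mapping.single (orbit_loop (SOME X. X \<in> \<gamma>)) 1)"

definition bounds ::
    "(complex \<Rightarrow> complex) set \<Rightarrow> (complex \<times> complex) set rat_chain \<Rightarrow> orbit_collection \<Rightarrow> bool" where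
  "bounds \<Gamma> c K \<longleftrightarrow>
     rat_singular_chain 2 (unit_tangent_bundle \<Gamma>) c \<and> rat_chain_boundary 2 c = fundamental_cycle K"

definition null_homologous :: "(complex \<Rightarrow> complex) set \<Rightarrow> orbit_collection \<Rightarrow> bool" where
  "null_homologous \<Gamma> K \<longleftrightarrow> (\<exists>c. bounds \<Gamma> c K)"

section \<open>Transverse intersections and the linking number\<close>

text \<open>The universal covering of \<open>T\<^sup>1\<Sigma>\<close> by \<open>\<complex> \<times> \<real> \<cong> \<real>\<^sup>3\<close>, with \<open>\<theta>\<close> the angle of the tangent vector. It
  determines the smooth structure of \<open>T\<^sup>1\<Sigma>\<close>, and its orientation by the coordinates
  \<open>(Re z, Im z, \<theta>)\<close>.\<close>

definition tangent_cover ::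
    "(complex \<Rightarrow> complex) set \<Rightarrow> complex \<times> real \<Rightarrow> (complex \<times> complex) set" where
  "tangent_cover \<Gamma> = (\<lambda>(z, \<theta>). tangent_class \<Gamma> (z, cis \<theta>))"

definition coordinates :: "complex \<times> real \<Rightarrow> real ^ 3" where
  "coordinates = (\<lambda>(z, \<theta>). vector [Re z, Im z, \<theta>])"

text \<open>The standard \<open>2\<close>-simplex is parametrised, compatibly with its orientation, by
  \<open>(a, b) = (s 1, s 2)\<close>.\<close>

definition simplex_point :: "real \<times> real \<Rightarrow> nat \<Rightarrow> real" where
  "simplex_point = (\<lambda>(a, b) i. if i = 0 then 1 - a - b else if i = 1 then a else if i = 2 then b else 0)"

definition simplex_interior :: "(nat \<Rightarrow> real) set" where
  "simplex_interior = {s \<in> standard_simplex 2. \<forall>i\<le>2. 0 < s i}"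

text \<open>\<open>f\<close> is a local lift of the \<open>2\<close>-simplex \<open>\<sigma>\<close> near \<open>s\<close>, with differential \<open>D\<close> at \<open>s\<close>.\<close>

definition lift_at ::
    "(complex \<Rightarrow> complex) set \<Rightarrow> ((nat \<Rightarrow> real) \<Rightarrow> (complex \<times> complex) set) \<Rightarrow> (nat \<Rightarrow> real) \<Rightarrow>
     (real \<times> real \<Rightarrow> complex \<times> real) \<Rightarrow> (real \<times> real \<Rightarrow> complex \<times> real) \<Rightarrow> bool" where
  "lift_at \<Gamma> \<sigma> s f D \<longleftrightarrow>
     (\<forall>\<^sub>F u in nhds (s 1, s 2). tangent_cover \<Gamma> (f u) = \<sigma> (simplex_point u)) \<and>
     (f has_derivative D) (at (s 1, s 2))"

text \<open>The frame consists of the two tangent vectors of the simplex followed by the generator of the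
  geodesic flow at the point \<open>(z, \<theta>)\<close>, which in these coordinates is \<open>(cis \<theta>, 0)\<close>.\<close>

definition crossing_det ::
    "complex \<times> real \<Rightarrow> (real \<times> real \<Rightarrow> complex \<times> real) \<Rightarrow> real" where
  "crossing_det x D =
     det (vector [coordinates (D (1, 0)), coordinates (D (0, 1)), coordinates (cis (snd x), 0)]
       :: real ^ 3 ^ 3)"

definition transverse_at ::
    "(complex \<Rightarrow> complex) set \<Rightarrow> ((nat \<Rightarrow> real) \<Rightarrow> (complex \<times> complex) set) \<Rightarrow> (nat \<Rightarrow> real) \<Rightarrow> bool" where
  "transverse_at \<Gamma> \<sigma> s \<longleftrightarrow>
     s \<in> simplex_interior \<and> (\<exists>f D. lift_at \<Gamma> \<sigma> s f D \<and> crossing_det (f (s 1, s 2)) D \<noteq> 0)"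

text \<open>The sign does not depend on the lift, since \<open>\<Gamma>\<close> preserves the orientation.\<close>

definition crossing_sign ::
    "(complex \<Rightarrow> complex) set \<Rightarrow> ((nat \<Rightarrow> real) \<Rightarrow> (complex \<times> complex) set) \<Rightarrow> (nat \<Rightarrow> real) \<Rightarrow> rat" where
  "crossing_sign \<Gamma> \<sigma> s =
     (if \<exists>f D. lift_at \<Gamma> \<sigma> s f D \<and> crossing_det (f (s 1, s 2)) D > 0 then 1 else -1)"

text \<open>Transversality to the \<open>1\<close>-dimensional \<open>K\<close> forces the edges and vertices of the simplices
  to avoid \<open>K\<close>. Simplices need to be differentiable only where they meet \<open>K\<close>; this suffices for the
  intersections to be isolated, hence finite in number, with well-defined signs.\<close>

definition transverse ::
    "(complex \<Rightarrow> complex) set \<Rightarrow> (complex \<times> complex) set rat_chain \<Rightarrow> orbit_collection \<Rightarrow> bool" where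
  "transverse \<Gamma> c K \<longleftrightarrow>
     (\<forall>\<sigma>\<in>Poly_Mapping.keys c. \<forall>s\<in>standard_simplex 2. \<sigma> s \<in> support K \<longrightarrow> transverse_at \<Gamma> \<sigma> s)"

definition intersection_number ::
    "(complex \<Rightarrow> complex) set \<Rightarrow> (complex \<times> complex) set rat_chain \<Rightarrow> orbit_collection \<Rightarrow> rat" where
  "intersection_number \<Gamma> c K =
     (\<Sum>\<sigma>\<in>Poly_Mapping.keys c. \<Sum>\<gamma>\<in>#K. \<Sum>s | s \<in> standard_simplex 2 \<and> \<sigma> s \<in> \<gamma>.
        Poly_Mapping.lookup c \<sigma> * crossing_sign \<Gamma> \<sigma> s)"

definition linking_number ::
    "(complex \<Rightarrow> complex) set \<Rightarrow> orbit_collection \<Rightarrow> orbit_collection \<Rightarrow> rat" where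
  "linking_number \<Gamma> K K' =
     (THE r. \<exists>c. bounds \<Gamma> c K \<and> transverse \<Gamma> c K' \<and> r = intersection_number \<Gamma> c K')"

end

theory Submission
  imports Defs "HOL-Complex_Analysis.Complex_Analysis"
begin

text \<open>Lift everything to the universal cover \<open>\<complex> \<times> \<real>\<close>, where a periodic orbit becomes a family of parallel
  horizontal lines. Projecting along the lines turns the family into a planar lattice, and a
  quasi-periodic function of theta type vanishes exactly there, to first order. If a collection is
  null-homologous, then the vectors of its lines add up to \<open>0\<close>, so that its factors of automorphy cancel up to
  constants and the winding number of the product of these functions along a path is invariant under the
  deck group. Consequently the intersection number of any transverse chain bounded by \<open>K\<close> with \<open>K'\<close> is the
  winding number along \<open>K\<close> of the product belonging to \<open>K'\<close>. Each pair of closed orbits that meet at angle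
  \<open>2 \<pi> t\<close> contributes a positive multiple of \<open>sin (2 \<pi> t)\<close> times \<open>t - sgn t / 2\<close>, where \<open>\<bar>t\<bar> \<le> 1/2\<close>; this is never positive
  and vanishes only for parallel orbits.\<close>

section \<open>Winding numbers along the boundary of a triangle\<close>

text \<open>The multiplier of a degree one section has slope \<open>n\<close> in \<open>t\<close>,
  so a loop that moves \<open>y\<close> by \<open>n\<close> at constant \<open>t\<close> winds
  \<open>n * t\<close> times up to a constant. Periodicity in \<open>t\<close> then forces a jump by
  \<open>- n\<close> at the integers, where the loop may meet zeros: hence a sawtooth. Its additive
  constant is a normalisation. Replacing \<open>quasi_theta y t\<close> by
  \<open>exp (2 * pi * \<i> * c * y) * quasi_theta y t\<close> adds \<open>c * n\<close>, and these
  terms cancel over a collection whose vectors sum to 0. The symmetric exponents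
  \<open>\<i> * pi * y\<close> and \<open>- (\<i> * pi * y)\<close> make every single contribution
  nonpositive, not only the sum. Two obstacles shape the rest. Simplices are continuous and
  differentiable only at the crossings, so signed counts are obtained as degrees of continuous
  functions and not as integrals. And \<open>linking_number\<close> is a definite description, so
  that besides the equality of all intersection numbers a transverse chain must be constructed; it
  averages over \<open>rotations\<close>, since it is the sum over all rotated copies of the orbits
  whose vectors are known to close up.\<close>

lemma winding_number_exp:
  fixes h :: "real \<Rightarrow> complex"
  assumes "continuous_on {0..1} h" and "\<And>t. t \<in> {0..1} \<Longrightarrow> \<phi> t = exp (h t)"
  shows "winding_number \<phi> 0 = (h 1 - h 0) / (2 * of_real pi * \<i>)"
proof -
  have "winding_number \<phi> 0 = winding_number (exp \<circ> h) 0"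
    by (rule winding_number_cong) (simp add: assms(2))
  also have "\<dots> = (h 1 - h 0) / (2 * of_real pi * \<i>)"
    using winding_number_compose_exp[of h] assms(1)
    by (simp add: path_def pathfinish_def pathstart_def)
  finally show ?thesis .
qed

lemma continuous_logarithm_interval:
  fixes \<phi> :: "real \<Rightarrow> complex"
  assumes "continuous_on {0..1} \<phi>" "\<And>t. t \<in> {0..1} \<Longrightarrow> \<phi> t \<noteq> 0"
  obtains h where "continuous_on {0..1} h" "\<And>t. t \<in> {0..1} \<Longrightarrow> \<phi> t = exp (h t)"
    "winding_number \<phi> 0 = (h 1 - h 0) / (2 * of_real pi * \<i>)"
  by (metis winding_number_exp continuous_logarithm_on_contractible[OF assms(1) _ assms(2)]
      convex_imp_contractible convex_closed_interval)

lemma winding_number_mult: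
  assumes "continuous_on {0..1} \<phi>" "\<And>t. t \<in> {0..1} \<Longrightarrow> \<phi> t \<noteq> 0"
    and "continuous_on {0..1} \<psi>" "\<And>t. t \<in> {0..1} \<Longrightarrow> \<psi> t \<noteq> 0"
  shows "winding_number (\<lambda>t. \<phi> t * \<psi> t) 0 = winding_number \<phi> 0 + winding_number \<psi> 0"
proof -
  obtain f where f: "continuous_on {0..1} f" "\<And>t. t \<in> {0..1} \<Longrightarrow> \<phi> t = exp (f t)"
    "winding_number \<phi> 0 = (f 1 - f 0) / (2 * of_real pi * \<i>)"
    using continuous_logarithm_interval[OF assms(1,2)] by metis
  obtain g where g: "continuous_on {0..1} g" "\<And>t. t \<in> {0..1} \<Longrightarrow> \<psi> t = exp (g t)"
    "winding_number \<psi> 0 = (g 1 - g 0) / (2 * of_real pi * \<i>)"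
    using continuous_logarithm_interval[OF assms(3,4)] by metis
  have "winding_number (\<lambda>t. \<phi> t * \<psi> t) 0
      = ((f 1 + g 1) - (f 0 + g 0)) / (2 * of_real pi * \<i>)"
    by (rule winding_number_exp[where h = "\<lambda>t. f t + g t"])
       (use f g in \<open>auto simp: exp_add continuous_on_add\<close>)
  then show ?thesis
    by (simp add: f(3) g(3) diff_divide_distrib add_divide_distrib)
qed

lemma winding_number_cnj_zero:
  assumes "continuous_on {0..1} \<phi>" "\<And>t. t \<in> {0..1} \<Longrightarrow> \<phi> t \<noteq> 0"
  shows "winding_number (\<lambda>t. cnj (\<phi> t)) 0 = - cnj (winding_number \<phi> 0)"
proof -
  obtain f where f: "continuous_on {0..1} f" "\<And>t. t \<in> {0..1} \<Longrightarrow> \<phi> t = exp (f t)"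
    "winding_number \<phi> 0 = (f 1 - f 0) / (2 * of_real pi * \<i>)"
    using continuous_logarithm_interval[OF assms] by metis
  have "winding_number (\<lambda>t. cnj (\<phi> t)) 0 = (cnj (f 1) - cnj (f 0)) / (2 * of_real pi * \<i>)"
    by (rule winding_number_exp) (use f in \<open>auto simp: exp_cnj continuous_on_cnj\<close>)
  then show ?thesis by (simp add: f(3) divide_simps)
qed

section \<open>The planar model of the 2-simplex and winding along its boundary\<close>

definition triangle :: "complex set" where
  "triangle = convex hull {0, 1, \<i>}"

lemma compact_triangle: "compact triangle" and convex_triangle: "convex triangle"
  by (simp_all add: triangle_def finite_imp_compact_convex_hull)

lemma mem_triangle: "w \<in> triangle \<longleftrightarrow> 0 \<le> Re w \<and> 0 \<le> Im w \<and> Re w + Im w \<le> 1"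
proof
  assume "w \<in> triangle"
  then obtain u v t where "0 \<le> u" "0 \<le> v" "0 \<le> t" "u + v + t = 1"
    and w: "w = u *\<^sub>R 0 + v *\<^sub>R 1 + t *\<^sub>R \<i>"
    unfolding triangle_def convex_hull_3 by blast
  then show "0 \<le> Re w \<and> 0 \<le> Im w \<and> Re w + Im w \<le> 1" by auto
next
  assume w: "0 \<le> Re w \<and> 0 \<le> Im w \<and> Re w + Im w \<le> 1"
  have "w = (1 - Re w - Im w) *\<^sub>R 0 + Re w *\<^sub>R 1 + Im w *\<^sub>R \<i>"
    by (simp add: complex_eq_iff)
  moreover have "0 \<le> 1 - Re w - Im w" "(1 - Re w - Im w) + Re w + Im w = 1"
    using w by auto
  ultimately show "w \<in> triangle"
    unfolding triangle_def convex_hull_3 using w by blast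
qed

lemma interior_triangle: "w \<in> interior triangle \<longleftrightarrow> 0 < Re w \<and> 0 < Im w \<and> Re w + Im w < 1"
proof
  assume w: "0 < Re w \<and> 0 < Im w \<and> Re w + Im w < 1"
  have "open {w. 0 < Re w \<and> 0 < Im w \<and> Re w + Im w < 1}"
    by (intro open_Collect_conj open_Collect_less continuous_intros)
  then show "w \<in> interior triangle"
    using w by (intro interiorI[of "{w. 0 < Re w \<and> 0 < Im w \<and> Re w + Im w < 1}"])
       (auto simp: mem_triangle)
next
  assume "w \<in> interior triangle"
  then obtain e where e: "0 < e" "cball w e \<subseteq> triangle"
    by (auto simp: mem_interior_cball)
  have "w - of_real e \<in> triangle" "w - \<i> * of_real e \<in> triangle" "w + of_real e \<in> triangle"
    using e by (auto intro!: subsetD[OF e(2)] simp: dist_norm norm_mult)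
  then show "0 < Re w \<and> 0 < Im w \<and> Re w + Im w < 1"
    using e(1) by (auto simp: mem_triangle)
qed

definition triangle_edges :: "(real \<Rightarrow> complex) set" where
  "triangle_edges = {linepath 1 \<i>, linepath 0 \<i>, linepath 0 1}"

text \<open>The signs are those of the singular boundary operator: the three edges parametrise the
  faces 0, 1 and 2 in this order. Together they run once counterclockwise around
  \<open>triangle\<close>.\<close>

definition edge_sum :: "((real \<Rightarrow> complex) \<Rightarrow> 'a::ab_group_add) \<Rightarrow> 'a" where
  "edge_sum \<Phi> = \<Phi> (linepath 1 \<i>) - \<Phi> (linepath 0 \<i>) + \<Phi> (linepath 0 1)"

lemma edge_sum_cong: "(\<And>e. e \<in> triangle_edges \<Longrightarrow> \<Phi> e = \<Psi> e) \<Longrightarrow> edge_sum \<Phi> = edge_sum \<Psi>"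
  by (simp add: edge_sum_def triangle_edges_def)

lemma edge_sum_add: "edge_sum (\<lambda>e. \<Phi> e + \<Psi> e) = edge_sum \<Phi> + edge_sum \<Psi>"
  by (simp add: edge_sum_def)

lemma edge_sum_sum: "edge_sum (\<lambda>e. \<Sum>i\<in>I. \<Phi> i e) = (\<Sum>i\<in>I. edge_sum (\<Phi> i))"
  by (simp add: edge_sum_def sum.distrib sum_subtractf)

lemma linepath_real: "linepath 1 \<i> t = Complex (1 - t) t" "linepath 0 \<i> t = Complex 0 t"
    "linepath 0 1 t = Complex t 0"
  by (simp_all add: linepath_def complex_eq_iff)

lemma triangle_edge_continuous: "e \<in> triangle_edges \<Longrightarrow> continuous_on A e"
  by (auto simp: triangle_edges_def)

lemma triangle_edge_mem: "e \<in> triangle_edges \<Longrightarrow> t \<in> {0..1} \<Longrightarrow> e t \<in> triangle - interior triangle"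
  by (auto simp: triangle_edges_def mem_triangle interior_triangle linepath_real)

text \<open>On the contractible triangle \<open>H\<close> has a continuous logarithm. The winding
  number along an edge is the difference of its values at the end points, and these differences
  telescope.\<close>

lemma edge_sum_winding_nonzero:
  assumes "continuous_on triangle H" "\<And>w. w \<in> triangle \<Longrightarrow> H w \<noteq> 0"
  shows "edge_sum (\<lambda>e. winding_number (H \<circ> e) 0) = 0"
proof -
  obtain h where h: "continuous_on triangle h" "\<And>w. w \<in> triangle \<Longrightarrow> H w = exp (h w)"
    using continuous_logarithm_on_contractible[OF assms(1) _ assms(2)] convex_triangle
      convex_imp_contractible by metis
  have "winding_number (H \<circ> e) 0 = (h (e 1) - h (e 0)) / (2 * of_real pi * \<i>)"
    if e: "e \<in> triangle_edges" for e
  proof -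
    have "continuous_on {0..1} (\<lambda>t. h (e t))"
      using triangle_edge_mem[OF e] by (intro continuous_on_compose2[OF h(1) triangle_edge_continuous[OF e]]) auto
    then show ?thesis
      using triangle_edge_mem[OF e] by (intro winding_number_exp) (auto simp: h(2))
  qed
  then have "edge_sum (\<lambda>e. winding_number (H \<circ> e) 0)
      = edge_sum (\<lambda>e. (h (e 1) - h (e 0)) / (2 * of_real pi * \<i>))"
    by (rule edge_sum_cong)
  also have "\<dots> = 0"
    by (simp add: edge_sum_def linepath_def diff_divide_distrib)
  finally show ?thesis .
qed

text \<open>With the middle edge reversed, the edges join to the counterclockwise boundary curve of
  the triangle, which winds once around interior points.\<close>

lemma edge_sum_winding_diff:
  assumes z: "z \<in> interior triangle"
  shows "edge_sum (\<lambda>e. winding_number (\<lambda>t. e t - z) 0) = 1"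
proof -
  have edges: "z \<notin> path_image e" if "e \<in> triangle_edges" for e
    using triangle_edge_mem[OF that] z by (auto simp: path_image_def)
  then have e: "z \<notin> path_image (linepath 1 \<i>)" "z \<notin> path_image (linepath 0 \<i>)"
      "z \<notin> path_image (linepath 0 1)"
    by (simp_all only: triangle_edges_def insert_iff simp_thms)
  have e': "z \<notin> path_image (linepath \<i> 0)"
    using e(2) by (metis path_image_linepath closed_segment_commute)
  have "winding_number (linepath 0 1 +++ linepath 1 \<i> +++ linepath \<i> 0) z = 1"
    using winding_number_triangle[of z 0 1 \<i>] z interior_triangle[of z] by (simp add: triangle_def)
  moreover have "winding_number (linepath 0 1 +++ linepath 1 \<i> +++ linepath \<i> 0) z
      = winding_number (linepath 0 1) z + (winding_number (linepath 1 \<i>) z + winding_number (linepath \<i> 0) z)"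
    using e e' by (simp add: winding_number_join not_in_path_image_join)
  moreover have "winding_number (linepath 0 \<i>) z = - winding_number (linepath \<i> 0) z"
    using winding_number_reversepath[of "linepath \<i> 0" z] e' by simp
  ultimately show ?thesis
    by (simp add: edge_sum_def winding_number_offset[symmetric] add.commute)
qed

lemma edge_sum_winding_cnj_diff:
  assumes z: "z \<in> interior triangle"
  shows "edge_sum (\<lambda>e. winding_number (\<lambda>t. cnj (e t - z)) 0) = -1"
proof -
  have "edge_sum (\<lambda>e. winding_number (\<lambda>t. cnj (e t - z)) 0)
      = edge_sum (\<lambda>e. - cnj (winding_number (\<lambda>t. e t - z) 0))"
    using triangle_edge_mem z
    by (intro edge_sum_cong winding_number_cnj_zero continuous_intros triangle_edge_continuous) auto
  also have "\<dots> = - cnj (edge_sum (\<lambda>e. winding_number (\<lambda>t. e t - z) 0))"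
    by (simp add: edge_sum_def)
  finally show ?thesis using edge_sum_winding_diff[OF z] by simp
qed

section \<open>Zeros of local degree 1 or -1 and the argument principle for continuous
  functions\<close>

definition oriented :: "bool \<Rightarrow> complex \<Rightarrow> complex" where
  "oriented b w = (if b then w else cnj w)"

lemma norm_oriented [simp]: "cmod (oriented b w) = cmod w"
  by (simp add: oriented_def)

lemma oriented_eq_0 [simp]: "oriented b w = 0 \<longleftrightarrow> w = 0"
  by (simp add: oriented_def)

lemma continuous_on_oriented [continuous_intros]:
  "continuous_on A f \<Longrightarrow> continuous_on A (\<lambda>w. oriented b (f w))"
  by (cases b) (simp_all add: oriented_def continuous_on_cnj)

text \<open>A zero of local degree \<open>1\<close> (for \<open>b = True\<close>) or \<open>-1\<close>, for functions that are merely continuous.\<close>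

definition simple_zero :: "bool \<Rightarrow> (complex \<Rightarrow> complex) \<Rightarrow> complex \<Rightarrow> bool" where
  "simple_zero b G z \<longleftrightarrow> (\<exists>a m. m < cmod a \<and>
     (\<forall>\<^sub>F w in nhds z. cmod (G w - a * oriented b (w - z)) \<le> m * cmod (w - z)))"

lemma simple_zero_transform:
  assumes "simple_zero b G z" "\<forall>\<^sub>F w in nhds z. G w = H w"
  shows "simple_zero b H z"
proof -
  from assms(1) obtain a m where a: "m < cmod a"
    "\<forall>\<^sub>F w in nhds z. cmod (G w - a * oriented b (w - z)) \<le> m * cmod (w - z)"
    unfolding simple_zero_def by blast
  have "\<forall>\<^sub>F w in nhds z. cmod (H w - a * oriented b (w - z)) \<le> m * cmod (w - z)"
    using a(2) assms(2) by eventually_elim simp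
  with a(1) show ?thesis unfolding simple_zero_def by blast
qed

text \<open>The new leading coefficient is \<open>k z * a\<close>. The relative error
  \<open>cmod (k w) * m' + cmod (k w - k z) * cmod a\<close> tends to
  \<open>cmod (k z) * m'\<close>, which is smaller than \<open>cmod (k z * a)\<close>; continuity of
  \<open>k\<close> leaves room for a bound \<open>M\<close> in between.\<close>

lemma simple_zero_mult:
  assumes "simple_zero b G z" "continuous (at z) k" "k z \<noteq> 0"
  shows "simple_zero b (\<lambda>w. k w * G w) z"
proof -
  from assms(1) obtain a m where am: "m < cmod a"
    and ev: "\<forall>\<^sub>F w in nhds z. cmod (G w - a * oriented b (w - z)) \<le> m * cmod (w - z)"
    unfolding simple_zero_def by blast
  have a0: "a \<noteq> 0"
  proof
    assume "a = 0"
    then have "m < 0" using am by simp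
    obtain d where d: "d > 0" "\<And>w. dist w z < d \<Longrightarrow> cmod (G w - a * oriented b (w - z)) \<le> m * cmod (w - z)"
      using ev unfolding eventually_nhds_metric by blast
    have "0 \<le> cmod (G (z + of_real (d / 2)) - a * oriented b (z + of_real (d / 2) - z))"
      by simp
    also have "\<dots> \<le> m * cmod (z + of_real (d / 2) - z)"
      by (rule d(2)) (use d(1) in \<open>simp add: dist_norm\<close>)
    also have "\<dots> = m * (d / 2)" using d(1) by simp
    finally have "0 \<le> m * (d / 2)" .
    then show False using \<open>m < 0\<close> d(1) by (simp add: zero_le_mult_iff)
  qed
  \<comment> \<open>The definition puts no lower bound on \<open>m\<close>; a nonnegative bound is
    wanted for the products below, and \<open>a \<noteq> 0\<close> keeps it smaller than
    \<open>cmod a\<close>.\<close>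
  define m' where "m' = max m 0"
  have m': "0 \<le> m'" "m' < cmod a" "m \<le> m'"
    using a0 am by (auto simp: m'_def)
  have tk: "(k \<longlongrightarrow> k z) (nhds z)"
    using assms(2) by (simp add: continuous_at tendsto_at_iff_tendsto_nhds)
  have "((\<lambda>w. cmod (k w) * m' + cmod (k w - k z) * cmod a) \<longlongrightarrow> cmod (k z) * m' + cmod (k z - k z) * cmod a) (nhds z)"
    by (intro tendsto_intros tk)
  moreover have lt: "cmod (k z) * m' + cmod (k z - k z) * cmod a < cmod (k z) * cmod a"
    using m' assms(3) by simp
  then obtain M where M: "cmod (k z) * m' + cmod (k z - k z) * cmod a < M" "M < cmod (k z) * cmod a"
    using dense by blast
  ultimately have "\<forall>\<^sub>F w in nhds z. cmod (k w) * m' + cmod (k w - k z) * cmod a < M"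
    by (simp add: order_tendsto_iff)
  then have "\<forall>\<^sub>F w in nhds z. cmod (k w * G w - (k z * a) * oriented b (w - z)) \<le> M * cmod (w - z)"
    using ev
  proof eventually_elim
    case (elim w)
    have "k w * G w - (k z * a) * oriented b (w - z)
        = k w * (G w - a * oriented b (w - z)) + (k w - k z) * (a * oriented b (w - z))"
      by (simp add: algebra_simps)
    also have "cmod \<dots> \<le> cmod (k w) * cmod (G w - a * oriented b (w - z)) + cmod (k w - k z) * (cmod a * cmod (w - z))"
      by (rule order_trans[OF norm_triangle_ineq]) (simp add: norm_mult)
    also have "\<dots> \<le> cmod (k w) * (m' * cmod (w - z)) + cmod (k w - k z) * (cmod a * cmod (w - z))"
      using elim(2) m'(3) by (intro add_right_mono mult_left_mono)
         (auto intro: order_trans[OF _ mult_right_mono])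
    also have "\<dots> = (cmod (k w) * m' + cmod (k w - k z) * cmod a) * cmod (w - z)"
      by (simp add: algebra_simps)
    also have "\<dots> \<le> M * cmod (w - z)"
      using elim(1) by (intro mult_right_mono) auto
    finally show ?case .
  qed
  moreover have "M < cmod (k z * a)" using M(2) by (simp add: norm_mult)
  ultimately show ?thesis unfolding simple_zero_def by blast
qed

text \<open>A real-linear map has the form \<open>\<alpha> * w + \<beta> * cnj w\<close>, with
  determinant \<open>(cmod \<alpha>)\<^sup>2 - (cmod \<beta>)\<^sup>2\<close>, which is
  \<open>Im (cnj (L 1) * L \<i>)\<close>. Its sign decides which summand dominates and serves as the
  model; the other one is counted as error.\<close>

lemma simple_zero_derivative:
  assumes "(G has_derivative L) (at z)" "G z = 0" and c: "Im (cnj (L 1) * L \<i>) \<noteq> 0"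
  shows "simple_zero (Im (cnj (L 1) * L \<i>) > 0) G z"
proof -
  define \<alpha> \<beta> where "\<alpha> = (L 1 - \<i> * L \<i>) / 2" and "\<beta> = (L 1 + \<i> * L \<i>) / 2"
  interpret L: bounded_linear L using assms(1) by (rule has_derivative_bounded_linear)
  have L: "L w = \<alpha> * w + \<beta> * cnj w" for w
  proof -
    have "w = Re w *\<^sub>R 1 + Im w *\<^sub>R \<i>" by (simp add: complex_eq_iff)
    then have "L w = Re w *\<^sub>R L 1 + Im w *\<^sub>R L \<i>" by (metis L.add L.scaleR)
    also have "\<dots> = \<alpha> * w + \<beta> * cnj w"
      by (simp add: \<alpha>_def \<beta>_def complex_eq_iff field_simps)
    finally show ?thesis .
  qed
  have sq: "(cmod \<alpha>)\<^sup>2 - (cmod \<beta>)\<^sup>2 = Im (cnj (L 1) * L \<i>)"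
    unfolding cmod_power2 \<alpha>_def \<beta>_def by (simp add: power2_eq_square field_simps)
  define b where "b \<longleftrightarrow> Im (cnj (L 1) * L \<i>) > 0"
  define p q where "p = (if b then \<alpha> else \<beta>)" and "q = (if b then \<beta> else \<alpha>)"
  have "(cmod q)\<^sup>2 < (cmod p)\<^sup>2"
    using sq c unfolding p_def q_def b_def by (cases "Im (cnj (L 1) * L \<i>) > 0") auto
  then have pq: "cmod q < cmod p" by (rule power_less_imp_less_base) simp
  \<comment> \<open>Half of the gap between the two moduli is left for the remainder of the linear
    approximation.\<close>
  define \<delta> where "\<delta> = (cmod p - cmod q) / 2"
  have \<delta>: "\<delta> > 0" "cmod q + \<delta> < cmod p" using pq by (auto simp: \<delta>_def field_simps)
  have "\<exists>d>0. \<forall>w. norm (w - z) < d \<longrightarrow> norm (G w - G z - L (w - z)) \<le> \<delta> * norm (w - z)"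
    using assms(1) \<delta>(1) unfolding has_derivative_at_alt by blast
  then obtain d where d: "d > 0" "\<And>w. norm (w - z) < d \<Longrightarrow> norm (G w - G z - L (w - z)) \<le> \<delta> * norm (w - z)"
    by blast
  have "\<forall>\<^sub>F w in nhds z. cmod (G w - p * oriented b (w - z)) \<le> (cmod q + \<delta>) * cmod (w - z)"
    unfolding eventually_nhds_metric
  proof (intro exI[of _ d] conjI d(1) allI impI)
    fix w assume "dist w z < d"
    then have *: "cmod (G w - L (w - z)) \<le> \<delta> * cmod (w - z)"
      using d(2)[of w] assms(2) by (simp add: dist_norm)
    have "G w - p * oriented b (w - z) = (G w - L (w - z)) + q * oriented (\<not> b) (w - z)"
      by (simp add: L p_def q_def oriented_def algebra_simps)
    also have "cmod \<dots> \<le> \<delta> * cmod (w - z) + cmod q * cmod (w - z)"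
      using * by (intro order_trans[OF norm_triangle_ineq]) (simp add: norm_mult)
    finally show "cmod (G w - p * oriented b (w - z)) \<le> (cmod q + \<delta>) * cmod (w - z)"
      by (simp add: algebra_simps)
  qed
  then show ?thesis unfolding simple_zero_def b_def[symmetric] using \<delta>(2) by blast
qed

text \<open>At another zero near \<open>z\<close> the defining estimate would reduce to
  \<open>cmod a \<le> m\<close>.\<close>

lemma simple_zero_isolated:
  assumes "simple_zero b G z"
  shows "\<forall>\<^sub>F w in at z. G w \<noteq> 0"
proof -
  from assms(1) obtain a m where am: "m < cmod a"
    and ev: "\<forall>\<^sub>F w in nhds z. cmod (G w - a * oriented b (w - z)) \<le> m * cmod (w - z)"
    unfolding simple_zero_def by blast
  have "\<forall>\<^sub>F w in at z. w \<noteq> z" by (simp add: eventually_at_filter)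
  moreover have "\<forall>\<^sub>F w in at z. cmod (G w - a * oriented b (w - z)) \<le> m * cmod (w - z)"
    using ev by (simp add: eventually_at_filter eventually_mono)
  ultimately show ?thesis
  proof eventually_elim
    case (elim w)
    show ?case
    proof
      assume "G w = 0"
      then have "cmod a * cmod (w - z) \<le> m * cmod (w - z)"
        using elim(2) by (simp add: norm_mult)
      then show False using am elim(1) by simp
    qed
  qed
qed

text \<open>Division by the local model \<open>oriented b (w - z)\<close> leaves values near \<open>z\<close> in a disc that
  misses \<open>0\<close>; convexity of the disc allows to replace them by a continuous function.\<close>

lemma remove_simple_zero:
  assumes G: "continuous_on S G" and z: "simple_zero b G z" and U: "open U" "z \<in> U"
  obtains H r where "0 < r" "cball z r \<subseteq> U" "continuous_on S H"
    "\<And>w. w \<in> cball z r \<Longrightarrow> H w \<noteq> 0"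
    "\<And>w. w \<notin> ball z r \<Longrightarrow> G w = H w * oriented b (w - z)"
proof -
  from z obtain a m where am: "m < cmod a"
    and ev: "\<forall>\<^sub>F w in nhds z. cmod (G w - a * oriented b (w - z)) \<le> m * cmod (w - z)"
    unfolding simple_zero_def by blast
  then obtain d where d: "d > 0"
    "\<And>w. dist w z < d \<Longrightarrow> cmod (G w - a * oriented b (w - z)) \<le> m * cmod (w - z)"
    unfolding eventually_nhds_metric by blast
  obtain d' where d': "d' > 0" "ball z d' \<subseteq> U" using U openE by blast
  define r where "r = min d d' / 2"
  have r: "r > 0" "r < d" "r < d'" using d(1) d'(1) by (auto simp: r_def)
  have bd: "cmod (G w / oriented b (w - z) - a) \<le> m" if "w \<in> cball z r" "w \<noteq> z" for w
  proof -
    have "cmod (G w / oriented b (w - z) - a) * cmod (w - z) = cmod (G w - a * oriented b (w - z))"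
    proof -
      have "G w - a * oriented b (w - z) = (G w / oriented b (w - z) - a) * oriented b (w - z)"
        using that(2) by (simp add: field_simps)
      then show ?thesis by (simp add: norm_mult)
    qed
    also have "\<dots> \<le> m * cmod (w - z)" using that r by (intro d) (auto simp: dist_commute)
    finally show ?thesis using that(2) by simp
  qed
  \<comment> \<open>The quotient by the model is bounded near \<open>z\<close> but need not have a
    limit there. The cutoff vanishes at \<open>z\<close>, which makes \<open>H\<close> continuous
    with value \<open>a\<close>, and equals 1 from the circle of radius \<open>r\<close> outwards,
    where \<open>G\<close> has to be recovered exactly.\<close>
  define \<rho> where "\<rho> w = min 1 (cmod (w - z) / r)" for w
  define H where "H w = a + of_real (\<rho> w) * (G w / oriented b (w - z) - a)" for w
  have \<rho>: "0 \<le> \<rho> w" "\<rho> w \<le> 1" for w using r by (auto simp: \<rho>_def)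
  have \<rho>z: "\<rho> z = 0" by (simp add: \<rho>_def)
  have cont\<rho>: "continuous_on A \<rho>" for A unfolding \<rho>_def by (intro continuous_intros) (use r in auto)
  show thesis
  proof
    show "0 < r" by fact
    show "cball z r \<subseteq> U" using r d' by auto
    show "H w \<noteq> 0" if "w \<in> cball z r" for w
    proof (cases "w = z")
      case True
      then have "H w = a" by (simp add: H_def \<rho>z)
      moreover have "a \<noteq> 0" 
      proof
        assume "a = 0"
        have y: "z + of_real r \<in> cball z r" "z + of_real r \<noteq> z"
          using r(1) by (auto simp: dist_norm)
        have "0 \<le> m" by (rule order_trans[OF norm_ge_zero bd[OF y]])
        then show False using am \<open>a = 0\<close> by simp
      qed
      ultimately show ?thesis by simp
    next
      case False
      have "0 \<le> m" by (rule order_trans[OF norm_ge_zero bd[OF that False]])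
      have "cmod (of_real (\<rho> w) * (G w / oriented b (w - z) - a)) \<le> 1 * m"
        unfolding norm_mult using \<rho>[of w] bd[OF that False] by (intro mult_mono) auto
      then have "cmod (of_real (\<rho> w) * (G w / oriented b (w - z) - a)) < cmod a"
        using am by simp
      then show ?thesis
        unfolding H_def by (metis add_eq_0_iff norm_minus_cancel less_irrefl)
    qed
    show "G w = H w * oriented b (w - z)" if "w \<notin> ball z r" for w
    proof -
      have "\<rho> w = 1" using that r by (auto simp: \<rho>_def dist_norm norm_minus_commute)
      moreover have "w \<noteq> z" using that r by auto
      ultimately show ?thesis by (simp add: H_def)
    qed
    show "continuous_on S H"
      unfolding continuous_on_eq_continuous_within
    proof
      fix x assume "x \<in> S"
      show "continuous (at x within S) H"
      proof (cases "x = z")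
        case True
        have "((\<lambda>w. H w - a) \<longlongrightarrow> 0) (at z within S)"
        proof (rule Lim_null_comparison)
          have "\<forall>\<^sub>F w in at z within S. w \<in> cball z r - {z}"
            unfolding eventually_at using r by (auto intro!: exI[of _ r] simp: dist_commute)
          then show "\<forall>\<^sub>F w in at z within S. norm (H w - a) \<le> \<rho> w * \<bar>m\<bar>"
          proof eventually_elim
            case (elim w)
            then have "cmod (G w / oriented b (w - z) - a) \<le> \<bar>m\<bar>" using bd[of w] by auto
            then show ?case using \<rho>[of w] by (simp add: H_def norm_mult mult_left_mono)
          qed
          have "((\<lambda>w. \<rho> w * \<bar>m\<bar>) \<longlongrightarrow> \<rho> z * \<bar>m\<bar>) (at z within S)"
            using cont\<rho>[of UNIV] by (intro tendsto_intros)
              (auto simp: continuous_on_def intro: tendsto_within_subset)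
          then show "((\<lambda>w. \<rho> w * \<bar>m\<bar>) \<longlongrightarrow> 0) (at z within S)" by (simp add: \<rho>z)
        qed
        then have "(H \<longlongrightarrow> a) (at z within S)" by (simp add: LIM_zero_iff)
        moreover have "H z = a" by (simp add: H_def \<rho>z)
        ultimately show ?thesis by (simp add: True continuous_within)
      next
        case False
        have "continuous_on (S - {z}) H"
          unfolding H_def
          by (intro continuous_intros cont\<rho> continuous_on_compose2[OF cont\<rho>] continuous_on_subset[OF G]) auto
        then have "continuous (at x within (S - {z})) H"
          using \<open>x \<in> S\<close> False by (simp add: continuous_on_eq_continuous_within)
        moreover have "at x within (S - {z}) = at x within S"
          using False by (intro at_within_nhd[of x "- {z}"]) auto
        ultimately show ?thesis by simp
      qed
    qed
  qed
qed

text \<open>The zeros are divided out one at a time. The edges see only the product of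
  \<open>H\<close> with the local model, and the model alone winds once in the direction given by
  \<open>b\<close>.\<close>

theorem edge_sum_winding_number:
  assumes "finite Z" "continuous_on triangle G" "\<And>w. w \<in> triangle \<Longrightarrow> G w = 0 \<longleftrightarrow> w \<in> Z"
    and "Z \<subseteq> interior triangle" and "\<And>z. z \<in> Z \<Longrightarrow> simple_zero (b z) G z"
  shows "edge_sum (\<lambda>e. winding_number (G \<circ> e) 0) = (\<Sum>z\<in>Z. if b z then 1 else -1)"
  using assms
proof (induction Z arbitrary: G rule: finite_induct)
  case empty
  then show ?case using edge_sum_winding_nonzero[of G] by (simp add: o_def)
next
  case (insert z Z)
  have "open (interior triangle - Z)"
    by (simp add: open_Diff finite_imp_closed insert.hyps(1))
  moreover have "z \<in> interior triangle - Z"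
    using insert.hyps(2) insert.prems(3) by simp
  ultimately obtain H r where r: "0 < r" "cball z r \<subseteq> interior triangle - Z"
    and H: "continuous_on triangle H" "\<And>w. w \<in> cball z r \<Longrightarrow> H w \<noteq> 0"
    and GH: "\<And>w. w \<notin> ball z r \<Longrightarrow> G w = H w * oriented (b z) (w - z)"
    by (rule remove_simple_zero[OF insert.prems(1) insert.prems(4)[OF insertI1]]) (rule that)
  have out: "H w = 0 \<longleftrightarrow> w \<in> Z" if "w \<in> triangle" for w
  proof (cases "w \<in> cball z r")
    case True
    then show ?thesis using H(2) r(2) by auto
  next
    case False
    then have "w \<noteq> z" "G w = H w * oriented (b z) (w - z)" using GH[of w] r(1) by auto
    then show ?thesis using insert.prems(2)[OF that] by auto
  qed
  \<comment> \<open>Near the remaining zeros \<open>H\<close> is \<open>G\<close> divided by a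
    continuous function without zeros, so the local degrees persist.\<close>
  have sz: "simple_zero (b y) H y" if "y \<in> Z" for y
  proof -
    have y: "y \<notin> cball z r" "y \<noteq> z" using that r insert.hyps(2) by auto
    have *: "continuous (at y) (\<lambda>w. 1 / oriented (b z) (w - z))"
      using y(2) unfolding oriented_def by (cases "b z") (auto intro!: continuous_intros)
    have "simple_zero (b y) (\<lambda>w. 1 / oriented (b z) (w - z) * G w) y"
      using insert.prems(4)[of y] that y(2) by (intro simple_zero_mult *) auto
    moreover have "\<forall>\<^sub>F w in nhds y. 1 / oriented (b z) (w - z) * G w = H w"
    proof (rule eventually_nhds_in_open[of "- cball z r" y, THEN eventually_mono])
      fix w assume "w \<in> - cball z r"
      then have "w \<noteq> z" "G w = H w * oriented (b z) (w - z)" using GH[of w] r(1) by auto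
      then show "1 / oriented (b z) (w - z) * G w = H w" by simp
    qed (use y in auto)
    ultimately show ?thesis by (rule simple_zero_transform)
  qed
  have "edge_sum (\<lambda>e. winding_number (H \<circ> e) 0) = (\<Sum>z\<in>Z. if b z then 1 else -1)"
    using insert.prems(3) sz out H(1) by (intro insert.IH) auto
  moreover have "edge_sum (\<lambda>e. winding_number (\<lambda>t. oriented (b z) (e t - z)) 0) = (if b z then 1 else - 1)"
    using edge_sum_winding_diff[of z] edge_sum_winding_cnj_diff[of z] insert.prems(3)
    by (simp add: oriented_def)
  moreover have "edge_sum (\<lambda>e. winding_number (G \<circ> e) 0) =
      edge_sum (\<lambda>e. winding_number (H \<circ> e) 0 + winding_number (\<lambda>t. oriented (b z) (e t - z)) 0)"
  proof (rule edge_sum_cong)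
    fix e assume e: "e \<in> triangle_edges"
    have m: "e t \<in> triangle" "e t \<notin> interior triangle" if "t \<in> {0..1}" for t
      using triangle_edge_mem[OF e that] by auto
    have "winding_number (G \<circ> e) 0 = winding_number (\<lambda>t. (H \<circ> e) t * oriented (b z) (e t - z)) 0"
    proof (rule winding_number_cong)
      fix t :: real assume "0 \<le> t" "t \<le> 1"
      then have "e t \<notin> ball z r" using m[of t] r(2) by force
      then show "(G \<circ> e) t = (H \<circ> e) t * oriented (b z) (e t - z)" by (simp add: GH)
    qed
    also have "\<dots> = winding_number (H \<circ> e) 0 + winding_number (\<lambda>t. oriented (b z) (e t - z)) 0"
    proof (rule winding_number_mult)
      show "continuous_on {0..1} (H \<circ> e)"
        using m by (intro continuous_on_compose triangle_edge_continuous[OF e] continuous_on_subset[OF H(1)]) auto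
      show "(H \<circ> e) t \<noteq> 0" if "t \<in> {0..1}" for t
        using out[OF m(1)[OF that]] m(2)[OF that] insert.prems(3) by auto
      show "continuous_on {0..1} (\<lambda>t. oriented (b z) (e t - z))"
        by (intro continuous_intros triangle_edge_continuous[OF e])
      show "oriented (b z) (e t - z) \<noteq> 0" if "t \<in> {0..1}" for t
        using m(2)[OF that] insert.prems(3) by auto
    qed
    finally show "winding_number (G \<circ> e) 0 =
        winding_number (H \<circ> e) 0 + winding_number (\<lambda>t. oriented (b z) (e t - z)) 0" .
  qed
  ultimately show ?case using insert.hyps by (simp add: edge_sum_add o_def)
qed

section \<open>A section of degree one on the torus\<close>

text \<open>\<open>quasi_theta\<close> is a section of the line bundle of degree \<open>1\<close> on the torus \<open>\<real>\<^sup>2 / \<int>\<^sup>2\<close> with a single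
  zero. It is the theta series with the Gaussian replaced by the tent function
  \<open>x \<mapsto> max 0 (1 - \<bar>x\<bar>)\<close>, so that at most two terms of the series are nonzero.\<close>

definition strip_theta :: "real \<Rightarrow> real \<Rightarrow> complex" where
  "strip_theta y t = exp (2 * pi * \<i> * (y + 1/2) * t) *
     ((1/2 - t) * exp (\<i> * pi * y) - (1/2 + t) * exp (- (\<i> * pi * y)))"

definition quasi_theta :: "real \<Rightarrow> real \<Rightarrow> complex" where
  "quasi_theta y t = strip_theta y (t - of_int (round t))"

lemma exp_two_pi_int: "exp (of_int n * (2 * of_real pi * \<i>)) = 1"
  using exp_integer_2pi[of "of_int n"] by (simp add: mult_ac)

lemma exp_pi_i_int: "exp (- (\<i> * pi * of_int n)) = exp (\<i> * pi * of_int n)"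
proof -
  have "exp (\<i> * pi * of_int n) = exp (- (\<i> * pi * of_int n) + of_int n * (2 * of_real pi * \<i>))"
    by (rule arg_cong[where f = exp]) (simp add: algebra_simps)
  also have "\<dots> = exp (- (\<i> * pi * of_int n))" unfolding exp_add exp_two_pi_int by simp
  finally show ?thesis by simp
qed

text \<open>At either end only one of the two terms survives, and both values are
  \<open>- \<i>\<close>. The summand 1/2 in \<open>y + 1/2\<close> serves this purpose: without it
  the two ends would differ by a sign and the strips would not glue.\<close>

lemma strip_theta_ends: "strip_theta y (1/2) = strip_theta y (- (1/2))"
proof -
  have "strip_theta y (1/2) = - (exp (\<i> * pi * (y + 1/2)) * exp (- (\<i> * pi * y)))"
    by (simp add: strip_theta_def algebra_simps)
  also have "exp (\<i> * pi * (y + 1/2)) * exp (- (\<i> * pi * y)) = exp (of_real (pi/2) * \<i>)"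
    by (simp add: exp_add[symmetric] algebra_simps)
  also have "\<dots> = \<i>" by (metis cis_conv_exp cis_pi_half mult.commute)
  finally have 1: "strip_theta y (1/2) = - \<i>" .
  have "strip_theta y (- (1/2)) = exp (- (\<i> * pi * (y + 1/2))) * exp (\<i> * pi * y)"
    by (simp add: strip_theta_def algebra_simps)
  also have "\<dots> = exp (of_real (- pi/2) * \<i>)"
    by (simp add: exp_add[symmetric] algebra_simps)
  also have "\<dots> = - \<i>" 
    using cis_conv_exp[of "- pi/2"] by (simp add: mult.commute cis.ctr complex_eq_iff)
  finally show ?thesis using 1 by simp
qed

lemma quasi_theta_shift_t: "quasi_theta y (t + of_int m) = quasi_theta y t"
proof -
  have "\<lfloor>t + 1/2 + of_int m\<rfloor> = \<lfloor>t + 1/2\<rfloor> + m" by (rule floor_add_int[symmetric])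
  then have "round (t + of_int m) = round t + m" by (simp add: round_def add_ac)
  then show ?thesis by (simp add: quasi_theta_def)
qed

text \<open>This multiplier is the factor of automorphy of a degree one bundle. It may be written
  with \<open>t\<close> although \<open>strip_theta\<close> only sees \<open>t - round t\<close>,
  since the discrepancy is the exponential of an integer multiple of
  \<open>2 * pi * \<i>\<close>.\<close>

lemma quasi_theta_shift_y:
  "quasi_theta (y + of_int n) t = exp (2 * pi * \<i> * of_int n * (t + 1/2)) * quasi_theta y t"
proof -
  define t0 where "t0 = t - of_int (round t)"
  have "strip_theta (y + of_int n) t0
      = exp (2 * pi * \<i> * of_int n * t0) * exp (\<i> * pi * of_int n) * strip_theta y t0"
  proof -
    have a: "exp (2 * pi * \<i> * (of_real (y + of_int n) + 1/2) * t0)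
        = exp (2 * pi * \<i> * of_int n * t0) * exp (2 * pi * \<i> * (y + 1/2) * t0)"
      by (simp add: exp_add[symmetric] algebra_simps)
    have b: "exp (\<i> * pi * of_real (y + of_int n)) = exp (\<i> * pi * of_int n) * exp (\<i> * pi * y)"
      by (simp add: exp_add[symmetric] algebra_simps)
    have c: "exp (- (\<i> * pi * of_real (y + of_int n))) = exp (\<i> * pi * of_int n) * exp (- (\<i> * pi * y))"
      unfolding exp_pi_i_int[symmetric] by (simp add: exp_add[symmetric] algebra_simps)
    show ?thesis unfolding strip_theta_def a b c by (simp add: algebra_simps)
  qed
  also have "exp (2 * pi * \<i> * of_int n * t0) * exp (\<i> * pi * of_int n)
      = exp (2 * pi * \<i> * of_int n * (t + 1/2)) * exp (2 * of_int (- n * round t) * pi * \<i>)"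
    by (simp add: t0_def exp_add[symmetric] algebra_simps)
  also have "exp (2 * of_int (- n * round t) * pi * \<i>) = 1"
    using exp_integer_2pi[of "of_int (- n * round t)"] by (metis Ints_of_int mult.assoc mult.commute of_real_of_int_eq)
  finally show ?thesis by (simp add: quasi_theta_def t0_def)
qed

text \<open>For real \<open>y\<close> both exponentials have modulus 1. If the two terms cancel,
  their weights \<open>1/2 - t\<close> and \<open>1/2 + t\<close> have equal absolute value, so
  \<open>t = 0\<close>; then the exponentials themselves agree.\<close>

lemma strip_theta_eq_0: "strip_theta y t = 0 \<longleftrightarrow> t = 0 \<and> y \<in> \<int>"
proof -
  have "strip_theta y t = 0 \<longleftrightarrow> (1/2 - t) * exp (\<i> * pi * y) = (1/2 + t) * exp (- (\<i> * pi * y))"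
    by (simp add: strip_theta_def)
  also have "\<dots> \<longleftrightarrow> t = 0 \<and> exp (\<i> * pi * y) = exp (- (\<i> * pi * y))"
  proof safe
    assume eq: "(1/2 - t) * exp (\<i> * pi * y) = (1/2 + t) * exp (- (\<i> * pi * y))"
    have "(1/2 - complex_of_real t) = of_real (1/2 - t)" "(1/2 + complex_of_real t) = of_real (1/2 + t)"
      by simp_all
    then have "\<bar>1/2 - t\<bar> = \<bar>1/2 + t\<bar>"
      using arg_cong[OF eq, of cmod] by (simp only: norm_mult norm_of_real) simp
    then show "t = 0" by linarith
    then show "exp (\<i> * pi * y) = exp (- (\<i> * pi * y))" using eq by simp
  qed simp
  also have "exp (\<i> * pi * y) = exp (- (\<i> * pi * y)) \<longleftrightarrow> exp (2 * of_real y * pi * \<i>) = 1"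
    by (simp add: exp_minus field_simps exp_add[symmetric])
  also have "\<dots> \<longleftrightarrow> y \<in> \<int>"
    using exp_integer_2pi_plus1 unfolding exp_eq_1
    by (auto simp: Ints_def)
  finally show ?thesis .
qed

lemma quasi_theta_eq_0: "quasi_theta y t = 0 \<longleftrightarrow> y \<in> \<int> \<and> t \<in> \<int>"
  unfolding quasi_theta_def strip_theta_eq_0
  by (metis Ints_of_int eq_iff_diff_eq_0 round_of_int Ints_cases)

lemma continuous_on_strip_theta: "continuous_on A (\<lambda>(y, t). strip_theta y t)"
  unfolding strip_theta_def case_prod_beta by (intro continuous_intros)

text \<open>Closed strips are needed for pasting. At the upper end \<open>round\<close> already
  jumps to \<open>k + 1\<close>, but the value does not change by
  \<open>strip_theta_ends\<close>.\<close>

lemma quasi_theta_eq_strip: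
  assumes "of_int k - 1/2 \<le> t" "t \<le> of_int k + 1/2"
  shows "quasi_theta y t = strip_theta y (t - of_int k)"
proof (cases "t = of_int k + 1/2")
  case True
  then have "round t = k + 1" by (simp add: round_def)
  then show ?thesis using True strip_theta_ends[of y] by (simp add: quasi_theta_def)
next
  case False
  then have "round t = k" using assms unfolding round_def by (intro floor_unique) auto
  then show ?thesis by (simp add: quasi_theta_def)
qed

lemma continuous_on_quasi_theta: "continuous_on UNIV (\<lambda>(y, t). quasi_theta y t)"
proof -
  have strip: "continuous_on (UNIV \<times> {of_int k - 1/2 .. of_int k + 1/2}) (\<lambda>(y, t). quasi_theta y t)" for k
  proof -
    have "continuous_on (UNIV \<times> {of_int k - 1/2 .. of_int k + 1/2}) (\<lambda>x. strip_theta (fst x) (snd x - of_int k))"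
      using continuous_on_compose2[OF continuous_on_strip_theta[of UNIV], of _ "\<lambda>x. (fst x, snd x - of_int k)"]
      by (simp add: continuous_intros)
    then show ?thesis
      by (rule continuous_on_eq) (auto simp: quasi_theta_eq_strip)
  qed
  have "isCont (\<lambda>(y, t). quasi_theta y t) p" for p
  proof -
    obtain y0 t0 where p: "p = (y0, t0)" by fastforce
    define k where "k = \<lfloor>t0\<rfloor>"
    let ?A = "UNIV \<times> {of_int k - 1/2 .. of_int k + 1/2} :: (real \<times> real) set"
    let ?B = "UNIV \<times> {of_int (k + 1) - 1/2 .. of_int (k + 1) + 1/2} :: (real \<times> real) set"
    let ?U = "UNIV \<times> {of_int k - 1/2 <..< of_int k + 3/2} :: (real \<times> real) set"
    have "continuous_on (?A \<union> ?B) (\<lambda>(y, t). quasi_theta y t)"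
      by (intro continuous_on_closed_Un strip closed_Times) auto
    then have "continuous_on ?U (\<lambda>(y, t). quasi_theta y t)"
      by (rule continuous_on_subset) auto
    moreover have "open ?U" by (intro open_Times) auto
    moreover have "p \<in> ?U" unfolding p k_def by (simp; linarith)
    ultimately show ?thesis using continuous_on_eq_continuous_at by blast
  qed
  then show ?thesis by (simp add: continuous_at_imp_continuous_on)
qed

lemma has_derivative_nhds_cong:
  assumes "(f has_derivative D) (at x)" "\<forall>\<^sub>F y in nhds x. f y = g y"
  shows "(g has_derivative D) (at x)"
proof (rule has_derivative_transform_eventually[OF assms(1)])
  show "\<forall>\<^sub>F y in at x. f y = g y"
    using assms(2) by (simp add: eventually_at_filter eventually_mono)
  show "f x = g x" using assms(2) by (rule eventually_nhds_x_imp_x)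
qed simp

lemma has_derivative_cexp:
  fixes g :: "'a::real_normed_vector \<Rightarrow> complex"
  assumes "(g has_derivative g') (at x)"
  shows "((\<lambda>x. exp (g x)) has_derivative (\<lambda>h. exp (g x) * g' h)) (at x)"
  using has_derivative_compose[OF assms DERIV_exp[unfolded has_field_derivative_def]] by simp

text \<open>At a lattice point the bracket of \<open>strip_theta\<close> vanishes, so the
  exponential in front of it enters the product rule only through its value, which is 1
  there.\<close>

lemma has_derivative_quasi_theta:
  "((\<lambda>x. quasi_theta (fst x) (snd x)) has_derivative
     (\<lambda>h. exp (\<i> * pi * of_int n) * (\<i> * pi * of_real (fst h) - 2 * of_real (snd h)))) (at (of_int n, of_int m))"
proof -
  define e where "e = exp (\<i> * pi * of_int n)"
  have e': "exp (- (\<i> * pi * of_int n)) = e" by (simp add: e_def exp_pi_i_int)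
  let ?f = "\<lambda>x::real \<times> real. exp (2 * pi * \<i> * (of_real (fst x) + 1/2) * (of_real (snd x) - of_int m))"
  let ?g = "\<lambda>x::real \<times> real. (1/2 - (of_real (snd x) - of_int m)) * exp (\<i> * pi * of_real (fst x)) -
      (1/2 + (of_real (snd x) - of_int m)) * exp (- (\<i> * pi * of_real (fst x)))"
  have g: "(?g has_derivative (\<lambda>h. e * (\<i> * pi * of_real (fst h) - 2 * of_real (snd h)))) (at (of_int n, of_int m))"
    apply (rule has_derivative_eq_rhs)
     apply (rule derivative_intros has_derivative_cexp)+
    apply (simp only: fst_conv snd_conv of_real_of_int_eq e' e_def[symmetric])
    apply (simp add: fun_eq_iff algebra_simps)
    done
  have f: "?f differentiable (at (of_int n, of_int m))"
    unfolding differentiable_def by (rule exI) (rule derivative_intros has_derivative_cexp)+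
  then obtain f' where f: "(?f has_derivative f') (at (of_int n, of_int m))"
    unfolding differentiable_def by blast
  have "((\<lambda>x. strip_theta (fst x) (snd x - of_int m)) has_derivative
     (\<lambda>h. e * (\<i> * pi * of_real (fst h) - 2 * of_real (snd h)))) (at (of_int n, of_int m))"
    using has_derivative_mult[OF f g] by (simp add: strip_theta_def e' e_def[symmetric])
  moreover have "\<forall>\<^sub>F x in nhds (of_int n, of_int m).
      strip_theta (fst x) (snd x - of_int m) = quasi_theta (fst x) (snd x)"
  proof (rule eventually_nhds_in_open[of "UNIV \<times> {of_int m - 1/2 <..< of_int m + 1/2}", THEN eventually_mono])
  qed (auto simp: quasi_theta_eq_strip[of m] open_Times)
  ultimately show ?thesis
    unfolding e_def by (rule has_derivative_nhds_cong)
qed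

text \<open>For \<open>t0 \<noteq> 0\<close> the dominant of the two terms is pulled out of the
  bracket. What remains is \<open>1 - r * exp (...)\<close> with \<open>r < 1\<close>; it stays in
  the right half plane and returns to its start, so it does not wind. The outer exponential
  contributes \<open>n * t0\<close> and the extracted one \<open>- n * sgn t0 / 2\<close>. For
  \<open>t0 = 0\<close> the loop is constant.\<close>

lemma winding_number_quasi_theta:
  fixes y t :: real and n :: int
  defines "t0 \<equiv> t - of_int (round t)"
  assumes n: "t0 = 0 \<Longrightarrow> n = 0" and nz: "\<not> (y \<in> \<int> \<and> t \<in> \<int>)"
  shows "winding_number (\<lambda>s. quasi_theta (y + s * of_int n) t) 0 = of_real (of_int n * (t0 - sgn t0 / 2))"
proof (cases "t0 = 0")
  case True
  then have "winding_number (\<lambda>s. quasi_theta (y + s * of_int n) t) 0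
      = (Ln (quasi_theta y t) - Ln (quasi_theta y t)) / (2 * of_real pi * \<i>)"
    using n nz by (intro winding_number_exp) (auto simp: quasi_theta_eq_0)
  then show ?thesis using True n by simp
next
  case False
  have t0: "\<bar>t0\<bar> \<le> 1/2" using of_int_round_abs_le[of t] by (simp add: t0_def abs_minus_commute)
  define \<epsilon> where "\<epsilon> = sgn t0"
  have \<epsilon>: "\<epsilon> = 1 \<and> t0 > 0 \<or> \<epsilon> = -1 \<and> t0 < 0" using False by (auto simp: \<epsilon>_def sgn_if)
  \<comment> \<open>The ratio of the smaller to the larger of the weights \<open>1/2 - t0\<close>
    and \<open>1/2 + t0\<close>.\<close>
  define r where "r = (1/2 - \<bar>t0\<bar>) / (1/2 + \<bar>t0\<bar>)"
  have r: "0 \<le> r" "r < 1" using t0 False by (auto simp: r_def divide_simps)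
  let ?y = "\<lambda>s. y + s * of_int n"
  let ?w = "\<lambda>s. 1 - r * exp (\<epsilon> * 2 * pi * \<i> * ?y s)"
  have re: "Re (?w s) > 0" for s
  proof -
    have "Re (r * exp (\<epsilon> * 2 * pi * \<i> * ?y s)) \<le> cmod (r * exp (\<epsilon> * 2 * pi * \<i> * ?y s))"
      by (rule complex_Re_le_cmod)
    also have "\<dots> = r" using r by (simp add: norm_mult)
    finally show ?thesis using r(2) by simp
  qed
  have strip: "strip_theta (?y s) t0 = exp (2 * pi * \<i> * (of_real (?y s) + 1/2) * t0) *
      (exp (- (\<epsilon> * \<i> * pi * of_real (?y s))) * (of_real (- \<epsilon> * (1/2 + \<bar>t0\<bar>)) * ?w s))" for s
  proof -
    define E F where "E = exp (\<i> * pi * of_real (?y s))" and "F = exp (- (\<i> * pi * of_real (?y s)))"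
    have EF: "E * F = 1" by (simp add: E_def F_def exp_minus)
    have sq: "exp (2 * pi * \<i> * of_real (?y s)) = E * E" "exp (- (2 * pi * \<i> * of_real (?y s))) = F * F"
      unfolding E_def F_def exp_add[symmetric] by (rule arg_cong[where f = exp], simp add: algebra_simps)+
    have "(1/2 + \<bar>t0\<bar>) * r = 1/2 - \<bar>t0\<bar>"
    proof -
      have "1/2 + \<bar>t0\<bar> \<noteq> 0" using abs_ge_zero[of t0] by linarith
      then show ?thesis unfolding r_def by simp
    qed
    then have r': "complex_of_real (1/2 + \<bar>t0\<bar>) * r = of_real (1/2 - \<bar>t0\<bar>)"
      by (metis of_real_mult)
    have "of_real (1/2 + \<bar>t0\<bar>) * ?w s
        = of_real (1/2 + \<bar>t0\<bar>) - of_real (1/2 - \<bar>t0\<bar>) * exp (\<epsilon> * 2 * pi * \<i> * of_real (?y s))"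
      unfolding right_diff_distrib mult.assoc[symmetric] r' by simp
    moreover have "exp (\<epsilon> * 2 * pi * \<i> * of_real (?y s)) = (if t0 > 0 then E * E else F * F)"
      using \<epsilon> sq by (auto simp: mult.assoc)
    ultimately have w: "of_real (1/2 + \<bar>t0\<bar>) * ?w s
        = of_real (1/2 + \<bar>t0\<bar>) - of_real (1/2 - \<bar>t0\<bar>) * (if t0 > 0 then E * E else F * F)"
      by simp
    have G: "exp (- (\<epsilon> * \<i> * pi * of_real (?y s))) = (if t0 > 0 then F else E)"
      using \<epsilon> by (auto simp: E_def F_def)
    have EEF: "F * (E * E) = E" "E * (F * F) = F" using EF by (simp_all add: algebra_simps)
    have "exp (- (\<epsilon> * \<i> * pi * of_real (?y s))) * (of_real (- \<epsilon> * (1/2 + \<bar>t0\<bar>)) * ?w s)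
       = of_real (- \<epsilon>) * ((if t0 > 0 then F else E) * (of_real (1/2 + \<bar>t0\<bar>) * ?w s))"
      unfolding G of_real_mult by (simp only: mult_ac)
    also have "\<dots> = (1/2 - of_real t0) * E - (1/2 + of_real t0) * F"
      unfolding w using \<epsilon>
    proof (elim disjE conjE)
      assume "\<epsilon> = 1" "t0 > 0"
      then show "of_real (- \<epsilon>) * ((if t0 > 0 then F else E) * (of_real (1/2 + \<bar>t0\<bar>) -
          of_real (1/2 - \<bar>t0\<bar>) * (if t0 > 0 then E * E else F * F))) = (1/2 - of_real t0) * E - (1/2 + of_real t0) * F"
        using EEF(1) by (simp add: right_diff_distrib mult.left_commute[of F _ "E * E"])
    next
      assume "\<epsilon> = -1" "t0 < 0"
      then show "of_real (- \<epsilon>) * ((if t0 > 0 then F else E) * (of_real (1/2 + \<bar>t0\<bar>) -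
          of_real (1/2 - \<bar>t0\<bar>) * (if t0 > 0 then E * E else F * F))) = (1/2 - of_real t0) * E - (1/2 + of_real t0) * F"
        by (simp add: right_diff_distrib mult.left_commute[of E _ "F * F"] EEF(2) del: mult_cancel_left mult_cancel_right)
          (simp add: algebra_simps)
    qed
    finally have "exp (- (\<epsilon> * \<i> * pi * of_real (?y s))) * (of_real (- \<epsilon> * (1/2 + \<bar>t0\<bar>)) * ?w s)
       = (1/2 - of_real t0) * E - (1/2 + of_real t0) * F" .
    then show ?thesis by (simp only: strip_theta_def E_def F_def)
  qed
  define h where "h s = 2 * pi * \<i> * (of_real (?y s) + 1/2) * t0 + (- (\<epsilon> * \<i> * pi * of_real (?y s))
      + (Ln (of_real (- \<epsilon> * (1/2 + \<bar>t0\<bar>))) + Ln (?w s)))" for s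
  have wn: "winding_number (\<lambda>s. quasi_theta (?y s) t) 0 = (h 1 - h 0) / (2 * of_real pi * \<i>)"
  proof (rule winding_number_exp)
    show "continuous_on {0..1} h"
      unfolding h_def using re by (intro continuous_intros) (auto simp: complex_nonpos_Reals_iff not_le)
    fix s
    have "complex_of_real (- \<epsilon> * (1/2 + \<bar>t0\<bar>)) \<noteq> 0"
      unfolding of_real_eq_0_iff using \<epsilon> by auto
    moreover have "?w s \<noteq> 0" using re[of s] by (metis less_irrefl zero_complex.sel(1))
    ultimately show "quasi_theta (?y s) t = exp (h s)"
      unfolding quasi_theta_def t0_def[symmetric] strip h_def exp_add by (simp only: exp_Ln not_False_eq_True)
  qed
  have weq: "?w 1 = ?w 0"
  proof -
    obtain k :: int where k: "\<epsilon> = of_int k" using \<epsilon> by (metis of_int_1 of_int_minus)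
    have "exp (\<epsilon> * 2 * pi * \<i> * of_real (?y 1))
        = exp (\<epsilon> * 2 * pi * \<i> * of_real (?y 0) + of_int (k * n) * (2 * of_real pi * \<i>))"
      by (rule arg_cong[where f = exp]) (simp add: k algebra_simps)
    then show ?thesis unfolding exp_add exp_two_pi_int by simp
  qed
  have "h 1 - h 0 = 2 * of_real pi * \<i> * of_real (of_int n * (t0 - \<epsilon> / 2))"
    unfolding h_def weq by (simp add: algebra_simps)
  then show ?thesis unfolding wn by (simp add: \<epsilon>_def)
qed

text \<open>The source of the sign in the theorem: on \<open>0 < t0 < 1/2\<close> the sawtooth is
  negative and the sine positive, on \<open>- 1/2 < t0 < 0\<close> the signs are interchanged, and
  at \<open>t0 = 1/2\<close> and \<open>t0 = - 1/2\<close> both vanish.\<close>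

lemma sin_sawtooth:
  fixes c t :: real
  assumes "c \<ge> 0"
  defines "t0 \<equiv> t - of_int (round t)"
  shows "c * sin (2 * pi * t) * (t0 - sgn t0 / 2) \<le> 0"
    and "c > 0 \<Longrightarrow> sin (2 * pi * t) \<noteq> 0 \<Longrightarrow> c * sin (2 * pi * t) * (t0 - sgn t0 / 2) < 0"
    and "t0 = 0 \<Longrightarrow> sin (2 * pi * t) = 0"
proof -
  have t0: "\<bar>t0\<bar> \<le> 1/2" using of_int_round_abs_le[of t] by (simp add: t0_def abs_minus_commute)
  have eq: "sin (2 * pi * t) = sin (2 * pi * t0)"
  proof -
    have "2 * pi * t = 2 * pi * t0 + 2 * pi * of_int (round t)" by (simp add: t0_def algebra_simps)
    then show ?thesis by (simp add: sin_add sin_int_2pin cos_int_2pin)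
  qed
  show "t0 = 0 \<Longrightarrow> sin (2 * pi * t) = 0" using eq by simp
  have pos: "0 \<le> sin (2 * pi * t0)" "t0 - sgn t0 / 2 \<le> 0" "t0 < 1/2 \<Longrightarrow> t0 - sgn t0 / 2 < 0" if "t0 > 0"
    using that t0 by (auto intro!: sin_ge_zero)
  have neg: "sin (2 * pi * t0) \<le> 0" "0 \<le> t0 - sgn t0 / 2" "- 1/2 < t0 \<Longrightarrow> 0 < t0 - sgn t0 / 2" if "t0 < 0"
  proof -
    have "2 * pi * (- t0) \<le> pi * 1" using that t0 by (subst mult.commute[of 2], subst mult.assoc) (intro mult_left_mono, auto)
    then have "0 \<le> sin (2 * pi * (- t0))" using that by (intro sin_ge_zero) (auto simp: mult_le_0_iff)
    then show "sin (2 * pi * t0) \<le> 0" by simp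
  qed (use that t0 in auto)
  have le: "sin (2 * pi * t0) * (t0 - sgn t0 / 2) \<le> 0"
    using pos neg by (cases t0 "0::real" rule: linorder_cases) (auto simp: mult_le_0_iff)
  then show "c * sin (2 * pi * t) * (t0 - sgn t0 / 2) \<le> 0"
    using assms(1) unfolding eq by (simp add: mult.assoc mult_nonneg_nonpos)
  assume c: "c > 0" and nz: "sin (2 * pi * t) \<noteq> 0"
  have "t0 - sgn t0 / 2 \<noteq> 0"
  proof
    assume "t0 - sgn t0 / 2 = 0"
    then have "t0 = 0 \<or> t0 = 1/2 \<or> t0 = -1/2" by (auto simp: sgn_if split: if_splits)
    then have "2 * pi * t0 = 0 \<or> 2 * pi * t0 = pi \<or> 2 * pi * t0 = - pi" by auto
    then have "sin (2 * pi * t0) = 0" by (elim disjE) (simp_all only: sin_pi sin_zero sin_minus minus_zero)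
    then show False using nz eq by simp
  qed
  then have "sin (2 * pi * t0) * (t0 - sgn t0 / 2) < 0"
    using le nz eq by (metis mult_eq_0_iff order_less_le)
  then show "c * sin (2 * pi * t) * (t0 - sgn t0 / 2) < 0"
    using c unfolding eq by (simp add: mult.assoc mult_pos_neg)
qed

section \<open>The lattice of translations\<close>

text \<open>The signed area of the parallelogram spanned by \<open>x\<close> and \<open>y\<close>,
  that is, their determinant.\<close>

definition wedge :: "complex \<Rightarrow> complex \<Rightarrow> real" where
  "wedge x y = Im (cnj x * y)"

lemma wedge_simps:
  "wedge (x + y) z = wedge x z + wedge y z" "wedge z (x + y) = wedge z x + wedge z y"
  "wedge (x - y) z = wedge x z - wedge y z" "wedge z (x - y) = wedge z x - wedge z y"
  "wedge (- x) z = - wedge x z" "wedge z (- x) = - wedge z x" "wedge 0 z = 0" "wedge z 0 = 0"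
  "wedge (of_real r * x) z = r * wedge x z" "wedge z (of_real r * x) = r * wedge z x" "wedge x x = 0"
  by (simp_all add: wedge_def algebra_simps)

lemma wedge_of_int: "wedge (of_int k * x) z = k * wedge x z" "wedge z (of_int k * x) = k * wedge z x"
  by (simp_all add: wedge_def algebra_simps)

lemma wedge_commute: "wedge y x = - wedge x y"
  by (simp add: wedge_def)

lemma wedge_sum: "wedge (sum f I) z = (\<Sum>i\<in>I. wedge (f i) z)"
  by (induction I rule: infinite_finite_induct) (simp_all add: wedge_simps)

lemma wedge_rotate: "cmod a = 1 \<Longrightarrow> wedge (a * x) (a * y) = wedge x y"
proof -
  assume "cmod a = 1"
  then have "cnj a * a = 1" using complex_norm_square[of a] by (simp add: mult.commute)
  moreover have "cnj (a * x) * (a * y) = (cnj a * a) * (cnj x * y)" by (simp add: mult_ac)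
  ultimately show ?thesis by (simp only: wedge_def mult_1_left)
qed

lemma wedge_le: "\<bar>wedge x y\<bar> \<le> cmod x * cmod y"
  unfolding wedge_def by (rule order_trans[OF abs_Im_le_cmod]) (simp add: norm_mult)

lemma wedge_cis: "wedge (cis s) (cis t) = sin (t - s)"
  by (simp add: wedge_def sin_diff)

lemma wedge_eq_0_imp:
  assumes "wedge x y = 0" "x \<noteq> 0"
  obtains r :: real where "y = of_real r * x"
proof
  define c where "c = Re (cnj x * y)"
  have c: "cnj x * y = of_real c"
    using assms(1) by (simp add: wedge_def c_def complex_eq_iff)
  have "y * of_real ((cmod x)\<^sup>2) = x * (cnj x * y)" by (simp only: complex_norm_square mult_ac)
  then have "y * of_real ((cmod x)\<^sup>2) = x * of_real c" by (simp only: c)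
  then show "y = of_real (c / (cmod x)\<^sup>2) * x"
    using assms(2) by (simp add: field_simps)
qed

lemma independent_imp_wedge: "w\<^sub>1 \<noteq> w\<^sub>2 \<Longrightarrow> independent {w\<^sub>1, w\<^sub>2} \<Longrightarrow> wedge w\<^sub>1 w\<^sub>2 \<noteq> 0"
proof
  assume ind: "w\<^sub>1 \<noteq> w\<^sub>2" "independent {w\<^sub>1, w\<^sub>2}" and "wedge w\<^sub>1 w\<^sub>2 = 0"
  have "w\<^sub>1 \<noteq> 0" using ind(2) dependent_zero[of "{w\<^sub>1, w\<^sub>2}"] by auto
  then obtain r where "w\<^sub>2 = of_real r * w\<^sub>1"
    using wedge_eq_0_imp \<open>wedge w\<^sub>1 w\<^sub>2 = 0\<close> by blast
  then have "w\<^sub>2 \<in> span {w\<^sub>1}" by (metis scaleR_conv_of_real span_base span_scale singletonI)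
  moreover have "w\<^sub>2 \<notin> span {w\<^sub>1}"
    using ind independent_insert[of w\<^sub>2 "{w\<^sub>1}"] by (simp add: insert_commute)
  ultimately show False by simp
qed

lemma affine_eq_iff:
  fixes a b a' b' :: complex
  shows "(\<lambda>z. a * z + b) = (\<lambda>z. a' * z + b') \<longleftrightarrow> a = a' \<and> b = b'"
proof
  assume eq: "(\<lambda>z. a * z + b) = (\<lambda>z. a' * z + b')"
  from fun_cong[OF eq, of 0] fun_cong[OF eq, of 1] show "a = a' \<and> b = b'" by simp
qed simp

lemma cis_eq_1_iff: "cis x = 1 \<longleftrightarrow> (\<exists>n::int. x = of_int n * 2 * pi)"
proof
  assume "cis x = 1"
  then have "cos x = 1" by (simp add: complex_eq_iff)
  then show "\<exists>n::int. x = of_int n * 2 * pi" using cos_one_2pi_int by blast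
next
  assume "\<exists>n::int. x = of_int n * 2 * pi"
  then have "cos x = 1" using cos_one_2pi_int by blast
  then show "cis x = 1" by (simp add: complex_eq_iff) (metis cos_one_sin_zero)
qed

lemma cis_Arg_unit: "cmod z = 1 \<Longrightarrow> cis (Arg z) = z"
  using rcis_cmod_Arg[of z] by (simp add: rcis_def)

section \<open>The point group and the translations of the orbifold group\<close>

locale flat_orbifold =
  fixes \<Gamma> :: "(complex \<Rightarrow> complex) set"
  assumes flat: "flat_orbifold_group \<Gamma>"
begin

definition affine_group :: "(complex \<times> complex) set" where
  "affine_group = {(a, b). (\<lambda>z. a * z + b) \<in> \<Gamma>}"

definition rotations :: "complex set" where
  "rotations = fst ` affine_group"

definition translation_vectors :: "complex set" where
  "translation_vectors = {b. (1, b) \<in> affine_group}"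

lemma group_eq: "\<Gamma> = (\<lambda>(a, b) z. a * z + b) ` affine_group"
proof
  show "\<Gamma> \<subseteq> (\<lambda>(a, b) z. a * z + b) ` affine_group"
  proof
    fix g assume "g \<in> \<Gamma>"
    moreover then obtain a b where "g = (\<lambda>z. a * z + b)"
      using flat unfolding flat_orbifold_group_def rigid_motion_def by blast
    ultimately show "g \<in> (\<lambda>(a, b) z. a * z + b) ` affine_group"
      by (auto simp: affine_group_def)
  qed
qed (auto simp: affine_group_def)

lemma affine_group_norm: "(a, b) \<in> affine_group \<Longrightarrow> cmod a = 1"
proof -
  assume "(a, b) \<in> affine_group"
  then obtain a' b' where "cmod a' = 1" "(\<lambda>z. a * z + b) = (\<lambda>z. a' * z + b')"
    using flat unfolding flat_orbifold_group_def rigid_motion_def affine_group_def by blast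
  then show ?thesis by (simp add: affine_eq_iff)
qed

lemma affine_group_nonzero: "(a, b) \<in> affine_group \<Longrightarrow> a \<noteq> 0"
  using affine_group_norm by fastforce

lemma affine_group_one: "(1, 0) \<in> affine_group"
proof -
  have "id \<in> \<Gamma>" using flat by (simp add: flat_orbifold_group_def)
  then show ?thesis by (simp add: affine_group_def id_def)
qed

lemma affine_group_comp:
  assumes "(a, b) \<in> affine_group" "(c, d) \<in> affine_group"
  shows "(a * c, a * d + b) \<in> affine_group"
proof -
  have "(\<lambda>z. a * z + b) \<circ> (\<lambda>z. c * z + d) \<in> \<Gamma>"
    using flat assms unfolding flat_orbifold_group_def affine_group_def by blast
  moreover have "(\<lambda>z. a * z + b) \<circ> (\<lambda>z. c * z + d) = (\<lambda>z. (a * c) * z + (a * d + b))"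
    by (simp add: fun_eq_iff algebra_simps)
  ultimately show ?thesis by (simp add: affine_group_def)
qed

lemma affine_group_inverse:
  assumes "(a, b) \<in> affine_group"
  shows "(1 / a, - b / a) \<in> affine_group"
proof -
  have "a \<noteq> 0" using assms by (rule affine_group_nonzero)
  have "inv_into UNIV (\<lambda>z. a * z + b) \<in> \<Gamma>"
    using flat assms unfolding flat_orbifold_group_def affine_group_def by blast
  moreover have "inv_into UNIV (\<lambda>z. a * z + b) = (\<lambda>z. (1 / a) * z + - b / a)"
    by (rule inv_equality) (use \<open>a \<noteq> 0\<close> in \<open>simp_all add: field_simps\<close>)
  ultimately show ?thesis by (simp add: affine_group_def)
qed

lemma rotations_norm: "a \<in> rotations \<Longrightarrow> cmod a = 1"
  using affine_group_norm by (auto simp: rotations_def)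

lemma rotations_one: "1 \<in> rotations"
  using affine_group_one by (force simp: rotations_def)

lemma rotations_mult: "a \<in> rotations \<Longrightarrow> b \<in> rotations \<Longrightarrow> a * b \<in> rotations"
  using affine_group_comp by (force simp: rotations_def)

lemma rotations_inverse: "a \<in> rotations \<Longrightarrow> 1 / a \<in> rotations"
  using affine_group_inverse by (force simp: rotations_def)

lemma rotations_bij: "a \<in> rotations \<Longrightarrow> bij_betw (\<lambda>c. a * c) rotations rotations"
proof (rule bij_betwI[where g = "\<lambda>c. (1 / a) * c"])
  assume a: "a \<in> rotations"
  then have "a \<noteq> 0" using rotations_norm by fastforce
  then show "\<And>x. (1 / a) * (a * x) = x" "\<And>x. a * ((1 / a) * x) = x" by simp_all
  show "(*) a \<in> rotations \<rightarrow> rotations" "(*) (1 / a) \<in> rotations \<rightarrow> rotations"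
    using rotations_mult[OF a] rotations_mult[OF rotations_inverse[OF a]] by auto
qed

lemma translations_group:
  "0 \<in> translation_vectors" "b \<in> translation_vectors \<Longrightarrow> c \<in> translation_vectors \<Longrightarrow> b + c \<in> translation_vectors"
  "b \<in> translation_vectors \<Longrightarrow> - b \<in> translation_vectors"
  "b \<in> translation_vectors \<Longrightarrow> c \<in> translation_vectors \<Longrightarrow> b - c \<in> translation_vectors"
proof -
  show "0 \<in> translation_vectors" by (simp add: translation_vectors_def affine_group_one)
  show add: "b + c \<in> translation_vectors" if "b \<in> translation_vectors" "c \<in> translation_vectors" for b c
    using affine_group_comp[of 1 c 1 b] that by (simp add: translation_vectors_def)
  show minus: "- b \<in> translation_vectors" if "b \<in> translation_vectors" for b
    using affine_group_inverse[of 1 b] that by (simp add: translation_vectors_def)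
  show "b - c \<in> translation_vectors" if "b \<in> translation_vectors" "c \<in> translation_vectors" for b c
    using add[OF that(1) minus[OF that(2)]] by simp
qed

lemma translations_of_int:
  assumes "b \<in> translation_vectors" shows "of_int k * b \<in> translation_vectors"
proof -
  have nat: "of_nat n * b \<in> translation_vectors" for n
    by (induction n) (simp_all add: translations_group assms algebra_simps)
  show ?thesis
    using nat translations_group(3)[OF nat] by (cases k rule: int_cases2) auto
qed

lemma translations_diff:
  assumes "(a, b) \<in> affine_group" "(a, b') \<in> affine_group"
  shows "b - b' \<in> translation_vectors"
proof -
  have "(a * (1 / a), a * (- b' / a) + b) \<in> affine_group"
    by (intro affine_group_comp affine_group_inverse assms)
  then show ?thesis using affine_group_nonzero[OF assms(1)] by (simp add: translation_vectors_def)
qed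

lemma rotate_translations:
  assumes "a \<in> rotations" "c \<in> translation_vectors"
  shows "a * c \<in> translation_vectors"
proof -
  obtain b where ab: "(a, b) \<in> affine_group" using assms(1) by (auto simp: rotations_def)
  have "(a * 1, a * c + b) \<in> affine_group"
    using affine_group_comp[OF ab, of 1 c] assms(2) by (simp add: translation_vectors_def)
  then show ?thesis using translations_diff[of a "a * c + b" b] ab by simp
qed

section \<open>Finiteness of the point group, and a basis of the translation lattice\<close>

lemma lattice:
  obtains w\<^sub>1 w\<^sub>2 \<Lambda> where "wedge w\<^sub>1 w\<^sub>2 \<noteq> 0"
    "\<Lambda> = {\<lambda>z. z + of_int m * w\<^sub>1 + of_int n * w\<^sub>2 | m n :: int. True}"
    "\<Lambda> \<subseteq> \<Gamma>" "finite ((\<lambda>g. (\<lambda>h. g \<circ> h) ` \<Lambda>) ` \<Gamma>)"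
proof -
  obtain \<Lambda> where \<Lambda>: "translation_lattice \<Lambda>" "\<Lambda> \<subseteq> \<Gamma>" "finite ((\<lambda>g. (\<lambda>h. g \<circ> h) ` \<Lambda>) ` \<Gamma>)"
    using flat unfolding flat_orbifold_group_def by blast
  then obtain w\<^sub>1 w\<^sub>2 where w: "w\<^sub>1 \<noteq> w\<^sub>2" "independent {w\<^sub>1, w\<^sub>2}"
    and eq: "\<Lambda> = {\<lambda>z. z + of_int m * w\<^sub>1 + of_int n * w\<^sub>2 | m n :: int. True}"
    unfolding translation_lattice_def by blast
  from independent_imp_wedge[OF w] eq \<Lambda>(2,3) show thesis by (rule that)
qed

text \<open>All elements of a coset of \<open>\<Lambda>\<close> have the same linear part, which
  \<open>F\<close> reads off from an arbitrary representative as \<open>g 1 - g 0\<close>. So there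
  are no more rotations than cosets.\<close>

lemma finite_rotations: "finite rotations"
proof -
  obtain w\<^sub>1 w\<^sub>2 \<Lambda> where L: "wedge w\<^sub>1 w\<^sub>2 \<noteq> 0"
    "\<Lambda> = {\<lambda>z. z + of_int m * w\<^sub>1 + of_int n * w\<^sub>2 | m n :: int. True}"
    "\<Lambda> \<subseteq> \<Gamma>" and fin: "finite ((\<lambda>g. (\<lambda>h. g \<circ> h) ` \<Lambda>) ` \<Gamma>)"
    by (rule lattice)
  define F where "F S = (let g = (SOME g. g \<in> S) in g 1 - g 0)" for S :: "(complex \<Rightarrow> complex) set"
  have "rotations \<subseteq> F ` (\<lambda>g. (\<lambda>h. g \<circ> h) ` \<Lambda>) ` \<Gamma>"
  proof
    fix a assume "a \<in> rotations"
    then obtain b where ab: "(\<lambda>z. a * z + b) \<in> \<Gamma>" by (auto simp: rotations_def affine_group_def)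
    let ?S = "(\<lambda>h. (\<lambda>z. a * z + b) \<circ> h) ` \<Lambda>"
    have "?S \<noteq> {}" unfolding L(2) by blast
    then have "(SOME g. g \<in> ?S) \<in> ?S" by (simp add: some_in_eq)
    then obtain h where h: "h \<in> \<Lambda>" "(SOME g. g \<in> ?S) = (\<lambda>z. a * z + b) \<circ> h" by blast
    then have F: "F ?S = a" unfolding F_def L(2) by (auto simp: algebra_simps)
    have "?S \<in> (\<lambda>g. (\<lambda>h. g \<circ> h) ` \<Lambda>) ` \<Gamma>" using ab by (rule imageI)
    then have "F ?S \<in> F ` (\<lambda>g. (\<lambda>h. g \<circ> h) ` \<Lambda>) ` \<Gamma>" by (rule imageI)
    then show "a \<in> F ` (\<lambda>g. (\<lambda>h. g \<circ> h) ` \<Lambda>) ` \<Gamma>" unfolding F .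
  qed
  then show ?thesis using fin finite_surj by blast
qed

text \<open>Among the multiples of \<open>b\<close> by \<open>0, ..., K\<close> two lie in the same
  coset, so some positive multiple of \<open>b\<close> by at most \<open>K\<close> lies in the
  sublattice, and so does \<open>N * b\<close>. Hence every area is an integer multiple of
  \<open>B / N\<^sup>2\<close>, and a least positive area exists.\<close>

lemma lattice_minimal_pair:
  obtains l m where "l \<in> translation_vectors" "m \<in> translation_vectors" "0 < wedge l m"
    "\<And>b c. b \<in> translation_vectors \<Longrightarrow> c \<in> translation_vectors \<Longrightarrow> 0 < wedge b c \<Longrightarrow> wedge l m \<le> wedge b c"
proof -
  obtain w\<^sub>1 w\<^sub>2 \<Lambda> where L: "wedge w\<^sub>1 w\<^sub>2 \<noteq> 0"
    "\<Lambda> = {\<lambda>z. z + of_int m * w\<^sub>1 + of_int n * w\<^sub>2 | m n :: int. True}"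
    "\<Lambda> \<subseteq> \<Gamma>" and fin: "finite ((\<lambda>g. (\<lambda>h. g \<circ> h) ` \<Lambda>) ` \<Gamma>)"
    by (rule lattice)
  let ?C = "(\<lambda>g. (\<lambda>h. g \<circ> h) ` \<Lambda>) ` \<Gamma>"
  define K where "K = card ?C"
  \<comment> \<open>A factorial, because it is divisible by each of the differences
    \<open>j - i \<le> K\<close> that the pigeonhole principle may produce.\<close>
  define N where "N = (fact K :: nat)"
  define B where "B = wedge w\<^sub>1 w\<^sub>2"
  have w: "w\<^sub>1 \<in> translation_vectors" "w\<^sub>2 \<in> translation_vectors"
  proof -
    have "(\<lambda>z. z + of_int 1 * w\<^sub>1 + of_int 0 * w\<^sub>2) \<in> \<Lambda>" "(\<lambda>z. z + of_int 0 * w\<^sub>1 + of_int 1 * w\<^sub>2) \<in> \<Lambda>"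
      unfolding L(2) by blast+
    then show "w\<^sub>1 \<in> translation_vectors" "w\<^sub>2 \<in> translation_vectors"
      using L(3) by (auto simp: translation_vectors_def affine_group_def)
  qed
  have mult: "\<exists>i j :: int. of_nat N * b = of_int i * w\<^sub>1 + of_int j * w\<^sub>2" if b: "b \<in> translation_vectors" for b
  proof -
    define t where "t k = (\<lambda>z. z + of_nat k * b)" for k :: nat
    have t: "t k \<in> \<Gamma>" for k
      using translations_of_int[OF b, of "int k"] by (simp add: t_def translation_vectors_def affine_group_def)
    define c where "c k = (\<lambda>h. t k \<circ> h) ` \<Lambda>" for k
    have "\<not> inj_on c {0..K}"
    proof
      assume "inj_on c {0..K}"
      then have "card {0..K} \<le> card ?C"
        using t by (intro card_inj_on_le fin) (auto simp: c_def)
      then show False by (simp add: K_def)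
    qed
    then obtain i j where ij: "i < j" "j \<le> K" "c i = c j"
      unfolding inj_on_def by (metis atLeastAtMost_iff linorder_neqE_nat)
    have "(\<lambda>z. z + of_int 0 * w\<^sub>1 + of_int 0 * w\<^sub>2) \<in> \<Lambda>" unfolding L(2) by blast
    then have "t j \<in> c j" unfolding c_def by (force simp: o_def)
    then have "t j \<in> c i" using ij(3) by simp
    then obtain m n :: int where "t j = t i \<circ> (\<lambda>z. z + of_int m * w\<^sub>1 + of_int n * w\<^sub>2)"
      unfolding c_def L(2) by blast
    from fun_cong[OF this, of 0] have mn: "of_nat (j - i) * b = of_int m * w\<^sub>1 + of_int n * w\<^sub>2"
      using ij(1) by (simp add: t_def of_nat_diff algebra_simps)
    have "(j - i) dvd N" unfolding N_def using ij by (intro dvd_fact) auto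
    then obtain q where q: "N = (j - i) * q" by blast
    have "of_nat N * b = of_int (int q * m) * w\<^sub>1 + of_int (int q * n) * w\<^sub>2"
      unfolding q of_nat_mult using arg_cong[OF mn, of "\<lambda>x. of_nat q * x"] by (simp add: algebra_simps)
    then show ?thesis by blast
  qed
  have N0: "N > 0" by (simp add: N_def)
  define f where "f b c = (real N)\<^sup>2 * wedge b c / B" for b c
  have f_int: "f b c \<in> \<int>" if bc: "b \<in> translation_vectors" "c \<in> translation_vectors" for b c
  proof -
    obtain i j i' j' :: int where "of_nat N * b = of_int i * w\<^sub>1 + of_int j * w\<^sub>2"
      "of_nat N * c = of_int i' * w\<^sub>1 + of_int j' * w\<^sub>2"
      using mult[OF bc(1)] mult[OF bc(2)] by blast
    then have "wedge (of_nat N * b) (of_nat N * c) = of_int (i * j' - j * i') * B"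
      by (simp only: wedge_simps wedge_of_int)
         (simp add: B_def wedge_commute[of w\<^sub>2 w\<^sub>1] algebra_simps)
    moreover have "wedge (of_nat N * b) (of_nat N * c) = (real N)\<^sup>2 * wedge b c"
      by (simp add: wedge_def power2_eq_square algebra_simps)
    ultimately have "f b c = of_int (i * j' - j * i')" using L(1) by (simp add: f_def B_def)
    then show ?thesis by simp
  qed
  define P where "P k \<longleftrightarrow> (\<exists>b\<in>translation_vectors. \<exists>c\<in>translation_vectors. 0 < wedge b c \<and> real k = \<bar>f b c\<bar>)" for k :: nat
  have ex: "\<exists>k::nat. real k = \<bar>f b c\<bar>" if bc: "b \<in> translation_vectors" "c \<in> translation_vectors" for b c
  proof -
    obtain i :: int where "f b c = of_int i" using f_int[OF bc] Ints_cases by blast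
    then have "real (nat \<bar>i\<bar>) = \<bar>f b c\<bar>" by simp
    then show ?thesis by blast
  qed
  have "\<exists>b\<in>translation_vectors. \<exists>c\<in>translation_vectors. 0 < wedge b c"
    using w L(1) wedge_commute[of w\<^sub>1 w\<^sub>2] by (cases "0 < wedge w\<^sub>1 w\<^sub>2") force+
  then have "\<exists>k. P k" unfolding P_def using ex by blast
  then have least: "P (LEAST k. P k)" by (rule LeastI_ex)
  then obtain l m where lm: "l \<in> translation_vectors" "m \<in> translation_vectors" "0 < wedge l m"
    and k: "real (LEAST k. P k) = \<bar>f l m\<bar>"
    unfolding P_def by blast
  show thesis
  proof (rule that[OF lm])
    fix b c assume bc: "b \<in> translation_vectors" "c \<in> translation_vectors" "0 < wedge b c"
    obtain k' where k': "real k' = \<bar>f b c\<bar>" using ex bc by blast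
    then have "P k'" unfolding P_def using bc by blast
    then have "(LEAST k. P k) \<le> k'" by (rule Least_le)
    then have "\<bar>f l m\<bar> \<le> \<bar>f b c\<bar>" using k k' by (metis of_nat_le_iff)
    then have "(real N)\<^sup>2 * wedge l m / \<bar>B\<bar> \<le> (real N)\<^sup>2 * wedge b c / \<bar>B\<bar>"
      using lm(3) bc(3) by (simp add: f_def abs_mult abs_divide)
    then show "wedge l m \<le> wedge b c" using N0 L(1) by (simp add: B_def divide_le_cancel)
  qed
qed

text \<open>Subtracting multiples of \<open>m\<close> or \<open>l\<close> from \<open>b\<close> is
  division with remainder on the areas; a positive remainder below \<open>wedge l m\<close> would
  contradict minimality. So both areas are multiples of \<open>wedge l m\<close>, and by Cramer's
  rule the quotients are the coordinates of \<open>b\<close>.\<close>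

lemma lattice_basis_ex:
  "\<exists>l m. l \<in> translation_vectors \<and> m \<in> translation_vectors \<and> 0 < wedge l m \<and>
     (\<forall>b\<in>translation_vectors. \<exists>i j :: int. b = of_int i * l + of_int j * m)"
proof -
  obtain l m where lm: "l \<in> translation_vectors" "m \<in> translation_vectors" "0 < wedge l m"
    and least: "\<And>b c. b \<in> translation_vectors \<Longrightarrow> c \<in> translation_vectors \<Longrightarrow> 0 < wedge b c \<Longrightarrow> wedge l m \<le> wedge b c"
    by (rule lattice_minimal_pair) (rule that)
  let ?A = "wedge l m"
  have divides: "\<exists>q::int. x = of_int q * ?A"
    if "\<And>q::int. x - of_int q * ?A > 0 \<Longrightarrow> ?A \<le> x - of_int q * ?A" for x
  proof
    define q where "q = \<lfloor>x / ?A\<rfloor>"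
    have "of_int q \<le> x / ?A" "x / ?A < of_int q + 1"
      unfolding q_def by linarith+
    then have "of_int q * ?A \<le> x" "x < (of_int q + 1) * ?A"
      by (simp_all only: pos_le_divide_eq[OF lm(3)] pos_divide_less_eq[OF lm(3)])
    moreover have "\<not> x - of_int q * ?A > 0"
    proof
      assume "x - of_int q * ?A > 0"
      from that[OF this] show False using \<open>x < (of_int q + 1) * ?A\<close> by (simp add: algebra_simps)
    qed
    ultimately show "x = of_int q * ?A" by linarith
  qed
  have "\<exists>i j :: int. b = of_int i * l + of_int j * m" if b: "b \<in> translation_vectors" for b
  proof -
    have "\<exists>j::int. wedge l b = of_int j * ?A"
    proof (rule divides)
      fix q :: int assume "wedge l b - of_int q * ?A > 0"
      then show "?A \<le> wedge l b - of_int q * ?A"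
        using least[OF lm(1) translations_group(4)[OF b translations_of_int[OF lm(2), of q]]]
        by (simp add: wedge_simps wedge_of_int)
    qed
    then obtain j :: int where j: "wedge l b = of_int j * ?A" by blast
    have "\<exists>i::int. wedge b m = of_int i * ?A"
    proof (rule divides)
      fix q :: int assume "wedge b m - of_int q * ?A > 0"
      then show "?A \<le> wedge b m - of_int q * ?A"
        using least[OF translations_group(4)[OF b translations_of_int[OF lm(1), of q]] lm(2)]
        by (simp add: wedge_simps wedge_of_int)
    qed
    then obtain i :: int where i: "wedge b m = of_int i * ?A" by blast
    define d where "d = b - (of_int i * l + of_int j * m)"
    have d: "wedge l d = 0" "wedge m d = 0"
      using i j wedge_commute[of m b] wedge_commute[of m l] by (simp_all add: d_def wedge_simps wedge_of_int)
    have "l \<noteq> 0" using lm(3) by (auto simp: wedge_simps)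
    then obtain r where "d = of_real r * l" using wedge_eq_0_imp[OF d(1)] by blast
    then have "d = 0" using d(2) lm(3) wedge_commute[of m l] by (auto simp: wedge_simps)
    then show ?thesis by (auto simp: d_def)
  qed
  then show ?thesis using lm by blast
qed

definition basis :: "complex \<times> complex" where
  "basis = (SOME (l, m). l \<in> translation_vectors \<and> m \<in> translation_vectors \<and> 0 < wedge l m \<and>
     (\<forall>b\<in>translation_vectors. \<exists>i j :: int. b = of_int i * l + of_int j * m))"

definition covolume :: real where
  "covolume = wedge (fst basis) (snd basis)"

lemma basis:
  "fst basis \<in> translation_vectors" "snd basis \<in> translation_vectors" "0 < covolume"
  "b \<in> translation_vectors \<Longrightarrow> \<exists>i j :: int. b = of_int i * fst basis + of_int j * snd basis"
proof -
  have "case basis of (l, m) \<Rightarrow> l \<in> translation_vectors \<and> m \<in> translation_vectors \<and> 0 < wedge l m \<and>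
     (\<forall>b\<in>translation_vectors. \<exists>i j :: int. b = of_int i * l + of_int j * m)"
    unfolding basis_def by (rule someI_ex) (use lattice_basis_ex in auto)
  then show "fst basis \<in> translation_vectors" "snd basis \<in> translation_vectors" "0 < covolume"
    "b \<in> translation_vectors \<Longrightarrow> \<exists>i j :: int. b = of_int i * fst basis + of_int j * snd basis"
    by (auto simp: covolume_def split: prod.splits)
qed

lemma wedge_translations:
  assumes "b \<in> translation_vectors" "c \<in> translation_vectors"
  obtains n :: int where "wedge b c = of_int n * covolume"
proof -
  obtain i j i' j' :: int where "b = of_int i * fst basis + of_int j * snd basis"
    "c = of_int i' * fst basis + of_int j' * snd basis"
    using basis(4) assms by meson
  then have "wedge b c = of_int (i * j' - j * i') * covolume"
    by (simp only: wedge_simps wedge_of_int)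
       (simp add: covolume_def wedge_commute[of "snd basis" "fst basis"] algebra_simps)
  then show ?thesis by (rule that)
qed

text \<open>Dividing \<open>u\<close> by the gcd of its coordinates gives a lattice vector again, so
  primitivity makes the coordinates coprime. Bezout coefficients then provide the second vector of a
  basis containing \<open>u\<close>.\<close>

lemma primitive_partner:
  assumes u: "u \<in> translation_vectors" "u \<noteq> 0" and prim: "\<And>r::real. of_real r * u \<in> translation_vectors \<Longrightarrow> r \<in> \<int>"
  obtains m where "m \<in> translation_vectors" "wedge u m = covolume"
proof -
  obtain i j :: int where ij: "u = of_int i * fst basis + of_int j * snd basis"
    using basis(4) u(1) by blast
  have g0: "gcd i j \<noteq> 0" using u(2) ij by auto
  have "of_real (1 / of_int (gcd i j)) * u = of_int (i div gcd i j) * fst basis + of_int (j div gcd i j) * snd basis"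
  proof -
    have "of_int i = of_int (gcd i j) * (of_int (i div gcd i j) :: complex)"
      "of_int j = of_int (gcd i j) * (of_int (j div gcd i j) :: complex)"
      unfolding of_int_mult[symmetric] by simp_all
    then show ?thesis unfolding ij using g0 by (simp add: field_simps)
  qed
  then have "of_real (1 / of_int (gcd i j)) * u \<in> translation_vectors"
    using basis(1,2) by (simp add: translations_group translations_of_int)
  then have "1 / of_int (gcd i j) \<in> (\<int> :: real set)" by (rule prim)
  then obtain k :: int where "1 / real_of_int (gcd i j) = of_int k" by (elim Ints_cases)
  then have "real_of_int (k * gcd i j) = 1" using g0 by (simp add: field_simps)
  then have "k * gcd i j = 1" by linarith
  then have "gcd i j dvd 1" by (metis dvd_triv_right)
  then have "gcd i j = 1" by simp
  then obtain x y where xy: "x * i + y * j = 1" using bezout_int[of i j] by auto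
  define m where "m = of_int (- y) * fst basis + of_int x * snd basis"
  have "m \<in> translation_vectors"
    using basis(1,2) unfolding m_def by (simp only: translations_group translations_of_int)
  moreover have "wedge u m = of_int (x * i + y * j) * covolume"
    unfolding ij m_def
    by (simp only: wedge_simps wedge_of_int)
       (simp add: covolume_def wedge_commute[of "snd basis" "fst basis"] algebra_simps)
  ultimately show ?thesis using xy that by simp
qed

text \<open>The areas of a lattice vector with the two basis vectors are multiples of
  \<open>covolume\<close>. For a short vector they are too small to be anything but 0.\<close>

lemma translations_discrete:
  obtains \<epsilon> where "0 < \<epsilon>" "\<And>b. b \<in> translation_vectors \<Longrightarrow> cmod b < \<epsilon> \<Longrightarrow> b = 0"
proof
  define M where "M = cmod (fst basis) + cmod (snd basis)"
  have "covolume \<le> cmod (fst basis) * cmod (snd basis)"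
    using wedge_le[of "fst basis" "snd basis"] by (simp add: covolume_def)
  then have "0 < cmod (fst basis) * cmod (snd basis)" using basis(3) by linarith
  then have "M > 0" unfolding M_def by (intro add_pos_pos) (auto simp: zero_less_mult_iff)
  show "0 < covolume / M" using basis(3) \<open>M > 0\<close> by simp
  fix b assume b: "b \<in> translation_vectors" "cmod b < covolume / M"
  have zero: "wedge c b = 0" if c: "c \<in> translation_vectors" "cmod c \<le> M" for c
  proof -
    obtain n :: int where n: "wedge c b = of_int n * covolume" using wedge_translations[OF c(1) b(1)] .
    have "\<bar>wedge c b\<bar> \<le> M * cmod b"
      using wedge_le[of c b] c(2) by (meson mult_right_mono norm_ge_zero order_trans)
    also have "\<dots> < covolume" using b(2) \<open>M > 0\<close> by (simp add: field_simps)
    finally have "\<bar>real_of_int n\<bar> < 1" using n basis(3) by (simp add: abs_mult)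
    then have "n = 0" by linarith
    then show ?thesis using n by simp
  qed
  have z: "wedge (fst basis) b = 0" "wedge (snd basis) b = 0"
    by (intro zero basis; simp add: M_def)+
  have "fst basis \<noteq> 0" using basis(3) by (auto simp: covolume_def wedge_simps)
  then obtain r where "b = of_real r * fst basis" using wedge_eq_0_imp[OF z(1)] by blast
  then show "b = 0" using z(2) basis(3) wedge_commute[of "snd basis" "fst basis"]
    by (auto simp: wedge_simps covolume_def)
qed

end

section \<open>The universal covering of the unit tangent bundle\<close>

context flat_orbifold
begin

abbreviation cover :: "complex \<times> real \<Rightarrow> (complex \<times> complex) set" where
  "cover \<equiv> tangent_cover \<Gamma>"

text \<open>\<open>\<beta>\<close> ranges over all real arguments of the linear part
  \<open>a\<close>. Thus a full turn of the tangent vector, \<open>a = 1\<close>,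
  \<open>b = 0\<close> and \<open>\<beta> = 2 * pi\<close>, is a deck transformation as
  well.\<close>

definition decks :: "(complex \<times> real \<Rightarrow> complex \<times> real) set" where
  "decks = {\<lambda>x. (a * fst x + b, snd x + \<beta>) | a b \<beta>. (a, b) \<in> affine_group \<and> cis \<beta> = a}"

lemma tangent_class_affine:
  "tangent_class \<Gamma> (p, v) = {(a * p + b, a * v) | a b. (a, b) \<in> affine_group}"
proof
  show "tangent_class \<Gamma> (p, v) \<subseteq> {(a * p + b, a * v) | a b. (a, b) \<in> affine_group}"
  proof
    fix y assume "y \<in> tangent_class \<Gamma> (p, v)"
    then obtain g where g: "g \<in> \<Gamma>" "y = tangent_action g (p, v)" by (auto simp: tangent_class_def)
    obtain a b where "(a, b) \<in> affine_group" "g = (\<lambda>z. a * z + b)"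
      using subsetD[OF equalityD1[OF group_eq] g(1)] by auto
    then show "y \<in> {(a * p + b, a * v) | a b. (a, b) \<in> affine_group}"
      using g(2) by (auto simp: tangent_action_def)
  qed
  show "{(a * p + b, a * v) | a b. (a, b) \<in> affine_group} \<subseteq> tangent_class \<Gamma> (p, v)"
  proof clarify
    fix a b assume "(a, b) \<in> affine_group"
    then have "(\<lambda>z. a * z + b) \<in> \<Gamma>" by (simp add: affine_group_def)
    moreover have "tangent_action (\<lambda>z. a * z + b) (p, v) = (a * p + b, a * v)"
      by (simp add: tangent_action_def)
    ultimately show "(a * p + b, a * v) \<in> tangent_class \<Gamma> (p, v)"
      unfolding tangent_class_def by (metis imageI)
  qed
qed

lemma tangent_class_self: "x \<in> tangent_class \<Gamma> x"
  using affine_group_one tangent_class_affine[of "fst x" "snd x"] by force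

lemma tangent_class_eq_iff:
  "tangent_class \<Gamma> (p, v) = tangent_class \<Gamma> (q, w) \<longleftrightarrow>
     (\<exists>a b. (a, b) \<in> affine_group \<and> q = a * p + b \<and> w = a * v)"
proof
  assume "tangent_class \<Gamma> (p, v) = tangent_class \<Gamma> (q, w)"
  then have "(q, w) \<in> tangent_class \<Gamma> (p, v)" using tangent_class_self by simp
  then show "\<exists>a b. (a, b) \<in> affine_group \<and> q = a * p + b \<and> w = a * v"
    by (auto simp: tangent_class_affine)
next
  have sub: "tangent_class \<Gamma> (a * p + b, a * v) \<subseteq> tangent_class \<Gamma> (p, v)"
    if ab: "(a, b) \<in> affine_group" for a b p v
  proof
    fix y assume "y \<in> tangent_class \<Gamma> (a * p + b, a * v)"
    then obtain c d where cd: "(c, d) \<in> affine_group" "y = (c * (a * p + b) + d, c * (a * v))"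
      by (auto simp: tangent_class_affine)
    then have "y = ((c * a) * p + (c * b + d), (c * a) * v)" by (simp add: algebra_simps)
    then show "y \<in> tangent_class \<Gamma> (p, v)"
      using affine_group_comp[OF cd(1) ab] unfolding tangent_class_affine by blast
  qed
  assume "\<exists>a b. (a, b) \<in> affine_group \<and> q = a * p + b \<and> w = a * v"
  then obtain a b where ab: "(a, b) \<in> affine_group" "q = a * p + b" "w = a * v" by blast
  have "tangent_class \<Gamma> (q, w) \<subseteq> tangent_class \<Gamma> (p, v)" using sub[OF ab(1)] ab by simp
  moreover have "tangent_class \<Gamma> (p, v) \<subseteq> tangent_class \<Gamma> (q, w)"
    using sub[OF affine_group_inverse[OF ab(1)], of q w] affine_group_nonzero[OF ab(1)]
    by (simp add: ab(2,3) add_divide_distrib)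
  ultimately show "tangent_class \<Gamma> (p, v) = tangent_class \<Gamma> (q, w)" by blast
qed

lemma cover_eq_iff: "cover x = cover y \<longleftrightarrow> (\<exists>d\<in>decks. y = d x)"
proof
  assume "cover x = cover y"
  then obtain a b where ab: "(a, b) \<in> affine_group" "fst y = a * fst x + b" "cis (snd y) = a * cis (snd x)"
    by (auto simp: tangent_cover_def tangent_class_eq_iff split: prod.splits)
  have "cis (snd y - snd x) = a" using ab(3) by (simp add: cis_divide[symmetric] cis_neq_zero)
  then have "(\<lambda>x. (a * fst x + b, snd x + (snd y - snd x'))) \<in> decks" if "x' = x" for x'
    unfolding decks_def using ab(1) that by blast
  from this[of x] ab(2) show "\<exists>d\<in>decks. y = d x"
    by (intro bexI[of _ "\<lambda>z. (a * fst z + b, snd z + (snd y - snd x))"]) (auto simp: prod_eq_iff)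
next
  assume "\<exists>d\<in>decks. y = d x"
  then obtain a b \<beta> where "(a, b) \<in> affine_group" "cis \<beta> = a" "y = (a * fst x + b, snd x + \<beta>)"
    by (auto simp: decks_def)
  then show "cover x = cover y"
    by (auto simp: tangent_cover_def tangent_class_eq_iff cis_mult[symmetric] split: prod.splits)
qed

lemma cover_deck: "d \<in> decks \<Longrightarrow> cover (d x) = cover x"
  using cover_eq_iff by blast

text \<open>As isometries, the deck transformations carry a ball around one point of a fibre to
  balls of the same radius around the others; these are the sheets of the covering.\<close>

lemma dist_deck: "d \<in> decks \<Longrightarrow> dist (d x) (d y) = dist x y"
proof -
  assume "d \<in> decks"
  then obtain a b \<beta> where d: "(a, b) \<in> affine_group" "d = (\<lambda>x. (a * fst x + b, snd x + \<beta>))"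
    by (auto simp: decks_def)
  have "dist (a * fst x + b) (a * fst y + b) = dist (fst x) (fst y)"
    using affine_group_norm[OF d(1)]
    by (simp add: dist_norm) (simp only: right_diff_distrib[symmetric] norm_mult mult_1_left)
  then show ?thesis unfolding d(2) by (simp add: dist_prod_def dist_norm)
qed

lemma continuous_on_deck: "d \<in> decks \<Longrightarrow> continuous_on S d"
  unfolding decks_def by (auto intro!: continuous_intros)

lemma topspace_cover: "topspace (unit_tangent_bundle \<Gamma>) = range cover"
proof -
  have eq: "unit_tangent_plane = range (\<lambda>(z, \<theta>). (z, cis \<theta>))"
  proof
    show "unit_tangent_plane \<subseteq> range (\<lambda>(z, \<theta>). (z, cis \<theta>))"
    proof
      fix x assume "x \<in> unit_tangent_plane"
      then have "cmod (snd x) = 1" by (auto simp: unit_tangent_plane_def)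
      then have "x = (\<lambda>(z, \<theta>). (z, cis \<theta>)) (fst x, Arg (snd x))"
        by (simp add: prod_eq_iff cis_Arg_unit)
      then show "x \<in> range (\<lambda>(z, \<theta>). (z, cis \<theta>))" by blast
    qed
  qed (auto simp: unit_tangent_plane_def)
  show ?thesis
    unfolding topspace_unit_tangent_bundle tangent_cover_def eq by (simp add: image_image case_prod_beta)
qed

text \<open>A small change of angle first forces \<open>a = 1\<close>, as the other rotations keep a
  distance from 1. The displacement is then a lattice vector together with a multiple of
  \<open>2 * pi\<close>, and both are 0 if small. The bound does not depend on the point.\<close>

lemma separation_ex: "\<exists>\<epsilon>>0. \<forall>x y. cover x = cover y \<longrightarrow> dist x y < \<epsilon> \<longrightarrow> x = y"
proof -
  obtain \<delta> where \<delta>: "0 < \<delta>" "\<And>b. b \<in> translation_vectors \<Longrightarrow> cmod b < \<delta> \<Longrightarrow> b = 0"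
    by (rule translations_discrete) (rule that)
  obtain \<eta> where \<eta>: "\<eta> > 0" "\<And>a. a \<in> rotations \<Longrightarrow> a \<noteq> 1 \<Longrightarrow> \<eta> \<le> dist 1 a"
    using finite_set_avoid[OF finite_rotations, of 1] by blast
  define \<epsilon> where "\<epsilon> = min (min \<delta> \<eta>) 1"
  have "x = y" if xy: "cover x = cover y" "dist x y < \<epsilon>" for x y
  proof -
    obtain a b \<beta> where d: "(a, b) \<in> affine_group" "cis \<beta> = a" "y = (a * fst x + b, snd x + \<beta>)"
      using xy(1) by (auto simp: cover_eq_iff decks_def)
    have "\<bar>\<beta>\<bar> \<le> dist x y" using dist_snd_le[of x y] by (simp add: d(3) dist_real_def)
    then have \<beta>: "\<bar>\<beta>\<bar> < \<eta>" "\<bar>\<beta>\<bar> < 1" using xy(2) by (auto simp: \<epsilon>_def)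
    have "cmod (cis \<beta> - 1) \<le> \<bar>\<beta>\<bar>"
      using dist_exp_i_1[of \<beta>] abs_sin_x_le_abs_x[of "\<beta> / 2"] by (simp add: cis_conv_exp)
    moreover have "a \<in> rotations" using d(1) by (force simp: rotations_def)
    ultimately have a: "a = 1" using \<eta>(2)[of a] \<beta>(1) d(2) by (force simp: dist_norm norm_minus_commute)
    then have "b \<in> translation_vectors" using d(1) by (simp add: translation_vectors_def)
    moreover have "cmod b \<le> dist x y" using dist_fst_le[of x y] by (simp add: d(3) a dist_norm)
    ultimately have "b = 0" using \<delta>(2) xy(2) by (simp add: \<epsilon>_def)
    moreover have "\<beta> = 0"
    proof -
      obtain n :: int where n: "\<beta> = of_int n * 2 * pi" using d(2) a cis_eq_1_iff[of \<beta>] by auto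
      have "n = 0"
      proof (rule ccontr)
        assume "n \<noteq> 0"
        then have "1 \<le> \<bar>real_of_int n\<bar>" by linarith
        then have "2 * pi \<le> \<bar>\<beta>\<bar>" unfolding n by (simp add: abs_mult)
        then show False using \<beta>(2) pi_gt3 by linarith
      qed
      then show ?thesis using n by simp
    qed
    ultimately show ?thesis using d(3) a by (simp add: prod_eq_iff)
  qed
  moreover have "\<epsilon> > 0" using \<delta>(1) \<eta>(1) by (simp add: \<epsilon>_def)
  ultimately show ?thesis by blast
qed

definition separation :: real where
  "separation = (SOME \<epsilon>. \<epsilon> > 0 \<and> (\<forall>x y. cover x = cover y \<longrightarrow> dist x y < \<epsilon> \<longrightarrow> x = y))"

lemma separation: "separation > 0" "cover x = cover y \<Longrightarrow> dist x y < separation \<Longrightarrow> x = y"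
  using someI_ex[OF separation_ex] unfolding separation_def by blast+

lemma continuous_map_cover: "continuous_map euclidean (unit_tangent_bundle \<Gamma>) cover"
proof -
  have "continuous_map euclidean (top_of_set unit_tangent_plane) (\<lambda>(z, \<theta>). (z, cis \<theta>))"
    by (auto simp: continuous_map_in_subtopology unit_tangent_plane_def case_prod_beta
        intro!: continuous_intros)
  then have "continuous_map euclidean (unit_tangent_bundle \<Gamma>) (tangent_class \<Gamma> \<circ> (\<lambda>(z, \<theta>). (z, cis \<theta>)))"
    by (rule continuous_map_compose) (rule quotient_imp_continuous_map[OF quotient_map_tangent_class])
  moreover have "tangent_class \<Gamma> \<circ> (\<lambda>(z, \<theta>). (z, cis \<theta>)) = cover"
    by (auto simp: tangent_cover_def)
  ultimately show ?thesis by simp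
qed

text \<open>Near the direction \<open>v\<close> the angle is a continuous function of the vector:
  \<open>Arg v\<close> plus the argument of \<open>snd y / v\<close>, which varies in a half plane.
  This local section \<open>s\<close>, moved by a deck transformation, lands in
  \<open>U\<close>.\<close>

lemma openin_cover_image:
  assumes "open U"
  shows "openin (unit_tangent_bundle \<Gamma>) (cover ` U)"
  unfolding openin_unit_tangent_bundle
proof
  show "cover ` U \<subseteq> tangent_class \<Gamma> ` unit_tangent_plane"
    using topspace_cover unfolding topspace_unit_tangent_bundle by blast
  let ?P = "{x \<in> unit_tangent_plane. tangent_class \<Gamma> x \<in> cover ` U}"
  show "openin (top_of_set unit_tangent_plane) ?P"
  proof (subst openin_subopen, intro ballI)
    fix x assume x: "x \<in> ?P"
    obtain p v where pv: "x = (p, v)" by fastforce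
    have v1: "cmod v = 1" using x pv by (simp add: unit_tangent_plane_def)
    then have cis: "cis (Arg v) = v" by (rule cis_Arg_unit)
    from x pv obtain u where u: "u \<in> U" "tangent_class \<Gamma> (p, v) = cover u" by auto
    then have "cover (p, Arg v) = cover u" by (simp add: tangent_cover_def cis)
    then obtain d where d: "d \<in> decks" "u = d (p, Arg v)" by (auto simp: cover_eq_iff)
    define s where "s y = (fst y, Arg v + Arg (snd y / v))" for y :: "complex \<times> complex"
    define Q where "Q = {y :: complex \<times> complex. Re (snd y / v) > 0}"
    have "open Q" unfolding Q_def using v1 by (intro open_Collect_less continuous_intros) auto
    have "continuous_on Q s"
      unfolding s_def Q_def using v1
      by (intro continuous_intros) (auto simp: complex_nonpos_Reals_iff)
    then have "continuous_on Q (d \<circ> s)"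
      by (rule continuous_on_compose) (rule continuous_on_deck[OF d(1)])
    then have op: "open (Q \<inter> (d \<circ> s) -` U)"
      using \<open>open Q\<close> assms by (rule continuous_open_preimage)
    have "v \<noteq> 0" using v1 by auto
    then have "x \<in> Q \<inter> (d \<circ> s) -` U" using u(1) d(2) by (simp add: pv Q_def s_def)
    moreover have "unit_tangent_plane \<inter> (Q \<inter> (d \<circ> s) -` U) \<subseteq> ?P"
    proof
      fix y assume y: "y \<in> unit_tangent_plane \<inter> (Q \<inter> (d \<circ> s) -` U)"
      then have "cmod (snd y / v) = 1" using v1 by (auto simp: unit_tangent_plane_def norm_divide)
      then have "cis (Arg (snd y / v)) = snd y / v" by (rule cis_Arg_unit)
      then have "cis (Arg v + Arg (snd y / v)) = snd y" using \<open>v \<noteq> 0\<close> by (simp add: cis_mult[symmetric] cis)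
      then have "tangent_class \<Gamma> y = cover (s y)" by (simp add: tangent_cover_def s_def)
      also have "\<dots> = cover (d (s y))" by (rule cover_deck[OF d(1), symmetric])
      finally show "y \<in> ?P" using y by auto
    qed
    ultimately show "\<exists>T. openin (top_of_set unit_tangent_plane) T \<and> x \<in> T \<and> T \<subseteq> ?P"
      using op x by (intro exI[of _ "unit_tangent_plane \<inter> (Q \<inter> (d \<circ> s) -` U)"])
        (auto simp: openin_open_Int)
  qed
qed

text \<open>The bundle is not a type-class space, so the lifting theorem is applied to the pull-back of the
  covering along \<open>h\<close>, which lives in a normed space.\<close>

lemma covering_space_pullback:
  fixes S :: "'a::real_normed_vector set"
  assumes h: "continuous_map (top_of_set S) (unit_tangent_bundle \<Gamma>) h"
  shows "covering_space {(u, x). u \<in> S \<and> cover x = h u} fst S"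
proof
  let ?E = "{(u, x). u \<in> S \<and> cover x = h u}"
  \<comment> \<open>Half of the separation: \<open>cover\<close> is injective on each ball of this
    radius, and the balls around different points of a fibre are disjoint.\<close>
  define r where "r = separation / 2"
  have r: "r > 0" using separation(1) by (simp add: r_def)
  show "continuous_on ?E fst" by (intro continuous_intros)
  have hS: "h u \<in> range cover" if "u \<in> S" for u
  proof -
    have "h u \<in> topspace (unit_tangent_bundle \<Gamma>)"
      using h that by (simp add: continuous_map_def Pi_iff)
    then show ?thesis by (simp only: topspace_cover)
  qed
  show "fst ` ?E = S"
  proof
    show "S \<subseteq> fst ` ?E"
    proof
      fix u assume "u \<in> S"
      then obtain x where "(u, x) \<in> ?E" using hS by fastforce
      then have "fst (u, x) \<in> fst ` ?E" by (rule imageI)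
      then show "u \<in> fst ` ?E" by (simp only: fst_conv)
    qed
  qed auto
  fix u0 assume "u0 \<in> S"
  then obtain x0 where x0: "h u0 = cover x0" using hS by blast
  define T where "T = {u \<in> S. h u \<in> cover ` ball x0 r}"
  define v where "v x = {(u, y). u \<in> T \<and> cover y = h u \<and> y \<in> ball x r}" for x
  have openT: "openin (top_of_set S) {u \<in> S. h u \<in> cover ` A}" if "open A" for A
    using openin_continuous_map_preimage[OF h openin_cover_image[OF that]] by simp
  have inj: "y = y'" if "y \<in> ball x r" "y' \<in> ball x r" "cover y = cover y'" for x y y'
  proof (rule separation(2)[OF that(3)])
    have "dist y y' \<le> dist x y + dist x y'" by (rule dist_triangle3)
    then show "dist y y' < separation" using that(1,2) by (simp add: r_def)
  qed
  show "\<exists>T. u0 \<in> T \<and> openin (top_of_set S) T \<and> (\<exists>v. \<Union> v = ?E \<inter> fst -` T \<and>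
      (\<forall>u\<in>v. openin (top_of_set ?E) u) \<and> pairwise disjnt v \<and> (\<forall>u\<in>v. \<exists>q. homeomorphism u T fst q))"
  proof (intro exI[of _ T] exI[of _ "v ` {x. cover x = cover x0}"] conjI ballI)
    show "u0 \<in> T" using \<open>u0 \<in> S\<close> x0 r by (auto simp: T_def)
    show "openin (top_of_set S) T" unfolding T_def by (intro openT open_ball)
    show "\<Union> (v ` {x. cover x = cover x0}) = ?E \<inter> fst -` T"
    proof
      show "?E \<inter> fst -` T \<subseteq> \<Union> (v ` {x. cover x = cover x0})"
      proof
        fix w assume "w \<in> ?E \<inter> fst -` T"
        then obtain u y where w: "w = (u, y)" and u: "u \<in> S" "cover y = h u" "u \<in> T" by auto
        obtain y' where y': "y' \<in> ball x0 r" "cover y' = cover y" using u by (auto simp: T_def)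
        then obtain d where d: "d \<in> decks" "y = d y'" by (auto simp: cover_eq_iff)
        have "dist (d x0) y = dist x0 y'" using d by (simp add: dist_deck)
        then have "(u, y) \<in> v (d x0)" using u y' by (auto simp: v_def)
        moreover have "cover (d x0) = cover x0" using d(1) by (rule cover_deck)
        ultimately show "w \<in> \<Union> (v ` {x. cover x = cover x0})" unfolding w by blast
      qed
    qed (auto simp: v_def T_def)
    show "pairwise disjnt (v ` {x. cover x = cover x0})"
    proof (rule pairwiseI)
      fix V V' assume "V \<in> v ` {x. cover x = cover x0}" "V' \<in> v ` {x. cover x = cover x0}" "V \<noteq> V'"
      then obtain x x' where x: "cover x = cover x0" "cover x' = cover x0" and V: "V = v x" "V' = v x'" "x \<noteq> x'"
        by blast
      show "disjnt V V'"
        unfolding disjnt_iff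
      proof (intro allI notI)
        fix w assume "w \<in> V \<and> w \<in> V'"
        then have b: "dist x (snd w) < r" "dist x' (snd w) < r" unfolding V v_def by auto
        have "dist x x' \<le> dist x (snd w) + dist x' (snd w)" by (rule dist_triangle2)
        then have "dist x x' < separation" using b by (simp add: r_def)
        then have "x = x'" using x by (intro separation(2)) simp_all
        then show False using V(3) by simp
      qed
    qed
  next
    fix V assume "V \<in> v ` {x. cover x = cover x0}"
    then obtain x where x: "cover x = cover x0" "V = v x" by blast
    obtain T' where T': "open T'" "T = S \<inter> T'"
      using openT[OF open_ball[of x0 r]] unfolding T_def[symmetric] openin_open by blast
    have "V = ?E \<inter> (T' \<times> ball x r)" unfolding x(2) v_def T'(2) by auto
    then show "openin (top_of_set ?E) V" using T'(1) by (simp add: openin_open_Int open_Times)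
    have ex: "\<exists>y. y \<in> ball x r \<and> cover y = h u" if u: "u \<in> T" for u
    proof -
      from u obtain y where y: "y \<in> ball x0 r" "cover y = h u" by (auto simp: T_def)
      obtain d where d: "d \<in> decks" "x = d x0" using x(1) cover_eq_iff[of x0 x] by auto
      have "dist x (d y) = dist x0 y" using d by (simp add: dist_deck)
      then have "d y \<in> ball x r \<and> cover (d y) = h u" using y cover_deck[OF d(1), of y] by simp
      then show ?thesis by blast
    qed
    define s where "s u = (SOME y. y \<in> ball x r \<and> cover y = h u)" for u
    have s: "s u \<in> ball x r" "cover (s u) = h u" if "u \<in> T" for u
      using someI_ex[OF ex[OF that]] unfolding s_def by auto
    have s_eq: "s u = y" if "u \<in> T" "y \<in> ball x r" "cover y = h u" for u y
      by (rule inj[OF s(1)[OF that(1)] that(2)]) (simp add: s(2)[OF that(1)] that(3))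
    \<comment> \<open>The inverse of a sheet is continuous because \<open>cover\<close> is open:
      \<open>s u\<close> lies in \<open>A\<close> exactly when \<open>h u\<close> lies in the image
      of \<open>A \<inter> ball x r\<close>.\<close>
    have "continuous_on T s"
      unfolding continuous_openin_preimage_eq
    proof (intro allI impI)
      fix A :: "(complex \<times> real) set" assume "open A"
      have "T \<inter> s -` A = T \<inter> {u \<in> S. h u \<in> cover ` (A \<inter> ball x r)}"
      proof
        show "T \<inter> s -` A \<subseteq> T \<inter> {u \<in> S. h u \<in> cover ` (A \<inter> ball x r)}"
        proof
          fix u assume u: "u \<in> T \<inter> s -` A"
          then have "s u \<in> A \<inter> ball x r" using s(1)[of u] by simp
          then have "cover (s u) \<in> cover ` (A \<inter> ball x r)" by (rule imageI)
          then show "u \<in> T \<inter> {u \<in> S. h u \<in> cover ` (A \<inter> ball x r)}"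
            using u s(2)[of u] by (simp add: T_def)
        qed
        show "T \<inter> {u \<in> S. h u \<in> cover ` (A \<inter> ball x r)} \<subseteq> T \<inter> s -` A"
        proof
          fix u assume u: "u \<in> T \<inter> {u \<in> S. h u \<in> cover ` (A \<inter> ball x r)}"
          then obtain y where y: "h u = cover y" "y \<in> A" "y \<in> ball x r" by blast
          have "s u = y" by (rule s_eq) (use u y in simp_all)
          then show "u \<in> T \<inter> s -` A" using u y(2) by simp
        qed
      qed
      moreover have "openin (top_of_set S) {u \<in> S. h u \<in> cover ` (A \<inter> ball x r)}"
        using \<open>open A\<close> by (intro openT) auto
      then have "openin (top_of_set T) (T \<inter> {u \<in> S. h u \<in> cover ` (A \<inter> ball x r)})"
      proof -
        assume "openin (top_of_set S) {u \<in> S. h u \<in> cover ` (A \<inter> ball x r)}"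
        then obtain O' where "open O'" "{u \<in> S. h u \<in> cover ` (A \<inter> ball x r)} = S \<inter> O'"
          unfolding openin_open by blast
        moreover have "T \<subseteq> S" by (auto simp: T_def)
        ultimately have "T \<inter> {u \<in> S. h u \<in> cover ` (A \<inter> ball x r)} = T \<inter> O'" by blast
        then show ?thesis using \<open>open O'\<close> by (simp add: openin_open_Int)
      qed
      ultimately show "openin (top_of_set T) (T \<inter> s -` A)" by simp
    qed
    then have "continuous_on T (\<lambda>u. (u, s u))" by (intro continuous_intros)
    moreover have "(u, s u) \<in> V" if "u \<in> T" for u using s[OF that] that by (simp add: x(2) v_def)
    moreover have "fst w \<in> T \<and> (fst w, s (fst w)) = w" if "w \<in> V" for w
      using that s_eq[of "fst w" "snd w"] by (cases w) (simp add: x(2) v_def)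
    ultimately have "homeomorphism V T fst (\<lambda>u. (u, s u))"
      by (intro homeomorphismI) (auto intro!: continuous_intros)
    then show "\<exists>q. homeomorphism V T fst q" by blast
  qed
qed

lemma cover_lift:
  fixes S :: "'a::real_normed_vector set"
  assumes "convex S" "continuous_map (top_of_set S) (unit_tangent_bundle \<Gamma>) h"
  obtains f where "continuous_on S f" "\<And>u. u \<in> S \<Longrightarrow> cover (f u) = h u"
proof -
  obtain g where g: "continuous_on S g" "g \<in> S \<rightarrow> {(u, x). u \<in> S \<and> cover x = h u}"
    "\<And>u. u \<in> S \<Longrightarrow> fst (g u) = id u"
    by (rule covering_space_lift[OF covering_space_pullback[OF assms(2)], of S id])
       (use assms(1) in \<open>auto simp: convex_imp_simply_connected convex_imp_locally_path_connected\<close>)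
  show thesis
  proof
    show "continuous_on S (snd \<circ> g)" using g(1) by (auto intro: continuous_on_snd simp: o_def)
    show "cover ((snd \<circ> g) u) = h u" if "u \<in> S" for u
      using g(2,3) that by (auto simp: Pi_iff case_prod_beta)
  qed
qed

text \<open>The distance between \<open>f'\<close> and \<open>d \<circ> f\<close> is 0 at
  \<open>u0\<close> and takes no value strictly between 0 and \<open>separation\<close>, so
  connectedness keeps it at 0.\<close>

lemma lift_unique:
  assumes "connected S" "S \<noteq> {}" "continuous_on S f" "continuous_on S f'"
    and eq: "\<And>u. u \<in> S \<Longrightarrow> cover (f u) = cover (f' u)"
  obtains d where "d \<in> decks" "\<And>u. u \<in> S \<Longrightarrow> f' u = d (f u)"
proof -
  obtain u0 where u0: "u0 \<in> S" using assms(2) by blast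
  obtain d where d: "d \<in> decks" "f' u0 = d (f u0)"
    using eq[OF u0] unfolding cover_eq_iff by blast
  define g where "g u = dist (f' u) (d (f u))" for u
  have "continuous_on S (\<lambda>u. d (f u))"
    by (rule continuous_on_compose2[OF continuous_on_deck[OF d(1)] assms(3)]) auto
  then have "continuous_on S g" unfolding g_def by (intro continuous_on_dist assms(4))
  then have conn: "connected (g ` S)" by (rule connected_continuous_image[OF _ assms(1)])
  have gap: "g u = 0" if "u \<in> S" "g u < separation" for u
  proof -
    have "f' u = d (f u)"
      by (rule separation(2)) (use eq[OF that(1)] cover_deck[OF d(1), of "f u"] that(2) in \<open>simp_all add: g_def\<close>)
    then show ?thesis by (simp add: g_def)
  qed
  have "g u = 0" if "u \<in> S" for u
  proof (rule ccontr)
    assume "g u \<noteq> 0"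
    then have "separation \<le> g u" using gap[OF that] by force
    then have "separation / 2 \<in> g ` S"
      using connectedD_interval[OF conn, of "g u0" "g u" "separation / 2"] u0 that d(2) separation(1)
      by (auto simp: g_def)
    then obtain u' where "u' \<in> S" "g u' = separation / 2" by force
    then show False using gap[of u'] separation(1) by auto
  qed
  then show thesis using that[OF d(1)] by (auto simp: g_def)
qed

end

section \<open>Chains, periodic orbits and cocycles\<close>

definition pm_sum :: "('a \<Rightarrow> rat \<Rightarrow> 'b::comm_monoid_add) \<Rightarrow> ('a \<Rightarrow>\<^sub>0 rat) \<Rightarrow> 'b" where
  "pm_sum f c = (\<Sum>x\<in>Poly_Mapping.keys c. f x (Poly_Mapping.lookup c x))"

text \<open>The value 0 at coefficient 0 allows to sum over any finite superset of the support.
  Supports of different chains can then be compared although cancellation changes them.\<close>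

locale rat_additive =
  fixes f :: "'a \<Rightarrow> rat \<Rightarrow> 'b::comm_monoid_add"
  assumes zero: "f x 0 = 0" and add: "f x (a + b) = f x a + f x b"
begin

lemma pm_sum_superset:
  "finite A \<Longrightarrow> Poly_Mapping.keys c \<subseteq> A \<Longrightarrow> pm_sum f c = (\<Sum>x\<in>A. f x (Poly_Mapping.lookup c x))"
  unfolding pm_sum_def by (rule sum.mono_neutral_left) (auto simp: in_keys_iff zero)

lemma pm_sum_zero: "pm_sum f 0 = 0"
  by (simp add: pm_sum_def)

lemma pm_sum_add: "pm_sum f (c + d) = pm_sum f c + pm_sum f d"
proof -
  let ?A = "Poly_Mapping.keys c \<union> Poly_Mapping.keys d"
  have "pm_sum f (c + d) = (\<Sum>x\<in>?A. f x (Poly_Mapping.lookup (c + d) x))"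
    by (rule pm_sum_superset) (simp_all add: Poly_Mapping.keys_add)
  also have "\<dots> = (\<Sum>x\<in>?A. f x (Poly_Mapping.lookup c x)) + (\<Sum>x\<in>?A. f x (Poly_Mapping.lookup d x))"
    by (simp add: lookup_add add sum.distrib)
  also have "\<dots> = pm_sum f c + pm_sum f d"
    by (simp add: pm_sum_superset[of ?A])
  finally show ?thesis .
qed

lemma pm_sum_single: "pm_sum f (Poly_Mapping.single x a) = f x a"
  by (simp add: pm_sum_def zero)

lemma pm_sum_sum: "pm_sum f (\<Sum>i\<in>I. c i) = (\<Sum>i\<in>I. pm_sum f (c i))"
  by (induction I rule: infinite_finite_induct) (simp_all add: pm_sum_zero pm_sum_add)

lemma pm_sum_sum_mset: "pm_sum f (\<Sum>i\<in>#I. c i) = (\<Sum>i\<in>#I. pm_sum f (c i))"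
  by (induction I) (simp_all add: pm_sum_zero pm_sum_add)

end

definition chain_eval :: "('a \<Rightarrow> complex) \<Rightarrow> ('a \<Rightarrow>\<^sub>0 rat) \<Rightarrow> complex" where
  "chain_eval \<Psi> = pm_sum (\<lambda>x a. of_rat a * \<Psi> x)"

interpretation chain_eval: rat_additive "\<lambda>x a. of_rat a * \<Psi> x :: complex"
  by unfold_locales (simp_all add: of_rat_add algebra_simps)

interpretation chain_boundary: rat_additive
  "\<lambda>\<sigma> a. \<Sum>k\<le>p. Poly_Mapping.single (singular_face p k \<sigma>) ((-1) ^ k * a) :: 'a rat_chain"
  by unfold_locales (simp_all add: single_add distrib_left sum.distrib)

lemma rat_chain_boundary_pm_sum:
  "p \<noteq> 0 \<Longrightarrow> rat_chain_boundary p =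
     pm_sum (\<lambda>\<sigma> a. \<Sum>k\<le>p. Poly_Mapping.single (singular_face p k \<sigma>) ((-1) ^ k * a))"
  by (simp add: fun_eq_iff rat_chain_boundary_def pm_sum_def)

lemma chain_eval_boundary:
  "chain_eval \<Psi> (rat_chain_boundary 2 c) = (\<Sum>\<sigma>\<in>Poly_Mapping.keys c. of_rat (Poly_Mapping.lookup c \<sigma>) *
     (\<Psi> (singular_face 2 0 \<sigma>) - \<Psi> (singular_face 2 1 \<sigma>) + \<Psi> (singular_face 2 2 \<sigma>)))"
  unfolding rat_chain_boundary_def chain_eval_def
  by (simp add: chain_eval.pm_sum_sum chain_eval.pm_sum_single chain_eval.pm_sum_add numeral_2_eq_2
      of_rat_minus algebra_simps)

lemma chain_eval_fundamental_cycle: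
  "chain_eval \<Psi> (fundamental_cycle K) = (\<Sum>\<gamma>\<in>#K. \<Psi> (orbit_loop (SOME X. X \<in> \<gamma>)))"
  unfolding fundamental_cycle_def chain_eval_def
  by (simp add: chain_eval.pm_sum_sum_mset chain_eval.pm_sum_single)

definition edge_point :: "real \<Rightarrow> nat \<Rightarrow> real" where
  "edge_point t = (\<lambda>i. if i = 0 then 1 - t else if i = 1 then t else 0)"

definition triangle_edge :: "nat \<Rightarrow> real \<Rightarrow> complex" where
  "triangle_edge k = (if k = 0 then linepath 1 \<i> else if k = 1 then linepath 0 \<i> else linepath 0 1)"

lemma triangle_edge_in: "triangle_edge k \<in> triangle_edges"
  by (simp add: triangle_edge_def triangle_edges_def)

lemma edge_sum_eq: "edge_sum \<Phi> = \<Phi> (triangle_edge 0) - \<Phi> (triangle_edge 1) + \<Phi> (triangle_edge 2)"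
  unfolding edge_sum_def triangle_edge_def by (simp only: if_True if_False refl one_neq_zero numeral_neq_zero
      numeral_eq_one_iff num.distinct)

definition triangle_point :: "complex \<Rightarrow> nat \<Rightarrow> real" where
  "triangle_point w = simplex_point (Re w, Im w)"

lemma edge_point_mem: "t \<in> {0..1} \<Longrightarrow> edge_point t \<in> standard_simplex 1"
  by (auto simp: edge_point_def standard_simplex_def)

lemma triangle_point_mem: "triangle_point w \<in> standard_simplex 2 \<longleftrightarrow> w \<in> triangle"
proof -
  have "(\<Sum>i\<le>2. triangle_point w i) = 1"
    by (simp add: numeral_2_eq_2 triangle_point_def simplex_point_def)
  moreover have "(\<forall>i. 0 \<le> triangle_point w i \<and> triangle_point w i \<le> 1) \<longleftrightarrow> w \<in> triangle"
  proof
    assume *: "\<forall>i. 0 \<le> triangle_point w i \<and> triangle_point w i \<le> 1"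
    from *[rule_format, of 0] *[rule_format, of 1] *[rule_format, of 2]
    show "w \<in> triangle" by (simp add: triangle_point_def simplex_point_def mem_triangle)
  qed (auto simp: triangle_point_def simplex_point_def mem_triangle)
  moreover have "\<forall>i>2. triangle_point w i = 0" by (simp add: triangle_point_def simplex_point_def)
  ultimately show ?thesis unfolding standard_simplex_def by blast
qed

lemma triangle_point_eq:
  assumes "s \<in> standard_simplex 2" shows "triangle_point (Complex (s 1) (s 2)) = s"
proof
  fix i :: nat
  have "s 0 + s 1 + s 2 = 1" "\<forall>i>2. s i = 0"
    using assms by (auto simp: standard_simplex_def numeral_2_eq_2)
  moreover have "i = 0 \<or> i = 1 \<or> i = 2 \<or> i > 2" by linarith
  ultimately show "triangle_point (Complex (s 1) (s 2)) i = s i"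
    by (auto simp: triangle_point_def simplex_point_def)
qed

lemma bij_betw_triangle_point: "bij_betw triangle_point triangle (standard_simplex 2)"
proof (rule bij_betwI[where g = "\<lambda>s. Complex (s 1) (s 2)"])
  show "triangle_point \<in> triangle \<rightarrow> standard_simplex 2" by (simp add: triangle_point_mem)
  show "(\<lambda>s. Complex (s 1) (s 2)) \<in> standard_simplex 2 \<rightarrow> triangle"
  proof
    fix s :: "nat \<Rightarrow> real" assume "s \<in> standard_simplex 2"
    then show "Complex (s 1) (s 2) \<in> triangle"
      using triangle_point_mem[of "Complex (s 1) (s 2)"] triangle_point_eq[of s] by simp
  qed
  show "Complex (triangle_point w 1) (triangle_point w 2) = w" for w
    by (simp add: triangle_point_def simplex_point_def complex_eq_iff)
  show "s \<in> standard_simplex 2 \<Longrightarrow> triangle_point (Complex (s 1) (s 2)) = s" for s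
    by (rule triangle_point_eq)
qed

lemma continuous_on_triangle_point: "continuous_on A triangle_point"
proof (rule continuous_on_coordinatewise_then_product)
  fix i :: nat
  show "continuous_on A (\<lambda>w. triangle_point w i)"
    unfolding triangle_point_def simplex_point_def
    by (cases "i = 0"; cases "i = 1"; cases "i = 2") (auto intro!: continuous_intros)
qed

lemma singular_face_edge:
  assumes "t \<in> {0..1}" "k \<le> 2"
  shows "singular_face 2 k \<sigma> (edge_point t) = \<sigma> (triangle_point (triangle_edge k t))"
proof -
  have "k = 0 \<or> k = 1 \<or> k = 2" using assms(2) by linarith
  then have "simplical_face k (edge_point t) = triangle_point (triangle_edge k t)"
    by (elim disjE) (simp_all add: fun_eq_iff triangle_edge_def linepath_real
        simplical_face_def edge_point_def triangle_point_def simplex_point_def del: linepath_0, presburger+)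
  then show ?thesis
    using edge_point_mem[OF assms(1)] by (simp add: singular_face_def)
qed

lemma continuous_map_triangle:
  assumes "singular_simplex 2 X \<sigma>"
  shows "continuous_map (top_of_set triangle) X (\<lambda>w. \<sigma> (triangle_point w))"
proof -
  have "continuous_map (top_of_set triangle) (subtopology (powertop_real UNIV) (standard_simplex 2)) triangle_point"
    using continuous_on_triangle_point[of triangle] triangle_point_mem
    by (auto simp: continuous_map_in_subtopology euclidean_product_topology)
  then have "continuous_map (top_of_set triangle) X (\<sigma> \<circ> triangle_point)"
    using assms unfolding singular_simplex_def by (blast intro: continuous_map_compose)
  then show ?thesis by (simp add: o_def)
qed

context flat_orbifold
begin

definition triangle_lift :: "((nat \<Rightarrow> real) \<Rightarrow> (complex \<times> complex) set) \<Rightarrow> (complex \<Rightarrow> complex \<times> real) \<Rightarrow> bool" where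
  "triangle_lift \<sigma> f \<longleftrightarrow> continuous_on triangle f \<and> (\<forall>w\<in>triangle. cover (f w) = \<sigma> (triangle_point w))"

definition edge_lift :: "((nat \<Rightarrow> real) \<Rightarrow> (complex \<times> complex) set) \<Rightarrow> (real \<Rightarrow> complex \<times> real) \<Rightarrow> bool" where
  "edge_lift \<tau> p \<longleftrightarrow> continuous_on {0..1} p \<and> (\<forall>t\<in>{0..1}. cover (p t) = \<tau> (edge_point t))"

lemma triangle_lift_ex:
  assumes "singular_simplex 2 (unit_tangent_bundle \<Gamma>) \<sigma>"
  obtains f where "triangle_lift \<sigma> f"
proof -
  obtain f where "continuous_on triangle f" "\<And>w. w \<in> triangle \<Longrightarrow> cover (f w) = \<sigma> (triangle_point w)"
    by (rule cover_lift[OF convex_triangle continuous_map_triangle[OF assms]]) (rule that)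
  then show thesis by (intro that[of f]) (simp add: triangle_lift_def)
qed

lemma edge_lift_face:
  assumes "triangle_lift \<sigma> f" "k \<le> 2"
  shows "edge_lift (singular_face 2 k \<sigma>) (f \<circ> triangle_edge k)"
  unfolding edge_lift_def
proof (intro conjI ballI)
  have m: "triangle_edge k t \<in> triangle" if "t \<in> {0..1}" for t
    using triangle_edge_mem[OF triangle_edge_in that] by simp
  show "continuous_on {0..1} (f \<circ> triangle_edge k)"
    using assms(1) m
    by (intro continuous_on_compose triangle_edge_continuous[OF triangle_edge_in])
       (auto simp: triangle_lift_def intro: continuous_on_subset)
  fix t :: real assume t: "t \<in> {0..1}"
  show "cover ((f \<circ> triangle_edge k) t) = singular_face 2 k \<sigma> (edge_point t)"
    using assms(1) m[OF t] singular_face_edge[OF t assms(2), of \<sigma>] by (simp add: triangle_lift_def)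
qed

text \<open>A deck-invariant functional of paths depends only on the projected 1-simplex and extends
  linearly to 1-chains. Both sides are its value on the boundary of \<open>c\<close>, computed once
  from the faces and once from the orbits. The set \<open>B\<close> stands for the zeros that
  winding numbers have to avoid.\<close>

lemma cocycle_sum:
  fixes \<Phi> :: "(real \<Rightarrow> complex \<times> real) \<Rightarrow> complex"
  assumes c: "rat_chain_boundary 2 c = fundamental_cycle K"
    and inv: "\<And>p d. continuous_on {0..1} p \<Longrightarrow> (\<And>t. t \<in> {0..1} \<Longrightarrow> cover (p t) \<notin> B) \<Longrightarrow>
      d \<in> decks \<Longrightarrow> \<Phi> (d \<circ> p) = \<Phi> p"
    and cong: "\<And>p q. (\<And>t. t \<in> {0..1} \<Longrightarrow> p t = q t) \<Longrightarrow> \<Phi> p = \<Phi> q"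
    and f: "\<And>\<sigma>. \<sigma> \<in> Poly_Mapping.keys c \<Longrightarrow> triangle_lift \<sigma> (f \<sigma>)"
    and fB: "\<And>\<sigma> e t. \<sigma> \<in> Poly_Mapping.keys c \<Longrightarrow> e \<in> triangle_edges \<Longrightarrow> t \<in> {0..1} \<Longrightarrow> cover (f \<sigma> (e t)) \<notin> B"
    and p: "\<And>\<gamma>. \<gamma> \<in># K \<Longrightarrow> edge_lift (orbit_loop (SOME X. X \<in> \<gamma>)) (p \<gamma>)"
    and pB: "\<And>\<gamma> t. \<gamma> \<in># K \<Longrightarrow> t \<in> {0..1} \<Longrightarrow> cover (p \<gamma> t) \<notin> B"
  shows "(\<Sum>\<sigma>\<in>Poly_Mapping.keys c. of_rat (Poly_Mapping.lookup c \<sigma>) * edge_sum (\<lambda>e. \<Phi> (f \<sigma> \<circ> e)))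
      = (\<Sum>\<gamma>\<in>#K. \<Phi> (p \<gamma>))"
proof -
  \<comment> \<open>The chosen lift is immaterial only for simplices that avoid \<open>B\<close>;
    the faces of \<open>c\<close> and the orbit loops are of this kind.\<close>
  define \<Psi> where "\<Psi> \<tau> = \<Phi> (SOME q. edge_lift \<tau> q)" for \<tau>
  have \<Psi>: "\<Psi> \<tau> = \<Phi> q" if q: "edge_lift \<tau> q" and qB: "\<And>t. t \<in> {0..1} \<Longrightarrow> cover (q t) \<notin> B" for \<tau> q
  proof -
    define r where "r = (SOME q. edge_lift \<tau> q)"
    have r: "edge_lift \<tau> r" unfolding r_def by (rule someI[of _ q]) (rule q)
    obtain d where d: "d \<in> decks" "\<And>t. t \<in> {0..1} \<Longrightarrow> r t = d (q t)"
      by (rule lift_unique[of "{0..1::real}" q r]) (use q r in \<open>auto simp: edge_lift_def\<close>)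
    have "\<Phi> r = \<Phi> (d \<circ> q)" using d(2) by (intro cong) simp
    also have "\<dots> = \<Phi> q" using q qB d(1) by (intro inv) (auto simp: edge_lift_def)
    finally show ?thesis by (simp add: \<Psi>_def r_def)
  qed
  have faces: "\<Psi> (singular_face 2 0 \<sigma>) - \<Psi> (singular_face 2 1 \<sigma>) + \<Psi> (singular_face 2 2 \<sigma>)
      = edge_sum (\<lambda>e. \<Phi> (f \<sigma> \<circ> e))" if \<sigma>: "\<sigma> \<in> Poly_Mapping.keys c" for \<sigma>
  proof -
    have "\<Psi> (singular_face 2 k \<sigma>) = \<Phi> (f \<sigma> \<circ> triangle_edge k)" if "k \<le> 2" for k
      using fB[OF \<sigma> triangle_edge_in[of k]] by (intro \<Psi> edge_lift_face f \<sigma> that) simp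
    then show ?thesis by (simp add: edge_sum_eq)
  qed
  have "(\<Sum>\<sigma>\<in>Poly_Mapping.keys c. of_rat (Poly_Mapping.lookup c \<sigma>) * edge_sum (\<lambda>e. \<Phi> (f \<sigma> \<circ> e)))
      = chain_eval \<Psi> (rat_chain_boundary 2 c)"
    unfolding chain_eval_boundary by (intro sum.cong refl) (simp only: faces)
  also have "\<dots> = (\<Sum>\<gamma>\<in>#K. \<Psi> (orbit_loop (SOME X. X \<in> \<gamma>)))"
    unfolding c chain_eval_fundamental_cycle ..
  also have "\<dots> = (\<Sum>\<gamma>\<in>#K. \<Phi> (p \<gamma>))"
    using p pB by (intro arg_cong[of _ _ sum_mset] image_mset_cong \<Psi>) auto
  finally show ?thesis .
qed

section \<open>Periodic orbits as closed straight lines\<close>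

lemma geodesic_flow_cover: "geodesic_flow t (cover (z, \<theta>)) = cover (z + of_real t * cis \<theta>, \<theta>)"
proof -
  have "plane_flow t ` {(a * z + b, a * cis \<theta>) | a b. (a, b) \<in> affine_group}
      = {(a * (z + of_real t * cis \<theta>) + b, a * cis \<theta>) | a b. (a, b) \<in> affine_group}"
  proof -
    have "plane_flow t (a * z + b, a * cis \<theta>) = (a * (z + of_real t * cis \<theta>) + b, a * cis \<theta>)" for a b
      by (simp add: plane_flow_def algebra_simps)
    then show ?thesis by (simp add: setcompr_eq_image image_Collect) metis
  qed
  then show ?thesis by (simp add: geodesic_flow_def tangent_cover_def tangent_class_affine)
qed

text \<open>A group element that fixes the direction \<open>cis \<theta>\<close> has linear part 1,
  so only translations make a geodesic close up in the unit tangent bundle.\<close>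

lemma cover_flow_eq_iff:
  "cover (z + of_real t * cis \<theta>, \<theta>) = cover (z, \<theta>) \<longleftrightarrow> of_real t * cis \<theta> \<in> translation_vectors"
proof -
  have "cover (z, \<theta>) = cover (z + of_real t * cis \<theta>, \<theta>) \<longleftrightarrow>
      (\<exists>a b. (a, b) \<in> affine_group \<and> z + of_real t * cis \<theta> = a * z + b \<and> cis \<theta> = a * cis \<theta>)"
    by (simp add: tangent_cover_def tangent_class_eq_iff)
  also have "\<dots> \<longleftrightarrow> (1, of_real t * cis \<theta>) \<in> affine_group"
    by (auto simp: cis_neq_zero)
  finally show ?thesis by (auto simp: translation_vectors_def)
qed

text \<open>Periods are bounded below by some \<open>\<epsilon> > 0\<close>, and a positive
  difference of two periods is a period. An infimum that is not attained would be approached by two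
  periods at a distance below \<open>\<epsilon>\<close>. Integrality of \<open>r\<close> follows
  from division with remainder by the least period.\<close>

lemma least_period:
  assumes "0 < T" "of_real T * cis \<theta> \<in> translation_vectors"
  defines "P \<equiv> {T. 0 < T \<and> of_real T * cis \<theta> \<in> translation_vectors}"
  shows "0 < Inf P" "of_real (Inf P) * cis \<theta> \<in> translation_vectors"
    and "of_real r * (of_real (Inf P) * cis \<theta>) \<in> translation_vectors \<Longrightarrow> r \<in> \<int>"
proof -
  obtain \<epsilon> where \<epsilon>: "0 < \<epsilon>" "\<And>b. b \<in> translation_vectors \<Longrightarrow> cmod b < \<epsilon> \<Longrightarrow> b = 0"
    by (rule translations_discrete) (rule that)
  have "T \<in> P" using assms by simp
  have lb: "\<epsilon> \<le> t" if "t \<in> P" for t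
    using \<epsilon>(2)[of "of_real t * cis \<theta>"] that by (force simp: P_def norm_mult)
  have bdd: "bdd_below P" using lb by (rule bdd_belowI)
  have "\<epsilon> \<le> Inf P" using \<open>T \<in> P\<close> lb by (intro cInf_greatest) auto
  then show pos: "0 < Inf P" using \<epsilon>(1) by simp
  have mem: "Inf P \<in> P"
  proof (rule ccontr)
    assume nmem: "Inf P \<notin> P"
    obtain t where t: "t \<in> P" "t < Inf P + \<epsilon>"
      using cInf_lessD[of P "Inf P + \<epsilon>"] \<open>T \<in> P\<close> \<epsilon>(1) by auto
    have "Inf P < t" using cInf_lower[OF t(1) bdd] nmem t(1) by (metis order_less_le)
    then obtain t' where t': "t' \<in> P" "t' < t" using cInf_lessD[of P t] \<open>T \<in> P\<close> by auto
    have "of_real (t - t') * cis \<theta> \<in> translation_vectors"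
      using translations_group(4)[of "of_real t * cis \<theta>" "of_real t' * cis \<theta>"] t(1) t'(1)
      by (simp add: P_def algebra_simps)
    then have "t - t' \<in> P" using t'(2) by (simp add: P_def)
    then show False using lb[of "t - t'"] cInf_lower[OF t'(1) bdd] t(2) by simp
  qed
  then show "of_real (Inf P) * cis \<theta> \<in> translation_vectors" by (simp add: P_def)
  assume r: "of_real r * (of_real (Inf P) * cis \<theta>) \<in> translation_vectors"
  define s where "s = (r - of_int \<lfloor>r\<rfloor>) * Inf P"
  have s: "0 \<le> s" "s < Inf P"
  proof -
    have "0 \<le> r - of_int \<lfloor>r\<rfloor>" "r - of_int \<lfloor>r\<rfloor> < 1" by linarith+
    then show "0 \<le> s" "s < Inf P" using pos by (simp_all add: s_def)
  qed
  have "of_real s * cis \<theta> = of_real r * (of_real (Inf P) * cis \<theta>) - of_int \<lfloor>r\<rfloor> * (of_real (Inf P) * cis \<theta>)"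
    by (simp add: s_def algebra_simps)
  also have "\<dots> \<in> translation_vectors"
    using r mem by (intro translations_group(4) translations_of_int) (auto simp: P_def)
  finally have "s = 0" using s cInf_lower[OF _ bdd, of s] by (force simp: P_def)
  then show "r \<in> \<int>" using pos by (simp add: s_def) (metis Ints_of_int)
qed

text \<open>A triple \<open>(p, \<theta>, T)\<close> describes the orbit of least period \<open>T\<close> through the class of \<open>(p, cis \<theta>)\<close>,
  the base point chosen by the fundamental cycle.\<close>

definition orbit_data :: "(complex \<times> complex) set set \<Rightarrow> complex \<times> real \<times> real \<Rightarrow> bool" where
  "orbit_data \<gamma> = (\<lambda>(p, \<theta>, T). 0 < T \<and> of_real T * cis \<theta> \<in> translation_vectors \<and>
     (\<forall>r::real. of_real r * (of_real T * cis \<theta>) \<in> translation_vectors \<longrightarrow> r \<in> \<int>) \<and>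
     \<gamma> = range (\<lambda>t. cover (p + of_real t * cis \<theta>, \<theta>)) \<and>
     orbit_loop (SOME X. X \<in> \<gamma>) =
       restrict (\<lambda>s. cover (p + of_real (s 1) * (of_real T * cis \<theta>), \<theta>)) (standard_simplex 1))"

lemma orbit_data_ex:
  assumes "periodic_orbit \<Gamma> \<gamma>"
  shows "\<exists>x. orbit_data \<gamma> x"
proof -
  obtain X\<^sub>0 T where X\<^sub>0: "X\<^sub>0 \<in> topspace (unit_tangent_bundle \<Gamma>)" and T: "T > 0" "geodesic_flow T X\<^sub>0 = X\<^sub>0"
    and \<gamma>: "\<gamma> = range (\<lambda>t. geodesic_flow t X\<^sub>0)"
    using assms by (auto simp: periodic_orbit_def)
  obtain p\<^sub>0 \<theta> where p\<^sub>0: "X\<^sub>0 = cover (p\<^sub>0, \<theta>)" using X\<^sub>0 by (auto simp: topspace_cover)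
  define X where "X = (SOME X. X \<in> \<gamma>)"
  have "X \<in> \<gamma>" unfolding X_def by (rule someI_ex) (use \<gamma> in blast)
  then obtain t\<^sub>0 where t\<^sub>0: "X = geodesic_flow t\<^sub>0 X\<^sub>0" using \<gamma> by blast
  define p where "p = p\<^sub>0 + of_real t\<^sub>0 * cis \<theta>"
  have X: "X = cover (p, \<theta>)" unfolding t\<^sub>0 p\<^sub>0 geodesic_flow_cover p_def ..
  have per: "{t. 0 < t \<and> geodesic_flow t X = X} = {t. 0 < t \<and> of_real t * cis \<theta> \<in> translation_vectors}"
    unfolding X geodesic_flow_cover cover_flow_eq_iff ..
  have T': "of_real T * cis \<theta> \<in> translation_vectors"
    using T(2) unfolding p\<^sub>0 geodesic_flow_cover cover_flow_eq_iff .
  note L = least_period[OF T(1) T', folded per, folded period_def]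
  have "\<gamma> = range (\<lambda>t. cover (p + of_real t * cis \<theta>, \<theta>))"
  proof -
    have "geodesic_flow t X\<^sub>0 = cover (p + of_real (t - t\<^sub>0) * cis \<theta>, \<theta>)" for t
      by (simp add: p\<^sub>0 geodesic_flow_cover p_def algebra_simps)
    then have "\<gamma> = (\<lambda>t. cover (p + of_real t * cis \<theta>, \<theta>)) ` range (\<lambda>t. t - t\<^sub>0)"
      unfolding \<gamma> image_image by (simp only:)
    also have "range (\<lambda>t. t - t\<^sub>0) = UNIV" using surj_diff_right[of t\<^sub>0] by simp
    finally show ?thesis .
  qed
  moreover have "orbit_loop X =
       restrict (\<lambda>s. cover (p + of_real (s 1) * (of_real (period X) * cis \<theta>), \<theta>)) (standard_simplex 1)"
    unfolding orbit_loop_def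
    by (rule restrict_ext) (simp add: X geodesic_flow_cover mult_ac)
  ultimately have "orbit_data \<gamma> (p, \<theta>, period X)"
    using L unfolding orbit_data_def X_def by blast
  then show ?thesis ..
qed

end

section \<open>A section vanishing on the lifts of a collection\<close>

lemma cis_eq_iff: "cis x = cis y \<longleftrightarrow> (x - y) / (2 * pi) \<in> \<int>"
proof -
  have "cis x = cis y \<longleftrightarrow> cis (x - y) = 1" by (simp add: cis_divide[symmetric] cis_neq_zero)
  also have "\<dots> \<longleftrightarrow> (x - y) / (2 * pi) \<in> \<int>"
    unfolding cis_eq_1_iff by (auto simp: Ints_def field_simps)
  finally show ?thesis .
qed

context flat_orbifold
begin

definition orbit_rep :: "(complex \<times> complex) set set \<Rightarrow> complex \<times> real \<times> real" where
  "orbit_rep \<gamma> = (SOME x. orbit_data \<gamma> x)"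

definition base :: "(complex \<times> complex) set set \<Rightarrow> complex" where "base \<gamma> = fst (orbit_rep \<gamma>)"
definition angle :: "(complex \<times> complex) set set \<Rightarrow> real" where "angle \<gamma> = fst (snd (orbit_rep \<gamma>))"
definition len :: "(complex \<times> complex) set set \<Rightarrow> real" where "len \<gamma> = snd (snd (orbit_rep \<gamma>))"

lemma orbit_rep:
  assumes "periodic_orbit \<Gamma> \<gamma>"
  shows "0 < len \<gamma>" "of_real (len \<gamma>) * cis (angle \<gamma>) \<in> translation_vectors"
    "of_real r * (of_real (len \<gamma>) * cis (angle \<gamma>)) \<in> translation_vectors \<Longrightarrow> r \<in> \<int>"
    "\<gamma> = range (\<lambda>t. cover (base \<gamma> + of_real t * cis (angle \<gamma>), angle \<gamma>))"
    "orbit_loop (SOME X. X \<in> \<gamma>) = restrict (\<lambda>s. cover (base \<gamma> + of_real (s 1) *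
       (of_real (len \<gamma>) * cis (angle \<gamma>)), angle \<gamma>)) (standard_simplex 1)"
proof -
  have "orbit_data \<gamma> (orbit_rep \<gamma>)"
    unfolding orbit_rep_def using orbit_data_ex[OF assms] by (rule someI_ex)
  then have *: "orbit_data \<gamma> (base \<gamma>, angle \<gamma>, len \<gamma>)" by (simp add: base_def angle_def len_def)
  from * show "0 < len \<gamma>" "of_real (len \<gamma>) * cis (angle \<gamma>) \<in> translation_vectors"
    "of_real r * (of_real (len \<gamma>) * cis (angle \<gamma>)) \<in> translation_vectors \<Longrightarrow> r \<in> \<int>"
    by (simp_all add: orbit_data_def)
  from * show "\<gamma> = range (\<lambda>t. cover (base \<gamma> + of_real t * cis (angle \<gamma>), angle \<gamma>))"
    "orbit_loop (SOME X. X \<in> \<gamma>) = restrict (\<lambda>s. cover (base \<gamma> + of_real (s 1) *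
       (of_real (len \<gamma>) * cis (angle \<gamma>)), angle \<gamma>)) (standard_simplex 1)"
    unfolding orbit_data_def prod.case by blast+
qed

text \<open>One fixed group element above each rotation; any other one differs by a lattice
  translation. The choice need not be multiplicative, whence the differences involving
  \<open>shift (c * a)\<close> below.\<close>

definition shift :: "complex \<Rightarrow> complex" where
  "shift a = (SOME b. (a, b) \<in> affine_group)"

lemma shift: "a \<in> rotations \<Longrightarrow> (a, shift a) \<in> affine_group"
  unfolding shift_def rotations_def by (metis (mono_tags) imageE prod.collapse someI)

definition rot_base :: "(complex \<times> complex) set set \<Rightarrow> complex \<Rightarrow> complex" where
  "rot_base \<gamma> a = a * base \<gamma> + shift a"

definition rot_angle :: "(complex \<times> complex) set set \<Rightarrow> complex \<Rightarrow> real" where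
  "rot_angle \<gamma> a = angle \<gamma> + Arg a"

definition rot_vec :: "(complex \<times> complex) set set \<Rightarrow> complex \<Rightarrow> complex" where
  "rot_vec \<gamma> a = a * (of_real (len \<gamma>) * cis (angle \<gamma>))"

lemma cis_rot_angle: "a \<in> rotations \<Longrightarrow> cis (rot_angle \<gamma> a) = a * cis (angle \<gamma>)"
  using cis_Arg_unit[OF rotations_norm]
  by (simp add: rot_angle_def cis_mult[symmetric] mult.commute)

lemma rot_vec_cis: "a \<in> rotations \<Longrightarrow> rot_vec \<gamma> a = of_real (len \<gamma>) * cis (rot_angle \<gamma> a)"
  by (simp add: rot_vec_def cis_rot_angle mult_ac)

lemma rot_vec_translation: "periodic_orbit \<Gamma> \<gamma> \<Longrightarrow> a \<in> rotations \<Longrightarrow> rot_vec \<gamma> a \<in> translation_vectors"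
  unfolding rot_vec_def by (intro rotate_translations orbit_rep)

lemma cover_rot: "a \<in> rotations \<Longrightarrow> (a, b) \<in> affine_group \<Longrightarrow>
    cover (a * z + b, rot_angle \<gamma> a) = cover (z, angle \<gamma>)"
  unfolding tangent_cover_def prod.case cis_rot_angle
  using tangent_class_eq_iff[of z "cis (angle \<gamma>)" "a * z + b" "a * cis (angle \<gamma>)"] by auto

text \<open>\<open>rot_factor \<gamma> a\<close> vanishes exactly on those lifts of \<open>\<gamma>\<close> that are translates of its \<open>a\<close>-rotated
  copy: it is \<open>quasi_theta\<close> of the projection along that copy.\<close>

definition rot_y :: "(complex \<times> complex) set set \<Rightarrow> complex \<Rightarrow> complex \<Rightarrow> real" where
  "rot_y \<gamma> a z = wedge (rot_vec \<gamma> a) (z - rot_base \<gamma> a) / covolume"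

definition rot_t :: "(complex \<times> complex) set set \<Rightarrow> complex \<Rightarrow> real \<Rightarrow> real" where
  "rot_t \<gamma> a \<theta> = (\<theta> - rot_angle \<gamma> a) / (2 * pi)"

definition rot_factor :: "(complex \<times> complex) set set \<Rightarrow> complex \<Rightarrow> complex \<times> real \<Rightarrow> complex" where
  "rot_factor \<gamma> a x = quasi_theta (rot_y \<gamma> a (fst x)) (rot_t \<gamma> a (snd x))"

lemma continuous_on_wedge [continuous_intros]:
  "continuous_on S f \<Longrightarrow> continuous_on S (\<lambda>x. wedge c (f x))"
  unfolding wedge_def by (intro continuous_intros)

lemma continuous_on_rot_factor:
  assumes "continuous_on S f"
  shows "continuous_on S (\<lambda>x. rot_factor \<gamma> a (f x))"
proof -
  have "continuous_on S (\<lambda>x. (rot_y \<gamma> a (fst (f x)), rot_t \<gamma> a (snd (f x))))"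
    unfolding rot_y_def rot_t_def using basis(3) by (intro continuous_intros assms) auto
  from continuous_on_compose2[OF continuous_on_quasi_theta this] show ?thesis
    by (simp add: rot_factor_def)
qed

lemma rot_factor_zero_cis:
  assumes "a \<in> rotations" "rot_factor \<gamma> a x = 0"
  shows "cis (snd x) = a * cis (angle \<gamma>)"
  using assms by (simp add: rot_factor_def quasi_theta_eq_0 rot_t_def cis_rot_angle[symmetric] cis_eq_iff)

text \<open>The least period vector is primitive and has a partner \<open>m\<close> with area
  \<open>covolume\<close>. So the line on which \<open>rot_y\<close> equals \<open>n\<close> is the
  base line translated by \<open>n * m\<close>, which is again a lift of the orbit. For a multiple
  of a primitive vector there would be zeros on lines that are not lifts.\<close>

lemma rot_factor_zero_imp:
  assumes \<gamma>: "periodic_orbit \<Gamma> \<gamma>" and a: "a \<in> rotations" and zero: "rot_factor \<gamma> a x = 0"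
  shows "cover x \<in> \<gamma>"
proof -
  have a0: "a \<noteq> 0" using rotations_norm[OF a] by auto
  have u: "rot_vec \<gamma> a \<in> translation_vectors" "rot_vec \<gamma> a \<noteq> 0"
    using rot_vec_translation[OF \<gamma> a] orbit_rep(1)[OF \<gamma>] a0 by (simp_all add: rot_vec_def cis_neq_zero)
  have prim: "r \<in> \<int>" if "of_real r * rot_vec \<gamma> a \<in> translation_vectors" for r :: real
  proof (rule orbit_rep(3)[OF \<gamma>])
    have "(1 / a) * (of_real r * rot_vec \<gamma> a) \<in> translation_vectors"
      by (intro rotate_translations rotations_inverse a that)
    then show "of_real r * (of_real (len \<gamma>) * cis (angle \<gamma>)) \<in> translation_vectors"
      using a0 by (simp add: rot_vec_def)
  qed
  obtain m where m: "m \<in> translation_vectors" "wedge (rot_vec \<gamma> a) m = covolume"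
    by (rule primitive_partner[OF u prim]) (auto intro: that)
  obtain n :: int where n: "rot_y \<gamma> a (fst x) = of_int n"
    using zero by (auto simp: rot_factor_def quasi_theta_eq_0 elim: Ints_cases)
  have "wedge (rot_vec \<gamma> a) (fst x - rot_base \<gamma> a) = of_int n * covolume"
    using n basis(3) by (simp add: rot_y_def field_simps)
  then have "wedge (rot_vec \<gamma> a) (fst x - rot_base \<gamma> a - of_int n * m) = 0"
    using m(2) by (simp add: wedge_simps(4)[of _ "fst x - rot_base \<gamma> a"] wedge_of_int)
  then obtain r :: real where r: "fst x - rot_base \<gamma> a - of_int n * m = of_real r * rot_vec \<gamma> a"
    using wedge_eq_0_imp u(2) by blast
  have eq: "fst x = a * (base \<gamma> + of_real (r * len \<gamma>) * cis (angle \<gamma>)) + (shift a + of_int n * m)"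
    using r by (simp add: rot_base_def rot_vec_def algebra_simps)
  have "(1, of_int n * m) \<in> affine_group"
    using translations_of_int[OF m(1), of n] by (simp add: translation_vectors_def)
  from affine_group_comp[OF this shift[OF a]] have ab: "(a, shift a + of_int n * m) \<in> affine_group"
    by simp
  have "cover x = cover (a * (base \<gamma> + of_real (r * len \<gamma>) * cis (angle \<gamma>)) + (shift a + of_int n * m), rot_angle \<gamma> a)"
    using rot_factor_zero_cis[OF a zero] eq cis_rot_angle[OF a]
    by (simp add: tangent_cover_def case_prod_beta)
  also have "\<dots> = cover (base \<gamma> + of_real (r * len \<gamma>) * cis (angle \<gamma>), angle \<gamma>)"
    by (rule cover_rot[OF a ab])
  also have "\<dots> \<in> \<gamma>" by (subst (3) orbit_rep(4)[OF \<gamma>]) blast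
  finally show ?thesis .
qed

lemma wedge_rot_vec_int:
  assumes "periodic_orbit \<Gamma> \<gamma>" "a \<in> rotations" "c \<in> translation_vectors"
  shows "wedge (rot_vec \<gamma> a) c / covolume \<in> \<int>"
proof -
  obtain n :: int where "wedge (rot_vec \<gamma> a) c = of_int n * covolume"
    by (rule wedge_translations[OF rot_vec_translation[OF assms(1,2)] assms(3)])
  then show ?thesis using basis(3) by simp
qed

text \<open>The group element that moves the base orbit to \<open>x\<close> and the chosen one with
  the same linear part differ by a lattice translation, along which \<open>rot_y\<close> changes by
  an integer.\<close>

lemma rot_factor_zero_ex:
  assumes \<gamma>: "periodic_orbit \<Gamma> \<gamma>" and x: "cover x \<in> \<gamma>"
  shows "\<exists>a\<in>rotations. rot_factor \<gamma> a x = 0"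
proof -
  have "cover x \<in> range (\<lambda>t. cover (base \<gamma> + of_real t * cis (angle \<gamma>), angle \<gamma>))"
    using x by (subst orbit_rep(4)[OF \<gamma>, symmetric])
  then obtain t where "cover (base \<gamma> + of_real t * cis (angle \<gamma>), angle \<gamma>) = cover x" by force
  then obtain a b where ab: "(a, b) \<in> affine_group" "fst x = a * (base \<gamma> + of_real t * cis (angle \<gamma>)) + b"
    "cis (snd x) = a * cis (angle \<gamma>)"
    by (auto simp: tangent_cover_def case_prod_beta tangent_class_eq_iff)
  have a: "a \<in> rotations" using ab(1) by (force simp: rotations_def)
  have "wedge (rot_vec \<gamma> a) (a * (of_real t * cis (angle \<gamma>))) = 0"
    unfolding rot_vec_def wedge_rotate[OF rotations_norm[OF a]] by (simp add: wedge_simps)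
  moreover have "fst x - rot_base \<gamma> a = a * (of_real t * cis (angle \<gamma>)) + (b - shift a)"
    by (simp add: ab(2) rot_base_def algebra_simps)
  ultimately have "rot_y \<gamma> a (fst x) = wedge (rot_vec \<gamma> a) (b - shift a) / covolume"
    by (simp add: rot_y_def wedge_simps(2))
  also have "\<dots> \<in> \<int>"
    by (intro wedge_rot_vec_int \<gamma> a translations_diff[OF ab(1) shift[OF a]])
  finally have "rot_y \<gamma> a (fst x) \<in> \<int>" .
  moreover have "rot_t \<gamma> a (snd x) \<in> \<int>"
    using ab(3) by (simp add: rot_t_def cis_rot_angle[OF a, symmetric] cis_eq_iff)
  ultimately show ?thesis using a by (auto simp: rot_factor_def quasi_theta_eq_0)
qed

text \<open>The direction at \<open>x\<close> determines the rotation. Hence a point on a lift is a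
  zero of one factor only, and crossings are not counted twice.\<close>

lemma rot_factor_zero_unique:
  "a \<in> rotations \<Longrightarrow> rot_factor \<gamma> a x = 0 \<Longrightarrow> a' \<in> rotations \<Longrightarrow> rot_factor \<gamma> a' x = 0 \<Longrightarrow> a = a'"
  using rot_factor_zero_cis[of a \<gamma> x] rot_factor_zero_cis[of a' \<gamma> x] by (simp add: cis_neq_zero)

section \<open>The homological constraint and the deck invariance of the winding\<close>

definition total_vec :: "orbit_collection \<Rightarrow> complex" where
  "total_vec K = (\<Sum>\<gamma>\<in>#K. \<Sum>a\<in>rotations. rot_vec \<gamma> a)"

definition orbit_path :: "(complex \<times> complex) set set \<Rightarrow> real \<Rightarrow> complex \<times> real" where
  "orbit_path \<gamma> t = (base \<gamma> + of_real t * (of_real (len \<gamma>) * cis (angle \<gamma>)), angle \<gamma>)"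

lemma edge_lift_orbit_path:
  assumes "periodic_orbit \<Gamma> \<gamma>"
  shows "edge_lift (orbit_loop (SOME X. X \<in> \<gamma>)) (orbit_path \<gamma>)"
  unfolding edge_lift_def orbit_rep(5)[OF assms] orbit_path_def
  using edge_point_mem by (auto intro!: continuous_intros simp: edge_point_def)

lemma orbit_path_mem: "periodic_orbit \<Gamma> \<gamma> \<Longrightarrow> cover (orbit_path \<gamma> t) \<in> \<gamma>"
proof -
  assume \<gamma>: "periodic_orbit \<Gamma> \<gamma>"
  have "cover (orbit_path \<gamma> t) \<in> range (\<lambda>t. cover (base \<gamma> + of_real t * cis (angle \<gamma>), angle \<gamma>))"
    by (rule range_eqI[of _ _ "t * len \<gamma>"]) (simp add: orbit_path_def mult_ac)
  then show ?thesis by (subst orbit_rep(4)[OF \<gamma>])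
qed

text \<open>Summed over all rotations, the rotated displacement of a path is invariant under
  \<open>decks\<close>, and it vanishes along the boundary of every triangle. Its value on the
  fundamental cycle is \<open>total_vec K\<close>.\<close>

lemma total_vec_eq_0:
  assumes K: "periodic_collection \<Gamma> K" and c: "bounds \<Gamma> c K"
  shows "total_vec K = 0"
proof -
  have c': "rat_chain_boundary 2 c = fundamental_cycle K"
    and sing: "\<And>\<sigma>. \<sigma> \<in> Poly_Mapping.keys c \<Longrightarrow> singular_simplex 2 (unit_tangent_bundle \<Gamma>) \<sigma>"
    using c by (auto simp: bounds_def rat_singular_chain_def)
  have po: "periodic_orbit \<Gamma> \<gamma>" if "\<gamma> \<in># K" for \<gamma> using K that by (simp add: periodic_collection_def)
  define f where "f \<sigma> = (SOME f. triangle_lift \<sigma> f)" for \<sigma>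
  have f: "triangle_lift \<sigma> (f \<sigma>)" if "\<sigma> \<in> Poly_Mapping.keys c" for \<sigma>
    unfolding f_def using triangle_lift_ex[OF sing[OF that]] by (metis someI)
  define \<Phi> where "\<Phi> p = (\<Sum>a\<in>rotations. a * (fst (p 1) - fst (p 0)))" for p :: "real \<Rightarrow> complex \<times> real"
  have "(\<Sum>\<sigma>\<in>Poly_Mapping.keys c. of_rat (Poly_Mapping.lookup c \<sigma>) * edge_sum (\<lambda>e. \<Phi> (f \<sigma> \<circ> e)))
      = (\<Sum>\<gamma>\<in>#K. \<Phi> (orbit_path \<gamma>))"
  proof (rule cocycle_sum[OF c', where B = "{}"])
    fix p d assume "d \<in> decks"
    then obtain c b \<beta> where d: "(c, b) \<in> affine_group" "d = (\<lambda>x. (c * fst x + b, snd x + \<beta>))"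
      by (auto simp: decks_def)
    have "c \<in> rotations" using d(1) by (force simp: rotations_def)
    have "\<Phi> (d \<circ> p) = (\<Sum>a\<in>rotations. (c * a) * (fst (p 1) - fst (p 0)))"
      unfolding \<Phi>_def d(2) by (simp add: algebra_simps)
    also have "\<dots> = \<Phi> p"
      unfolding \<Phi>_def
      by (rule sum.reindex_bij_betw[OF rotations_bij[OF \<open>c \<in> rotations\<close>], where g = "\<lambda>a. a * (fst (p 1) - fst (p 0))"])
    finally show "\<Phi> (d \<circ> p) = \<Phi> p" .
  qed (use f edge_lift_orbit_path po in \<open>auto simp: \<Phi>_def\<close>)
  moreover have "edge_sum (\<lambda>e. \<Phi> (g \<circ> e)) = 0" for g
    by (simp add: edge_sum_def \<Phi>_def sum_subtractf[symmetric] sum.distrib[symmetric] linepath_def algebra_simps)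
  moreover have "\<Phi> (orbit_path \<gamma>) = (\<Sum>a\<in>rotations. rot_vec \<gamma> a)" for \<gamma>
    by (simp add: \<Phi>_def orbit_path_def rot_vec_def)
  ultimately show ?thesis by (simp add: total_vec_def)
qed

definition winding :: "orbit_collection \<Rightarrow> (real \<Rightarrow> complex \<times> real) \<Rightarrow> complex" where
  "winding K p = (\<Sum>\<gamma>\<in>#K. \<Sum>a\<in>rotations. winding_number (\<lambda>t. rot_factor \<gamma> a (p t)) 0)"

text \<open>A deck transformation with linear part \<open>c\<close> carries lines of type
  \<open>a\<close> to lines of type \<open>c * a\<close>. Measured against the chosen base lines it
  is the lattice translation \<open>shift a + (b - shift (c * a)) / c\<close>, and the area of this
  vector with \<open>rot_vec \<gamma> a\<close> gives the integer in the multiplier.\<close>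

lemma rot_factor_deck:
  assumes \<gamma>: "periodic_orbit \<Gamma> \<gamma>" and a: "a \<in> rotations"
    and d: "(c, b) \<in> affine_group" "cis \<beta> = c"
  shows "rot_factor \<gamma> (c * a) (c * z + b, \<theta> + \<beta>) =
    exp (2 * pi * \<i> * (wedge (rot_vec \<gamma> a) (shift a + (b - shift (c * a)) / c) / covolume) * (rot_t \<gamma> a \<theta> + 1/2)) *
      rot_factor \<gamma> a (z, \<theta>)"
    and "shift a + (b - shift (c * a)) / c \<in> translation_vectors"
proof -
  have c: "c \<in> rotations" using d(1) by (force simp: rotations_def)
  have ca: "c * a \<in> rotations" using c a by (rule rotations_mult)
  have c0: "c \<noteq> 0" using rotations_norm[OF c] by auto
  let ?\<delta> = "shift a + (b - shift (c * a)) / c"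
  have "((1 / c) * (c * a), (1 / c) * shift (c * a) + - b / c) \<in> affine_group"
    by (intro affine_group_comp affine_group_inverse d shift ca)
  then have "(a, (1 / c) * shift (c * a) + - b / c) \<in> affine_group" using c0 by simp
  from translations_diff[OF shift[OF a] this] show \<delta>: "?\<delta> \<in> translation_vectors"
    using c0 by (simp add: diff_divide_distrib algebra_simps)
  obtain n :: int where n: "wedge (rot_vec \<gamma> a) ?\<delta> / covolume = of_int n"
    using wedge_rot_vec_int[OF \<gamma> a \<delta>] by (elim Ints_cases)
  have "rot_vec \<gamma> (c * a) = c * rot_vec \<gamma> a" by (simp add: rot_vec_def mult_ac)
  moreover have "c * z + b - rot_base \<gamma> (c * a) = c * ((z - rot_base \<gamma> a) + ?\<delta>)"
    using c0 by (simp add: rot_base_def field_simps)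
  ultimately have y: "rot_y \<gamma> (c * a) (c * z + b) = rot_y \<gamma> a z + of_int n"
    unfolding rot_y_def n[symmetric]
    by (simp only: wedge_rotate[OF rotations_norm[OF c]] wedge_simps(2) add_divide_distrib)
  have "cis (\<beta> + rot_angle \<gamma> a) = cis (rot_angle \<gamma> (c * a))"
    unfolding cis_mult[symmetric] cis_rot_angle[OF a] cis_rot_angle[OF ca] d(2) by (simp add: mult_ac)
  then obtain k :: int where "(\<beta> + rot_angle \<gamma> a - rot_angle \<gamma> (c * a)) / (2 * pi) = of_int k"
    unfolding cis_eq_iff by (elim Ints_cases)
  then have t: "rot_t \<gamma> (c * a) (\<theta> + \<beta>) = rot_t \<gamma> a \<theta> + of_int k"
    by (simp add: rot_t_def field_simps)
  show "rot_factor \<gamma> (c * a) (c * z + b, \<theta> + \<beta>) =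
    exp (2 * pi * \<i> * (wedge (rot_vec \<gamma> a) ?\<delta> / covolume) * (rot_t \<gamma> a \<theta> + 1/2)) * rot_factor \<gamma> a (z, \<theta>)"
    unfolding rot_factor_def fst_conv snd_conv y t quasi_theta_shift_t quasi_theta_shift_y n by simp
qed

text \<open>Each factor gains \<open>n \<gamma> a * \<tau>\<close>, where \<open>\<tau>\<close> is
  the number of turns made by the angle along \<open>p\<close>. In the sum over \<open>a\<close> the
  contributions of \<open>shift\<close> cancel; the rest is linear in the orbit vectors and adds up
  to the area of \<open>total_vec K\<close> with \<open>b / c\<close>.\<close>

lemma winding_deck:
  assumes K: "periodic_collection \<Gamma> K" and zero: "total_vec K = 0"
    and p: "continuous_on {0..1} p" "\<And>t. t \<in> {0..1} \<Longrightarrow> cover (p t) \<notin> support K" and d: "d \<in> decks"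
  shows "winding K (d \<circ> p) = winding K p"
proof -
  obtain c b \<beta> where cb: "(c, b) \<in> affine_group" "cis \<beta> = c" and d: "d = (\<lambda>x. (c * fst x + b, snd x + \<beta>))"
    using d by (auto simp: decks_def)
  have c: "c \<in> rotations" using cb(1) by (force simp: rotations_def)
  have po: "periodic_orbit \<Gamma> \<gamma>" if "\<gamma> \<in># K" for \<gamma> using K that by (simp add: periodic_collection_def)
  define \<delta> where "\<delta> a = shift a + (b - shift (c * a)) / c" for a
  define n where "n \<gamma> a = wedge (rot_vec \<gamma> a) (\<delta> a) / covolume" for \<gamma> a
  define \<tau> where "\<tau> = (snd (p 1) - snd (p 0)) / (2 * pi)"
  have wn: "winding_number (\<lambda>t. rot_factor \<gamma> (c * a) ((d \<circ> p) t)) 0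
      = of_real (n \<gamma> a * \<tau>) + winding_number (\<lambda>t. rot_factor \<gamma> a (p t)) 0"
    if \<gamma>: "\<gamma> \<in># K" and a: "a \<in> rotations" for \<gamma> a
  proof -
    let ?E = "\<lambda>t. exp (2 * pi * \<i> * of_real (n \<gamma> a) * (of_real (rot_t \<gamma> a (snd (p t))) + 1/2))"
    have nz: "rot_factor \<gamma> a (p t) \<noteq> 0" if "t \<in> {0..1}" for t
    proof
      assume "rot_factor \<gamma> a (p t) = 0"
      then have "cover (p t) \<in> \<gamma>" by (rule rot_factor_zero_imp[OF po[OF \<gamma>] a])
      then show False using p(2)[OF that] \<gamma> by (auto simp: support_def)
    qed
    have ch: "continuous_on {0..1} (\<lambda>t. 2 * pi * \<i> * of_real (n \<gamma> a) * (of_real (rot_t \<gamma> a (snd (p t))) + 1/2))"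
      unfolding rot_t_def by (intro continuous_intros p(1)) auto
    have "winding_number (\<lambda>t. rot_factor \<gamma> (c * a) ((d \<circ> p) t)) 0
        = winding_number (\<lambda>t. ?E t * rot_factor \<gamma> a (p t)) 0"
      using rot_factor_deck(1)[OF po[OF \<gamma>] a cb]
      by (intro winding_number_cong) (simp add: d n_def \<delta>_def)
    also have "\<dots> = winding_number ?E 0 + winding_number (\<lambda>t. rot_factor \<gamma> a (p t)) 0"
      using nz by (intro winding_number_mult continuous_on_rot_factor p(1) continuous_on_exp ch) auto
    also have "winding_number ?E 0 = of_real (n \<gamma> a * \<tau>)"
      by (subst winding_number_exp[OF ch refl])
         (simp add: \<tau>_def rot_t_def diff_divide_distrib algebra_simps)
    finally show ?thesis .
  qed
  have "winding K (d \<circ> p) = (\<Sum>\<gamma>\<in>#K. \<Sum>a\<in>rotations. winding_number (\<lambda>t. rot_factor \<gamma> (c * a) ((d \<circ> p) t)) 0)"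
    unfolding winding_def
    by (subst sum.reindex_bij_betw[OF rotations_bij[OF c], symmetric]) (rule refl)
  also have "\<dots> = (\<Sum>\<gamma>\<in>#K. (\<Sum>a\<in>rotations. of_real (n \<gamma> a * \<tau>)) + (\<Sum>a\<in>rotations. winding_number (\<lambda>t. rot_factor \<gamma> a (p t)) 0))"
    using wn by (intro arg_cong[of _ _ sum_mset] image_mset_cong) (simp add: sum.distrib)
  also have "\<dots> = (\<Sum>\<gamma>\<in>#K. \<Sum>a\<in>rotations. of_real (n \<gamma> a * \<tau>)) + winding K p"
    unfolding winding_def by (simp add: sum_mset.distrib)
  also have "(\<Sum>\<gamma>\<in>#K. \<Sum>a\<in>rotations. complex_of_real (n \<gamma> a * \<tau>)) = 0"
  proof -
    have n_eq: "(\<Sum>a\<in>rotations. n \<gamma> a) = wedge (\<Sum>a\<in>rotations. rot_vec \<gamma> a) (b / c) / covolume" for \<gamma>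
    proof -
      \<comment> \<open>Rotating both arguments by \<open>c\<close> turns the summand for
        \<open>a\<close> into the \<open>shift\<close> term that belongs to
        \<open>c * a\<close>.\<close>
      have "(\<Sum>a\<in>rotations. wedge (rot_vec \<gamma> a) (shift (c * a) / c)) = (\<Sum>a\<in>rotations. wedge (rot_vec \<gamma> (c * a)) (shift (c * a)))"
      proof (rule sum.cong[OF refl])
        fix a
        have "wedge (c * rot_vec \<gamma> a) (c * (shift (c * a) / c)) = wedge (rot_vec \<gamma> a) (shift (c * a) / c)"
          by (rule wedge_rotate[OF rotations_norm[OF c]])
        moreover have "c \<noteq> 0" using rotations_norm[OF c] by auto
        ultimately show "wedge (rot_vec \<gamma> a) (shift (c * a) / c) = wedge (rot_vec \<gamma> (c * a)) (shift (c * a))"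
          by (simp add: rot_vec_def mult_ac)
      qed
      also have "\<dots> = (\<Sum>a\<in>rotations. wedge (rot_vec \<gamma> a) (shift a))"
        by (rule sum.reindex_bij_betw[OF rotations_bij[OF c]])
      finally have "(\<Sum>a\<in>rotations. wedge (rot_vec \<gamma> a) (\<delta> a)) = (\<Sum>a\<in>rotations. wedge (rot_vec \<gamma> a) (b / c))"
        by (simp add: \<delta>_def wedge_simps diff_divide_distrib sum.distrib sum_subtractf)
      then show ?thesis by (simp add: n_def wedge_sum sum_divide_distrib[symmetric])
    qed
    have "(\<Sum>\<gamma>\<in>#K. \<Sum>a\<in>rotations. n \<gamma> a) = wedge (total_vec K) (b / c) / covolume"
    proof -
      have "(\<Sum>\<gamma>\<in>#M. \<Sum>a\<in>rotations. n \<gamma> a) = wedge (total_vec M) (b / c) / covolume" for M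
        unfolding total_vec_def by (induction M) (simp_all add: n_eq wedge_simps add_divide_distrib)
      then show ?thesis .
    qed
    then have z: "(\<Sum>\<gamma>\<in>#K. \<Sum>a\<in>rotations. n \<gamma> a) = 0" by (simp add: zero wedge_simps)
    have "(\<Sum>\<gamma>\<in>#M. \<Sum>a\<in>rotations. complex_of_real (n \<gamma> a * \<tau>)) = of_real ((\<Sum>\<gamma>\<in>#M. \<Sum>a\<in>rotations. n \<gamma> a) * \<tau>)" for M
      by (induction M) (simp_all add: distrib_right sum_distrib_right)
    then show ?thesis by (simp add: z)
  qed
  finally show ?thesis by (simp only: add_0_left)
qed

end

section \<open>Intersection numbers as winding numbers\<close>

lemma triangle_point_coords: "triangle_point w 1 = Re w" "triangle_point w 2 = Im w"
  by (simp_all add: triangle_point_def simplex_point_def)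

lemma simplex_interior_triangle: "triangle_point w \<in> simplex_interior \<longleftrightarrow> w \<in> interior triangle"
proof -
  have "(\<forall>i\<le>2. 0 < triangle_point w i) \<longleftrightarrow> w \<in> interior triangle"
  proof
    assume *: "\<forall>i\<le>2. 0 < triangle_point w i"
    from *[rule_format, of 0] *[rule_format, of 1] *[rule_format, of 2]
    show "w \<in> interior triangle" by (simp add: triangle_point_def simplex_point_def interior_triangle)
  qed (auto simp: triangle_point_def simplex_point_def interior_triangle)
  then show ?thesis
    using interior_subset[of triangle] by (auto simp: simplex_interior_def triangle_point_mem)
qed

lemma of_rat_sum_mset: "of_rat (\<Sum>x\<in>#M. h x) = (\<Sum>x\<in>#M. of_rat (h x))"
  by (induction M) (simp_all add: of_rat_add)

lemma crossing_det_wedge: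
  "crossing_det x D = wedge (cis (snd x)) (fst (D (1, 0))) * snd (D (0, 1))
     - snd (D (1, 0)) * wedge (cis (snd x)) (fst (D (0, 1)))"
  by (simp add: crossing_det_def det_3 coordinates_def wedge_def case_prod_beta algebra_simps)

context flat_orbifold
begin

text \<open>\<open>lift_at\<close> provides a lift near one point only, while winding numbers use a
  lift \<open>f\<close> of the whole triangle. A deck transformation matches the two at
  \<open>z\<close>; nearby they stay closer than \<open>separation\<close> and hence agree.\<close>

lemma local_lift_deck:
  assumes f: "triangle_lift \<sigma> f" and z: "z \<in> interior triangle"
    and g: "\<forall>\<^sub>F u in nhds (Re z, Im z). cover (g u) = \<sigma> (simplex_point u)"
    and cont: "isCont g (Re z, Im z)"
  obtains d where "d \<in> decks" "\<forall>\<^sub>F w in nhds z. f w = d (g (Re w, Im w))"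
proof -
  have z': "z \<in> triangle" using z interior_subset by blast
  have "((\<lambda>w. (Re w, Im w)) \<longlongrightarrow> (Re z, Im z)) (nhds z)"
    by (intro tendsto_intros filterlim_ident)
  then have g': "\<forall>\<^sub>F w in nhds z. cover (g (Re w, Im w)) = \<sigma> (triangle_point w)"
    using g unfolding triangle_point_def filterlim_def le_filter_def eventually_filtermap by blast
  have fz: "cover (f w) = \<sigma> (triangle_point w)" if "w \<in> triangle" for w
    using f that by (simp add: triangle_lift_def)
  have "cover (g (Re z, Im z)) = cover (f z)"
    using eventually_nhds_x_imp_x[OF g'] fz[OF z'] by simp
  then obtain d where d: "d \<in> decks" "f z = d (g (Re z, Im z))"
    unfolding cover_eq_iff by blast
  have "isCont f z"
    using f z continuous_on_interior by (auto simp: triangle_lift_def)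
  moreover have "isCont (\<lambda>w. d (g (Re w, Im w))) z"
  proof -
    have "isCont (\<lambda>w. (Re w, Im w)) z"
      by (intro continuous_Pair linear_continuous_at bounded_linear_Re bounded_linear_Im)
    then have "isCont (\<lambda>w. g (Re w, Im w)) z" by (rule isCont_o2) (rule cont)
    moreover have "isCont d (g (Re z, Im z))"
      using continuous_on_deck[OF d(1), of UNIV] by (metis continuous_on_eq_continuous_at open_UNIV UNIV_I)
    ultimately show ?thesis by (rule isCont_o2)
  qed
  ultimately have "isCont (\<lambda>w. dist (f w) (d (g (Re w, Im w)))) z" by (intro continuous_intros)
  then have "((\<lambda>w. dist (f w) (d (g (Re w, Im w)))) \<longlongrightarrow> dist (f z) (d (g (Re z, Im z)))) (nhds z)"
    using tendsto_at_iff_tendsto_nhds[of "\<lambda>w. dist (f w) (d (g (Re w, Im w)))" z]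
    by (simp only: isCont_def)
  then have "((\<lambda>w. dist (f w) (d (g (Re w, Im w)))) \<longlongrightarrow> 0) (nhds z)"
    using d(2) by simp
  then have close: "\<forall>\<^sub>F w in nhds z. dist (f w) (d (g (Re w, Im w))) < separation"
    using separation(1) by (rule order_tendstoD)
  have "\<forall>\<^sub>F w in nhds z. w \<in> interior triangle"
    using z by (intro eventually_nhds_in_open) auto
  with close g' have "\<forall>\<^sub>F w in nhds z. f w = d (g (Re w, Im w))"
  proof eventually_elim
    case (elim w)
    have "w \<in> triangle" using elim(3) interior_subset by blast
    then show ?case
      using elim fz cover_deck[OF d(1), of "g (Re w, Im w)"] by (intro separation(2)) simp_all
  qed
  with d(1) show thesis by (rule that)
qed

text \<open>At a zero the section is, to first order, the projection along the flow direction, so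
  its Jacobian is the triple product of the simplex frame with the flow vector, scaled by
  \<open>len \<gamma> / covolume\<close>. The factor \<open>2 * pi\<close> from
  \<open>quasi_theta\<close> cancels against the one in \<open>rot_t\<close>.\<close>

lemma rot_factor_derivative:
  assumes \<gamma>: "periodic_orbit \<Gamma> \<gamma>" and a: "a \<in> rotations"
    and f: "triangle_lift \<sigma> f" and z: "z \<in> interior triangle" and zero: "rot_factor \<gamma> a (f z) = 0"
    and g: "lift_at \<Gamma> \<sigma> (triangle_point z) g D"
  obtains M where "((\<lambda>w. rot_factor \<gamma> a (f w)) has_derivative M) (at z)"
    "Im (cnj (M 1) * M \<i>) = len \<gamma> / covolume * crossing_det (g (triangle_point z 1, triangle_point z 2)) D"
proof -
  have g1: "\<forall>\<^sub>F u in nhds (Re z, Im z). cover (g u) = \<sigma> (simplex_point u)"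
    and gD: "(g has_derivative D) (at (Re z, Im z))"
    using g unfolding lift_at_def triangle_point_coords by blast+
  obtain d where d: "d \<in> decks" and fd: "\<forall>\<^sub>F w in nhds z. f w = d (g (Re w, Im w))"
    by (rule local_lift_deck[OF f z g1 has_derivative_continuous[OF gD]])
  obtain c b \<beta> where cb: "(c, b) \<in> affine_group" "cis \<beta> = c" and d': "d = (\<lambda>x. (c * fst x + b, snd x + \<beta>))"
    using d by (auto simp: decks_def)
  have c1: "cmod c = 1" using cb(1) by (rule affine_group_norm)
  obtain n m :: int where nm: "rot_y \<gamma> a (fst (f z)) = of_int n" "rot_t \<gamma> a (snd (f z)) = of_int m"
    using zero by (auto simp: rot_factor_def quasi_theta_eq_0 elim!: Ints_cases)
  let ?g = "\<lambda>w. g (Re w, Im w)" and ?D = "\<lambda>h. D (Re h, Im h)"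
  let ?yt = "\<lambda>x. (rot_y \<gamma> a (c * fst x + b), rot_t \<gamma> a (snd x + \<beta>))"
  let ?yt' = "\<lambda>h. (wedge (rot_vec \<gamma> a) (c * fst h) / covolume, snd h / (2 * pi))"
  have g': "(?g has_derivative ?D) (at z)"
    by (rule has_derivative_compose[of "\<lambda>w. (Re w, Im w)" "\<lambda>w. (Re w, Im w)", OF _ gD])
       (intro derivative_intros has_derivative_Re has_derivative_Im has_derivative_ident)
  have fz: "f z = (c * fst (?g z) + b, snd (?g z) + \<beta>)"
    using eventually_nhds_x_imp_x[OF fd] by (simp add: d')
  have "((\<lambda>x. rot_y \<gamma> a (c * fst x + b)) has_derivative (\<lambda>h. wedge (rot_vec \<gamma> a) (c * fst h) / covolume)) (at (?g z))"
  proof -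
    have "((\<lambda>x. rot_y \<gamma> a (c * fst x + b)) has_derivative
      (\<lambda>h. Im (cnj (rot_vec \<gamma> a) * (c * fst h)) / covolume)) (at (?g z))"
      unfolding rot_y_def wedge_def using basis(3)
      by (auto intro!: derivative_eq_intros)
    then show ?thesis by (simp add: wedge_def)
  qed
  moreover have "((\<lambda>x. rot_t \<gamma> a (snd x + \<beta>)) has_derivative (\<lambda>h. snd h / (2 * pi))) (at (?g z))"
    unfolding rot_t_def by (auto intro!: derivative_eq_intros)
  ultimately have "(?yt has_derivative ?yt') (at (?g z))" by (rule has_derivative_Pair)
  then have yt: "((\<lambda>w. ?yt (?g w)) has_derivative (\<lambda>h. ?yt' (?D h))) (at z)"
    by (rule has_derivative_compose[OF g'])
  have "?yt (?g z) = (of_int n, of_int m)" using nm fz by simp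
  then have "((\<lambda>x. quasi_theta (fst x) (snd x)) has_derivative
     (\<lambda>h. exp (\<i> * pi * of_int n) * (\<i> * pi * of_real (fst h) - 2 * of_real (snd h)))) (at (?yt (?g z)))"
    using has_derivative_quasi_theta by simp
  define M where "M = (\<lambda>h. exp (\<i> * pi * of_int n) * (\<i> * pi * of_real (fst (?yt' (?D h))) - 2 * of_real (snd (?yt' (?D h)))))"
  have "((\<lambda>w. quasi_theta (fst (?yt (?g w))) (snd (?yt (?g w)))) has_derivative M) (at z)"
    unfolding M_def by (rule has_derivative_compose[OF yt]) fact
  moreover have "\<forall>\<^sub>F w in nhds z. quasi_theta (fst (?yt (?g w))) (snd (?yt (?g w))) = rot_factor \<gamma> a (f w)"
    using fd by eventually_elim (simp add: rot_factor_def d')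
  ultimately have deriv: "((\<lambda>w. rot_factor \<gamma> a (f w)) has_derivative M) (at z)"
    by (rule has_derivative_nhds_cong)
  \<comment> \<open>At the zero, the flow direction seen by the lift \<open>g\<close> and the
    rotated orbit vector differ only by the rotation \<open>c\<close> and the length.\<close>
  have rv: "wedge (rot_vec \<gamma> a) (c * x) = len \<gamma> * wedge (cis (snd (?g z))) x" for x
  proof -
    have "cis (snd (f z)) = a * cis (angle \<gamma>)" by (rule rot_factor_zero_cis[OF a zero])
    then have "rot_vec \<gamma> a = c * (of_real (len \<gamma>) * cis (snd (?g z)))"
      using cb(2) by (simp add: fz rot_vec_def cis_mult[symmetric] mult_ac)
    then show ?thesis by (simp only: wedge_rotate[OF c1] wedge_simps(9))
  qed
  have unit: "cnj (exp (\<i> * pi * of_int n)) * exp (\<i> * pi * of_int n) = 1"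
    using complex_norm_square[of "exp (\<i> * pi * of_int n)"] by (simp add: mult.commute)
  have M: "Im (cnj (e * (\<i> * pi * of_real y1 - 2 * of_real t1)) * (e * (\<i> * pi * of_real y2 - 2 * of_real t2)))
      = 2 * pi * (y1 * t2 - t1 * y2)" if "cnj e * e = 1" for e and y1 t1 y2 t2 :: real
  proof -
    have eq: "cnj (e * (\<i> * pi * of_real y1 - 2 * of_real t1)) * (e * (\<i> * pi * of_real y2 - 2 * of_real t2))
      = (cnj e * e) * (cnj (\<i> * pi * of_real y1 - 2 * of_real t1) * (\<i> * pi * of_real y2 - 2 * of_real t2))"
      by (simp add: mult_ac)
    show ?thesis unfolding eq that by (simp add: algebra_simps)
  qed
  have "Im (cnj (M 1) * M \<i>) = len \<gamma> / covolume * crossing_det (?g z) D"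
    unfolding M_def fst_conv snd_conv M[OF unit] rv crossing_det_wedge
    using basis(3) by (simp add: field_simps)
  then show thesis by (intro that[OF deriv]) (simp only: triangle_point_coords)
qed

text \<open>\<open>crossing_sign\<close> asks for some lift with positive determinant. All lifts at
  the point compute the derivative of one and the same function, and uniqueness of the derivative
  makes their determinants equal.\<close>

lemma transverse_simple_zero:
  assumes \<gamma>: "periodic_orbit \<Gamma> \<gamma>" and a: "a \<in> rotations"
    and f: "triangle_lift \<sigma> f" and tr: "transverse_at \<Gamma> \<sigma> (triangle_point z)"
    and zero: "rot_factor \<gamma> a (f z) = 0"
  shows "z \<in> interior triangle"
    and "simple_zero (crossing_sign \<Gamma> \<sigma> (triangle_point z) = 1) (\<lambda>w. rot_factor \<gamma> a (f w)) z"
proof -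
  let ?u = "(triangle_point z 1, triangle_point z 2)"
  show z: "z \<in> interior triangle" using tr by (simp add: transverse_at_def simplex_interior_triangle)
  obtain g D where g: "lift_at \<Gamma> \<sigma> (triangle_point z) g D" and det: "crossing_det (g ?u) D \<noteq> 0"
    using tr by (auto simp: transverse_at_def)
  obtain M where M: "((\<lambda>w. rot_factor \<gamma> a (f w)) has_derivative M) (at z)"
    "Im (cnj (M 1) * M \<i>) = len \<gamma> / covolume * crossing_det (g ?u) D"
    by (rule rot_factor_derivative[OF \<gamma> a f z zero g])
  have k: "len \<gamma> / covolume > 0" using orbit_rep(1)[OF \<gamma>] basis(3) by simp
  have "crossing_sign \<Gamma> \<sigma> (triangle_point z) = 1 \<longleftrightarrow> 0 < crossing_det (g ?u) D"
  proof -
    have "0 < crossing_det (g ?u) D"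
      if g': "lift_at \<Gamma> \<sigma> (triangle_point z) g' D'" "0 < crossing_det (g' ?u) D'" for g' D'
    proof -
      obtain M' where M': "((\<lambda>w. rot_factor \<gamma> a (f w)) has_derivative M') (at z)"
        "Im (cnj (M' 1) * M' \<i>) = len \<gamma> / covolume * crossing_det (g' ?u) D'"
        by (rule rot_factor_derivative[OF \<gamma> a f z zero g'(1)])
      have "M = M'" using M(1) M'(1) by (rule has_derivative_unique)
      then have "len \<gamma> / covolume * crossing_det (g ?u) D = len \<gamma> / covolume * crossing_det (g' ?u) D'"
        using M(2) M'(2) by simp
      then have "crossing_det (g ?u) D = crossing_det (g' ?u) D'"
        using k by (metis less_irrefl mult_left_cancel)
      then show ?thesis using g'(2) by simp
    qed
    then show ?thesis unfolding crossing_sign_def using g by auto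
  qed
  moreover have "0 < Im (cnj (M 1) * M \<i>) \<longleftrightarrow> 0 < crossing_det (g ?u) D"
    unfolding M(2) using k zero_less_mult_pos by (metis mult_pos_pos)
  moreover have "Im (cnj (M 1) * M \<i>) \<noteq> 0" unfolding M(2) using k det by (metis less_irrefl mult_eq_0_iff)
  ultimately show "simple_zero (crossing_sign \<Gamma> \<sigma> (triangle_point z) = 1) (\<lambda>w. rot_factor \<gamma> a (f w)) z"
    using simple_zero_derivative[OF M(1) zero] by simp
qed

text \<open>Transversality makes all zeros simple and interior. Simple zeros are isolated, so the
  closed zero set is finite in the compact triangle, and the argument principle applies.\<close>

lemma edge_sum_rot_factor:
  assumes \<gamma>: "periodic_orbit \<Gamma> \<gamma>" and a: "a \<in> rotations" and f: "triangle_lift \<sigma> f"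
    and tr: "\<And>s. s \<in> standard_simplex 2 \<Longrightarrow> \<sigma> s \<in> \<gamma> \<Longrightarrow> transverse_at \<Gamma> \<sigma> s"
  defines "Z \<equiv> {w \<in> triangle. rot_factor \<gamma> a (f w) = 0}"
  shows "finite Z"
    and "edge_sum (\<lambda>e. winding_number (\<lambda>t. rot_factor \<gamma> a (f (e t))) 0)
      = (\<Sum>w\<in>Z. of_rat (crossing_sign \<Gamma> \<sigma> (triangle_point w)))"
proof -
  let ?G = "\<lambda>w. rot_factor \<gamma> a (f w)"
  have contG: "continuous_on triangle ?G"
    using f by (intro continuous_on_rot_factor) (simp add: triangle_lift_def)
  have sz: "z \<in> interior triangle" "simple_zero (crossing_sign \<Gamma> \<sigma> (triangle_point z) = 1) ?G z"
    if z: "z \<in> Z" for z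
  proof -
    have zt: "z \<in> triangle" "?G z = 0" using z by (simp_all add: Z_def)
    have "\<sigma> (triangle_point z) \<in> \<gamma>"
      using rot_factor_zero_imp[OF \<gamma> a zt(2)] f zt(1) by (simp add: triangle_lift_def)
    then have tr': "transverse_at \<Gamma> \<sigma> (triangle_point z)"
      using tr zt(1) by (simp add: triangle_point_mem)
    show "z \<in> interior triangle" "simple_zero (crossing_sign \<Gamma> \<sigma> (triangle_point z) = 1) ?G z"
      by (rule transverse_simple_zero[OF \<gamma> a f tr' zt(2)])+
  qed
  have "closed Z"
    unfolding Z_def using contG compact_imp_closed[OF compact_triangle]
    by (rule continuous_closed_preimage_constant)
  then have "compact (triangle \<inter> Z)" by (rule compact_Int_closed[OF compact_triangle])
  moreover have "triangle \<inter> Z = Z" by (auto simp: Z_def)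
  ultimately have "compact Z" by simp
  have "finite (Z \<inter> Z)"
  proof (rule finite_not_islimpt_in_compact[OF \<open>compact Z\<close>])
    fix z assume "z \<in> Z"
    then have ev: "\<forall>\<^sub>F w in at z. ?G w \<noteq> 0" using simple_zero_isolated sz(2) by blast
    show "\<not> z islimpt Z"
      unfolding islimpt_iff_eventually
      using ev by (auto simp: Z_def elim: eventually_mono)
  qed
  then show "finite Z" by simp
  then have "edge_sum (\<lambda>e. winding_number (?G \<circ> e) 0)
      = (\<Sum>z\<in>Z. if crossing_sign \<Gamma> \<sigma> (triangle_point z) = 1 then 1 else -1)"
    using sz contG by (intro edge_sum_winding_number) (auto simp: Z_def)
  also have "\<dots> = (\<Sum>z\<in>Z. of_rat (crossing_sign \<Gamma> \<sigma> (triangle_point z)))"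
    by (intro sum.cong refl) (simp add: crossing_sign_def of_rat_minus)
  finally show "edge_sum (\<lambda>e. winding_number (\<lambda>t. ?G (e t)) 0)
      = (\<Sum>w\<in>Z. of_rat (crossing_sign \<Gamma> \<sigma> (triangle_point w)))" by (simp add: o_def)
qed

text \<open>The zero sets for different rotations are disjoint, and their union is the preimage of
  \<open>\<gamma>\<close>. So the sum over rotations counts every crossing with
  \<open>\<gamma>\<close> once.\<close>

lemma edge_sum_orbit:
  assumes \<gamma>: "periodic_orbit \<Gamma> \<gamma>" and f: "triangle_lift \<sigma> f"
    and tr: "\<And>s. s \<in> standard_simplex 2 \<Longrightarrow> \<sigma> s \<in> \<gamma> \<Longrightarrow> transverse_at \<Gamma> \<sigma> s"
  shows "edge_sum (\<lambda>e. \<Sum>a\<in>rotations. winding_number (\<lambda>t. rot_factor \<gamma> a (f (e t))) 0)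
    = (\<Sum>s | s \<in> standard_simplex 2 \<and> \<sigma> s \<in> \<gamma>. of_rat (crossing_sign \<Gamma> \<sigma> s))"
proof -
  define Z where "Z a = {w \<in> triangle. rot_factor \<gamma> a (f w) = 0}" for a
  have fw: "cover (f w) = \<sigma> (triangle_point w)" if "w \<in> triangle" for w
    using f that by (simp add: triangle_lift_def)
  have "edge_sum (\<lambda>e. \<Sum>a\<in>rotations. winding_number (\<lambda>t. rot_factor \<gamma> a (f (e t))) 0)
    = (\<Sum>a\<in>rotations. \<Sum>w\<in>Z a. of_rat (crossing_sign \<Gamma> \<sigma> (triangle_point w)))"
    unfolding edge_sum_sum Z_def by (intro sum.cong refl edge_sum_rot_factor(2)[OF \<gamma> _ f tr])
  also have "\<dots> = (\<Sum>w\<in>(\<Union>a\<in>rotations. Z a). of_rat (crossing_sign \<Gamma> \<sigma> (triangle_point w)))"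
  proof (rule sum.UNION_disjoint[symmetric])
    show "\<forall>a\<in>rotations. finite (Z a)"
      unfolding Z_def using edge_sum_rot_factor(1)[OF \<gamma> _ f tr] by blast
    show "\<forall>a\<in>rotations. \<forall>a'\<in>rotations. a \<noteq> a' \<longrightarrow> Z a \<inter> Z a' = {}"
    proof (intro ballI impI equals0I)
      fix a a' w assume "a \<in> rotations" "a' \<in> rotations" "a \<noteq> a'" "w \<in> Z a \<inter> Z a'"
      then show False using rot_factor_zero_unique[of a \<gamma> "f w" a'] by (simp add: Z_def)
    qed
  qed (rule finite_rotations)
  also have "(\<Union>a\<in>rotations. Z a) = {w \<in> triangle. \<sigma> (triangle_point w) \<in> \<gamma>}"
  proof
    show "(\<Union>a\<in>rotations. Z a) \<subseteq> {w \<in> triangle. \<sigma> (triangle_point w) \<in> \<gamma>}"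
    proof
      fix w assume "w \<in> (\<Union>a\<in>rotations. Z a)"
      then obtain a where a: "a \<in> rotations" "w \<in> triangle" "rot_factor \<gamma> a (f w) = 0"
        by (auto simp: Z_def)
      then show "w \<in> {w \<in> triangle. \<sigma> (triangle_point w) \<in> \<gamma>}"
        using rot_factor_zero_imp[OF \<gamma> a(1,3)] fw by simp
    qed
    show "{w \<in> triangle. \<sigma> (triangle_point w) \<in> \<gamma>} \<subseteq> (\<Union>a\<in>rotations. Z a)"
    proof
      fix w assume w: "w \<in> {w \<in> triangle. \<sigma> (triangle_point w) \<in> \<gamma>}"
      then have "cover (f w) \<in> \<gamma>" using fw by simp
      from rot_factor_zero_ex[OF \<gamma> this] w show "w \<in> (\<Union>a\<in>rotations. Z a)" by (auto simp: Z_def)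
    qed
  qed
  also have "(\<Sum>w\<in>{w \<in> triangle. \<sigma> (triangle_point w) \<in> \<gamma>}. of_rat (crossing_sign \<Gamma> \<sigma> (triangle_point w)))
      = (\<Sum>s | s \<in> standard_simplex 2 \<and> \<sigma> s \<in> \<gamma>. of_rat (crossing_sign \<Gamma> \<sigma> s) :: complex)"
  proof (rule sum.reindex_bij_betw[where h = triangle_point])
    have "inj_on triangle_point triangle" "triangle_point ` triangle = standard_simplex 2"
      using bij_betw_triangle_point by (simp_all add: bij_betw_def)
    then show "bij_betw triangle_point {w \<in> triangle. \<sigma> (triangle_point w) \<in> \<gamma>} {s \<in> standard_simplex 2. \<sigma> s \<in> \<gamma>}"
      by (auto simp: bij_betw_def inj_on_def)
  qed
  finally show ?thesis .
qed

text \<open>The right-hand side does not involve \<open>c\<close>. This yields the uniqueness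
  demanded by the definite description in \<open>linking_number\<close>.\<close>

theorem intersection_number_winding:
  assumes K: "periodic_collection \<Gamma> K" and K': "periodic_collection \<Gamma> K'"
    and zero: "total_vec K' = 0" and disj: "support K \<inter> support K' = {}"
    and c: "bounds \<Gamma> c K" and tr: "transverse \<Gamma> c K'"
  shows "of_rat (intersection_number \<Gamma> c K') = (\<Sum>\<gamma>\<in>#K. winding K' (orbit_path \<gamma>))"
proof -
  have c': "rat_chain_boundary 2 c = fundamental_cycle K"
    and sing: "\<And>\<sigma>. \<sigma> \<in> Poly_Mapping.keys c \<Longrightarrow> singular_simplex 2 (unit_tangent_bundle \<Gamma>) \<sigma>"
    using c by (auto simp: bounds_def rat_singular_chain_def)
  have po: "periodic_orbit \<Gamma> \<gamma>" if "\<gamma> \<in># K" for \<gamma> using K that by (simp add: periodic_collection_def)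
  have po': "periodic_orbit \<Gamma> \<gamma>" if "\<gamma> \<in># K'" for \<gamma> using K' that by (simp add: periodic_collection_def)
  define f where "f \<sigma> = (SOME f. triangle_lift \<sigma> f)" for \<sigma>
  have f: "triangle_lift \<sigma> (f \<sigma>)" if "\<sigma> \<in> Poly_Mapping.keys c" for \<sigma>
    unfolding f_def using triangle_lift_ex[OF sing[OF that]] by (metis someI)
  \<comment> \<open>\<open>transverse_at\<close> includes that the point is interior to the simplex,
    so no edge meets \<open>K'\<close>.\<close>
  have edges: "cover (f \<sigma> (e t)) \<notin> support K'"
    if \<sigma>: "\<sigma> \<in> Poly_Mapping.keys c" and e: "e \<in> triangle_edges" "t \<in> {0..1}" for \<sigma> e t
  proof
    have et: "e t \<in> triangle" "e t \<notin> interior triangle" using triangle_edge_mem[OF e] by auto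
    assume "cover (f \<sigma> (e t)) \<in> support K'"
    then have "\<sigma> (triangle_point (e t)) \<in> support K'" using f[OF \<sigma>] et(1) by (simp add: triangle_lift_def)
    then have "transverse_at \<Gamma> \<sigma> (triangle_point (e t))"
      using tr \<sigma> et(1) by (simp add: transverse_def triangle_point_mem)
    then show False using et(2) by (simp add: transverse_at_def simplex_interior_triangle)
  qed
  have "(\<Sum>\<sigma>\<in>Poly_Mapping.keys c. of_rat (Poly_Mapping.lookup c \<sigma>) * edge_sum (\<lambda>e. winding K' (f \<sigma> \<circ> e)))
      = (\<Sum>\<gamma>\<in>#K. winding K' (orbit_path \<gamma>))"
  proof (rule cocycle_sum[OF c', where B = "support K'"])
    show "winding K' (d \<circ> p) = winding K' p"
      if "continuous_on {0..1} p" "\<And>t. t \<in> {0..1} \<Longrightarrow> cover (p t) \<notin> support K'" "d \<in> decks" for p d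
      using that by (rule winding_deck[OF K' zero])
    show "winding K' p = winding K' q" if "\<And>t. t \<in> {0..1} \<Longrightarrow> p t = q t" for p q
      unfolding winding_def
      using that by (intro arg_cong[of _ _ sum_mset] image_mset_cong sum.cong refl winding_number_cong) simp
    show "cover (orbit_path \<gamma> t) \<notin> support K'" if "\<gamma> \<in># K" for \<gamma> t
      using orbit_path_mem[OF po[OF that]] disj that by (auto simp: support_def)
  qed (use f edges edge_lift_orbit_path po in auto)
  moreover have "edge_sum (\<lambda>e. winding K' (f \<sigma> \<circ> e)) = (\<Sum>\<gamma>\<in>#K'. \<Sum>s | s \<in> standard_simplex 2 \<and> \<sigma> s \<in> \<gamma>.
      of_rat (crossing_sign \<Gamma> \<sigma> s))" if \<sigma>: "\<sigma> \<in> Poly_Mapping.keys c" for \<sigma>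
  proof -
    have "edge_sum (\<lambda>e. \<Sum>\<gamma>\<in>#M. h \<gamma> e) = (\<Sum>\<gamma>\<in>#M. edge_sum (h \<gamma>))" for M and h :: "_ \<Rightarrow> _ \<Rightarrow> complex"
      by (induction M) (simp_all add: edge_sum_add, simp add: edge_sum_def)
    then have "edge_sum (\<lambda>e. winding K' (f \<sigma> \<circ> e)) = (\<Sum>\<gamma>\<in>#K'. edge_sum (\<lambda>e. \<Sum>a\<in>rotations.
        winding_number (\<lambda>t. rot_factor \<gamma> a (f \<sigma> (e t))) 0))"
      by (simp add: winding_def)
    also have "\<dots> = (\<Sum>\<gamma>\<in>#K'. \<Sum>s | s \<in> standard_simplex 2 \<and> \<sigma> s \<in> \<gamma>. of_rat (crossing_sign \<Gamma> \<sigma> s))"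
    proof (intro arg_cong[of _ _ sum_mset] image_mset_cong)
      fix \<gamma> assume \<gamma>: "\<gamma> \<in># K'"
      have "transverse_at \<Gamma> \<sigma> s" if "s \<in> standard_simplex 2" "\<sigma> s \<in> \<gamma>" for s
        using tr \<sigma> that \<gamma> unfolding transverse_def support_def by blast
      then show "edge_sum (\<lambda>e. \<Sum>a\<in>rotations. winding_number (\<lambda>t. rot_factor \<gamma> a (f \<sigma> (e t))) 0)
          = (\<Sum>s | s \<in> standard_simplex 2 \<and> \<sigma> s \<in> \<gamma>. of_rat (crossing_sign \<Gamma> \<sigma> s))"
        by (rule edge_sum_orbit[OF po'[OF \<gamma>] f[OF \<sigma>]])
    qed
    finally show ?thesis .
  qed
  moreover have "of_rat (intersection_number \<Gamma> c K') = (\<Sum>\<sigma>\<in>Poly_Mapping.keys c.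
      of_rat (Poly_Mapping.lookup c \<sigma>) * (\<Sum>\<gamma>\<in>#K'. \<Sum>s | s \<in> standard_simplex 2 \<and> \<sigma> s \<in> \<gamma>.
      of_rat (crossing_sign \<Gamma> \<sigma> s)) :: complex)"
    unfolding intersection_number_def
    by (simp add: of_rat_sum of_rat_sum_mset of_rat_mult sum_distrib_left[symmetric] sum_mset_distrib_left)
  ultimately show ?thesis by simp
qed

section \<open>The contribution of a pair of orbits\<close>

definition sawtooth :: "real \<Rightarrow> real" where
  "sawtooth t = (t - of_int (round t)) - sgn (t - of_int (round t)) / 2"

definition pair_linking :: "(complex \<times> complex) set set \<Rightarrow> (complex \<times> complex) set set \<Rightarrow> complex \<Rightarrow> real" where
  "pair_linking \<gamma> \<gamma>' a = (let t = rot_t \<gamma>' a (angle \<gamma>) in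
     len \<gamma>' * len \<gamma> / covolume * sin (2 * pi * t) * sawtooth t)"

text \<open>The angle is constant along an orbit, so \<open>t\<close> is fixed and \<open>y\<close>
  grows by the integer \<open>n\<close>, the area of the two period vectors in units of
  \<open>covolume\<close>. The sine of the enclosed angle enters through this area. Disjointness
  keeps the path away from the zeros.\<close>

lemma winding_orbit_path:
  assumes \<gamma>: "periodic_orbit \<Gamma> \<gamma>" and \<gamma>': "periodic_orbit \<Gamma> \<gamma>'" and a: "a \<in> rotations" and disj: "\<gamma> \<inter> \<gamma>' = {}"
  shows "winding_number (\<lambda>s. rot_factor \<gamma>' a (orbit_path \<gamma> s)) 0 = of_real (pair_linking \<gamma> \<gamma>' a)"
proof -
  let ?u = "of_real (len \<gamma>) * cis (angle \<gamma>)"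
  define t where "t = rot_t \<gamma>' a (angle \<gamma>)"
  define y where "y = rot_y \<gamma>' a (base \<gamma>)"
  obtain n :: int where n: "wedge (rot_vec \<gamma>' a) ?u / covolume = of_int n"
    using wedge_rot_vec_int[OF \<gamma>' a orbit_rep(2)[OF \<gamma>]] by (elim Ints_cases)
  have "wedge (rot_vec \<gamma>' a) ?u = len \<gamma>' * len \<gamma> * sin (angle \<gamma> - rot_angle \<gamma>' a)"
    by (simp add: rot_vec_cis[OF a] wedge_simps wedge_cis)
  also have "angle \<gamma> - rot_angle \<gamma>' a = 2 * pi * t" by (simp add: t_def rot_t_def)
  finally have n': "of_int n = len \<gamma>' * len \<gamma> / covolume * sin (2 * pi * t)"
    unfolding n[symmetric] by simp
  have eq: "rot_factor \<gamma>' a (orbit_path \<gamma> s) = quasi_theta (y + s * of_int n) t" for s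
    by (simp add: rot_factor_def orbit_path_def y_def t_def[symmetric] rot_y_def n[symmetric]
        wedge_simps diff_divide_distrib add_divide_distrib algebra_simps)
  have "rot_factor \<gamma>' a (orbit_path \<gamma> 0) \<noteq> 0"
    using rot_factor_zero_imp[OF \<gamma>' a] orbit_path_mem[OF \<gamma>, of 0] disj by blast
  then have nz: "\<not> (y \<in> \<int> \<and> t \<in> \<int>)" by (simp add: eq quasi_theta_eq_0)
  have "n = 0" if "t - of_int (round t) = 0"
    using n' sin_sawtooth(3)[of 1 t] that by simp
  from winding_number_quasi_theta[OF this nz] show ?thesis
    unfolding eq by (simp add: n' pair_linking_def t_def[symmetric] sawtooth_def Let_def)
qed

lemma pair_linking_nonpos: "periodic_orbit \<Gamma> \<gamma> \<Longrightarrow> periodic_orbit \<Gamma> \<gamma>' \<Longrightarrow> pair_linking \<gamma> \<gamma>' a \<le> 0"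
  unfolding pair_linking_def Let_def sawtooth_def
  using orbit_rep(1)[of \<gamma>] orbit_rep(1)[of \<gamma>'] basis(3) by (intro sin_sawtooth(1)) simp

lemma pair_linking_neg:
  assumes "periodic_orbit \<Gamma> \<gamma>" "periodic_orbit \<Gamma> \<gamma>'" "a \<in> rotations"
    and "wedge (a * cis (angle \<gamma>')) (cis (angle \<gamma>)) \<noteq> 0"
  shows "pair_linking \<gamma> \<gamma>' a < 0"
  unfolding pair_linking_def Let_def sawtooth_def
  using orbit_rep(1)[OF assms(1)] orbit_rep(1)[OF assms(2)] basis(3) assms(4)
  by (intro sin_sawtooth(2)) (simp_all add: cis_rot_angle[OF assms(3), symmetric] wedge_cis rot_t_def)

end

section \<open>Existence of transverse chains\<close>

context flat_orbifold
begin

definition affine_edge :: "complex \<times> real \<Rightarrow> complex \<times> real \<Rightarrow> (nat \<Rightarrow> real) \<Rightarrow> (complex \<times> complex) set" where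
  "affine_edge x y = restrict (\<lambda>s. cover (x + s 1 *\<^sub>R (y - x))) (standard_simplex 1)"

definition affine_triangle ::
    "complex \<times> real \<Rightarrow> complex \<times> real \<Rightarrow> complex \<times> real \<Rightarrow> (nat \<Rightarrow> real) \<Rightarrow> (complex \<times> complex) set" where
  "affine_triangle x y z =
     restrict (\<lambda>s. cover (x + s 1 *\<^sub>R (y - x) + s 2 *\<^sub>R (z - x))) (standard_simplex 2)"

lemma affine_edge_deck:
  assumes "d \<in> decks" shows "affine_edge (d x) (d y) = affine_edge x y"
proof -
  obtain a b \<beta> where d: "d = (\<lambda>x. (a * fst x + b, snd x + \<beta>))" using assms by (auto simp: decks_def)
  have "d x + r *\<^sub>R (d y - d x) = d (x + r *\<^sub>R (y - x))" for r
    by (simp add: d prod_eq_iff scaleR_conv_of_real algebra_simps)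
  then show ?thesis unfolding affine_edge_def by (simp only: cover_deck[OF assms])
qed

lemma affine_edge_translate:
  assumes "u \<in> translation_vectors"
  shows "affine_edge (x + (u, 0)) (y + (u, 0)) = affine_edge x y"
proof -
  have "(1, u) \<in> affine_group" using assms by (simp add: translation_vectors_def)
  then have "(\<lambda>x. (1 * fst x + u, snd x + 0)) \<in> decks" unfolding decks_def using cis_zero by blast
  from affine_edge_deck[OF this, of x y] show ?thesis by (simp add: plus_prod_def)
qed

text \<open>All rotated copies of the period segment project to the same 1-simplex. An average over
  the rotations therefore still has the orbit loop with coefficient 1 in its boundary.\<close>

lemma affine_edge_orbit:
  assumes \<gamma>: "periodic_orbit \<Gamma> \<gamma>" and a: "a \<in> rotations"
  shows "affine_edge (rot_base \<gamma> a, rot_angle \<gamma> a) ((rot_base \<gamma> a, rot_angle \<gamma> a) + (rot_vec \<gamma> a, 0))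
    = orbit_loop (SOME X. X \<in> \<gamma>)"
proof -
  let ?d = "\<lambda>x. (a * fst x + shift a, snd x + Arg a)"
  have d: "?d \<in> decks"
    unfolding decks_def using shift[OF a] cis_Arg_unit[OF rotations_norm[OF a]] by blast
  have "affine_edge (?d (base \<gamma>, angle \<gamma>)) (?d (base \<gamma> + of_real (len \<gamma>) * cis (angle \<gamma>), angle \<gamma>))
      = affine_edge (base \<gamma>, angle \<gamma>) (base \<gamma> + of_real (len \<gamma>) * cis (angle \<gamma>), angle \<gamma>)"
    by (rule affine_edge_deck[OF d])
  also have "\<dots> = orbit_loop (SOME X. X \<in> \<gamma>)"
    unfolding orbit_rep(5)[OF \<gamma>] affine_edge_def by (simp add: scaleR_conv_of_real)
  finally show ?thesis
    by (simp add: rot_base_def rot_angle_def rot_vec_def algebra_simps)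
qed

lemma affine_triangle_faces:
  "singular_face 2 0 (affine_triangle x y z) = affine_edge y z"
  "singular_face 2 1 (affine_triangle x y z) = affine_edge x z"
  "singular_face 2 2 (affine_triangle x y z) = affine_edge x y"
proof -
  have f: "singular_face 2 k (affine_triangle x y z) =
      restrict (\<lambda>s. cover (x + simplical_face k s 1 *\<^sub>R (y - x) + simplical_face k s 2 *\<^sub>R (z - x))) (standard_simplex 1)"
    if "k \<le> 2" for k
    unfolding singular_face_def affine_triangle_def
    using simplical_face_in_standard_simplex[of 2 k] that by (auto simp: fun_eq_iff)
  have s0: "s 0 = 1 - s 1" if "s \<in> standard_simplex 1" for s :: "nat \<Rightarrow> real"
    using that by (simp add: standard_simplex_def)
  show "singular_face 2 0 (affine_triangle x y z) = affine_edge y z"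
    unfolding f[OF le0] affine_edge_def
    by (intro restrict_ext arg_cong[of _ _ cover])
       (simp add: simplical_face_def s0 algebra_simps One_nat_def[symmetric] del: One_nat_def)
  show "singular_face 2 1 (affine_triangle x y z) = affine_edge x z"
    using f[of 1] unfolding affine_edge_def by (simp add: simplical_face_def)
  show "singular_face 2 2 (affine_triangle x y z) = affine_edge x y"
    using f[of 2] unfolding affine_edge_def by (simp add: simplical_face_def)
qed

lemma singular_simplex_affine_triangle:
  "singular_simplex 2 (unit_tangent_bundle \<Gamma>) (affine_triangle x y z)"
proof -
  have "continuous_on UNIV (\<lambda>s :: nat \<Rightarrow> real. x + s 1 *\<^sub>R (y - x) + s 2 *\<^sub>R (z - x))"
    by (intro continuous_intros continuous_on_product_coordinates)
  then have "continuous_map (powertop_real UNIV) euclidean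
      (\<lambda>s :: nat \<Rightarrow> real. x + s 1 *\<^sub>R (y - x) + s 2 *\<^sub>R (z - x))"
    by (simp add: euclidean_product_topology)
  then have "continuous_map (subtopology (powertop_real UNIV) (standard_simplex 2)) euclidean
      (\<lambda>s. x + s 1 *\<^sub>R (y - x) + s 2 *\<^sub>R (z - x))"
    by (rule continuous_map_from_subtopology)
  from continuous_map_compose[OF this continuous_map_cover]
  have "continuous_map (subtopology (powertop_real UNIV) (standard_simplex 2)) (unit_tangent_bundle \<Gamma>) (affine_triangle x y z)"
    by (rule continuous_map_eq) (simp add: affine_triangle_def topspace_standard_simplex)
  then show ?thesis by (simp add: singular_simplex_def affine_triangle_def)
qed

definition triangle_chain :: "rat \<Rightarrow> complex \<times> real \<Rightarrow> complex \<times> real \<Rightarrow> complex \<times> real \<Rightarrow>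
    (complex \<times> complex) set rat_chain" where
  "triangle_chain q x y z = Poly_Mapping.single (affine_triangle x y z) q"

definition edge_chain :: "rat \<Rightarrow> complex \<times> real \<Rightarrow> complex \<times> real \<Rightarrow> (complex \<times> complex) set rat_chain" where
  "edge_chain q x y = Poly_Mapping.single (affine_edge x y) q"

lemma keys_triangle_chain: "\<sigma> \<in> Poly_Mapping.keys (triangle_chain q x y z) \<Longrightarrow> \<sigma> = affine_triangle x y z"
  by (simp add: triangle_chain_def split: if_splits)

lemma boundary_add: "rat_chain_boundary 2 (c + d) = rat_chain_boundary 2 c + rat_chain_boundary 2 d"
  by (simp add: rat_chain_boundary_pm_sum chain_boundary.pm_sum_add)

lemma boundary_triangle_chain:
  "rat_chain_boundary 2 (triangle_chain q x y z) = edge_chain q y z - edge_chain q x z + edge_chain q x y"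
proof -
  have two: "{..2::nat} = {0, 1, 2}" "(2::nat) \<noteq> 0" by auto
  show ?thesis
    unfolding rat_chain_boundary_pm_sum[OF two(2)] triangle_chain_def chain_boundary.pm_sum_single
    unfolding two(1)
    by (simp add: edge_chain_def affine_triangle_faces single_uminus del: One_nat_def)
qed

definition parallelogram :: "rat \<Rightarrow> complex \<times> real \<Rightarrow> complex \<times> real \<Rightarrow> complex \<times> real \<Rightarrow>
    (complex \<times> complex) set rat_chain" where
  "parallelogram q x u o' = triangle_chain q x (x + u) (o' + u) + triangle_chain (- q) x o' (o' + u)"

lemma edge_chain_uminus: "edge_chain (- q) x y = - edge_chain q x y"
  by (simp add: edge_chain_def single_uminus)

text \<open>The two slanted sides differ by the translation \<open>u\<close> and project to the same
  simplex, and the diagonal occurs twice with opposite coefficients. Only the segments at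
  \<open>x\<close> and at \<open>o'\<close> are left.\<close>

lemma boundary_parallelogram:
  assumes "u \<in> translation_vectors"
  shows "rat_chain_boundary 2 (parallelogram q x (u, 0) o') =
    edge_chain q x (x + (u, 0)) - edge_chain q o' (o' + (u, 0))"
proof -
  have "edge_chain q (x + (u, 0)) (o' + (u, 0)) = edge_chain q x o'"
    by (simp add: edge_chain_def affine_edge_translate[OF assms])
  then show ?thesis
    by (simp add: parallelogram_def boundary_add boundary_triangle_chain edge_chain_uminus)
qed

text \<open>Each new triangle replaces two period segments by the one of their sum, as when loops on
  a torus are added. All triangles remain at the height of \<open>o'\<close>, so that a generic
  height keeps them away from the other collection.\<close>

lemma cap_ex:
  fixes o' :: "complex \<times> real"
  assumes "\<And>u. u \<in># M \<Longrightarrow> u \<in> translation_vectors"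
  shows "\<exists>C. (\<forall>\<sigma>\<in>Poly_Mapping.keys C. \<exists>x y z. \<sigma> = affine_triangle x y z \<and>
        snd x = snd o' \<and> snd y = snd o' \<and> snd z = snd o') \<and>
      rat_chain_boundary 2 C = (\<Sum>u\<in>#M. edge_chain q o' (o' + (u, 0))) - edge_chain q o' (o' + (\<Sum>\<^sub># M, 0))"
  using assms
proof (induction M)
  case empty
  \<comment> \<open>The boundary of a constant triangle is one constant edge, which accounts for the
    empty sum of vectors.\<close>
  have "(o' + (0, 0)) = o'" by (simp add: prod_eq_iff)
  then have "rat_chain_boundary 2 (triangle_chain (- q) o' o' o') = - edge_chain q o' (o' + (0, 0))"
    by (simp add: boundary_triangle_chain edge_chain_uminus)
  moreover have "\<forall>\<sigma>\<in>Poly_Mapping.keys (triangle_chain (- q) o' o' o'). \<exists>x y z. \<sigma> = affine_triangle x y z \<and>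
        snd x = snd o' \<and> snd y = snd o' \<and> snd z = snd o'"
    using keys_triangle_chain by blast
  ultimately show ?case by (intro exI[of _ "triangle_chain (- q) o' o' o'"]) simp
next
  case (add u M)
  let ?P = "\<lambda>\<sigma>. \<exists>x y z. \<sigma> = affine_triangle x y z \<and> snd x = snd o' \<and> snd y = snd o' \<and> snd z = snd o'"
  obtain C where C: "\<forall>\<sigma>\<in>Poly_Mapping.keys C. ?P \<sigma>"
    "rat_chain_boundary 2 C = (\<Sum>u\<in>#M. edge_chain q o' (o' + (u, 0))) - edge_chain q o' (o' + (\<Sum>\<^sub># M, 0))"
    using add.IH add.prems by auto
  let ?T = "triangle_chain q o' (o' + (u, 0)) (o' + (\<Sum>\<^sub># M, 0) + (u, 0))"
  have e1: "edge_chain q (o' + (u, 0)) (o' + (\<Sum>\<^sub># M, 0) + (u, 0)) = edge_chain q o' (o' + (\<Sum>\<^sub># M, 0))"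
    using affine_edge_translate[of u] add.prems by (simp add: edge_chain_def)
  have e2: "o' + (\<Sum>\<^sub># M, 0) + (u, 0) = o' + (u + \<Sum>\<^sub># M, 0)" by (simp add: prod_eq_iff)
  have "rat_chain_boundary 2 (C + ?T)
      = (\<Sum>u\<in>#add_mset u M. edge_chain q o' (o' + (u, 0))) - edge_chain q o' (o' + (\<Sum>\<^sub># (add_mset u M), 0))"
    unfolding boundary_add boundary_triangle_chain C(2) e1 unfolding e2 by simp
  moreover have "?P \<sigma>" if "\<sigma> \<in> Poly_Mapping.keys ?T" for \<sigma>
  proof -
    have "\<sigma> = affine_triangle o' (o' + (u, 0)) (o' + (\<Sum>\<^sub># M, 0) + (u, 0))"
      using that by (rule keys_triangle_chain)
    moreover have "snd (o' + (u, 0)) = snd o'" "snd (o' + (\<Sum>\<^sub># M, 0) + (u, 0)) = snd o'" by simp_all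
    ultimately show ?thesis by blast
  qed
  then have "\<forall>\<sigma>\<in>Poly_Mapping.keys (C + ?T). ?P \<sigma>"
    using C(1) Poly_Mapping.keys_add[of C ?T] by blast
  ultimately show ?case by blast
qed

lemma transverse_affine_triangle:
  assumes s: "s \<in> simplex_interior"
    and det: "crossing_det (x + s 1 *\<^sub>R (y - x) + s 2 *\<^sub>R (z - x)) (\<lambda>h. fst h *\<^sub>R (y - x) + snd h *\<^sub>R (z - x)) \<noteq> 0"
  shows "transverse_at \<Gamma> (affine_triangle x y z) s"
proof -
  let ?f = "\<lambda>u::real \<times> real. x + fst u *\<^sub>R (y - x) + snd u *\<^sub>R (z - x)"
  let ?D = "\<lambda>h::real \<times> real. fst h *\<^sub>R (y - x) + snd h *\<^sub>R (z - x)"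
  have ev: "\<forall>\<^sub>F u in nhds (s 1, s 2). 0 < fst u \<and> 0 < snd u \<and> fst u + snd u < 1"
  proof -
    have "open {u::real \<times> real. 0 < fst u \<and> 0 < snd u \<and> fst u + snd u < 1}"
      by (intro open_Collect_conj open_Collect_less continuous_intros)
    moreover have "s 0 + s 1 + s 2 = 1" "0 < s 0" "0 < s 1" "0 < s 2"
      using s by (auto simp: simplex_interior_def standard_simplex_def numeral_2_eq_2)
    then have "(s 1, s 2) \<in> {u. 0 < fst u \<and> 0 < snd u \<and> fst u + snd u < 1}" by simp
    ultimately have "\<forall>\<^sub>F u in nhds (s 1, s 2). u \<in> {u. 0 < fst u \<and> 0 < snd u \<and> fst u + snd u < 1}"
      by (rule eventually_nhds_in_open)
    then show ?thesis by simp
  qed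
  then have "\<forall>\<^sub>F u in nhds (s 1, s 2). cover (?f u) = affine_triangle x y z (simplex_point u)"
  proof eventually_elim
    case (elim u)
    have "simplex_point u = triangle_point (Complex (fst u) (snd u))" by (simp add: triangle_point_def)
    moreover have "Complex (fst u) (snd u) \<in> triangle" using elim by (simp add: mem_triangle)
    ultimately have "simplex_point u \<in> standard_simplex 2" by (simp add: triangle_point_mem)
    then show ?case by (simp add: affine_triangle_def simplex_point_def case_prod_beta)
  qed
  moreover have "(?f has_derivative ?D) (at (s 1, s 2))"
    by (auto intro!: derivative_eq_intros)
  ultimately have "lift_at \<Gamma> (affine_triangle x y z) s ?f ?D" by (simp add: lift_at_def)
  moreover have "crossing_det (?f (s 1, s 2)) ?D \<noteq> 0" using det by simp
  ultimately show ?thesis unfolding transverse_at_def using s by blast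
qed

definition admissible :: "orbit_collection \<Rightarrow> (complex \<times> complex) set rat_chain \<Rightarrow> bool" where
  "admissible K' c \<longleftrightarrow> rat_singular_chain 2 (unit_tangent_bundle \<Gamma>) c \<and> transverse \<Gamma> c K'"

lemma admissible_zero: "admissible K' 0"
  by (simp add: admissible_def rat_singular_chain_def transverse_def)

lemma admissible_add: "admissible K' c \<Longrightarrow> admissible K' d \<Longrightarrow> admissible K' (c + d)"
  using Poly_Mapping.keys_add[of c d]
  unfolding admissible_def rat_singular_chain_def transverse_def by blast

lemma admissible_sum: "(\<And>i. i \<in> I \<Longrightarrow> admissible K' (c i)) \<Longrightarrow> admissible K' (sum c I)"
  by (induction I rule: infinite_finite_induct) (simp_all add: admissible_zero admissible_add)

lemma admissible_sum_mset: "(\<And>i. i \<in># M \<Longrightarrow> admissible K' (c i)) \<Longrightarrow> admissible K' (\<Sum>i\<in>#M. c i)"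
  by (induction M) (simp_all add: admissible_zero admissible_add)

lemma admissible_triangle_chain:
  assumes "\<And>s. s \<in> standard_simplex 2 \<Longrightarrow> cover (x + s 1 *\<^sub>R (y - x) + s 2 *\<^sub>R (z - x)) \<in> support K' \<Longrightarrow>
    transverse_at \<Gamma> (affine_triangle x y z) s"
  shows "admissible K' (triangle_chain q x y z)"
  unfolding admissible_def rat_singular_chain_def transverse_def triangle_chain_def
  using singular_simplex_affine_triangle assms by (auto simp: affine_triangle_def)

text \<open>A point of the slanted parallelogram lies at height \<open>\<theta> + \<tau> (\<theta>\<^sub>0 - \<theta>)\<close> and is displaced by \<open>\<rho> u\<close>
  along the orbit. The values \<open>\<rho> = 0\<close>, \<open>\<rho> = 1\<close>, \<open>\<rho> = \<tau>\<close> are its sides and its diagonal; avoiding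
  them also excludes intersecting lines that are parallel to the orbit.\<close>

lemma admissible_parallelogram:
  fixes z\<^sub>0 :: complex and \<theta>\<^sub>0 :: real
  assumes \<gamma>: "periodic_orbit \<Gamma> \<gamma>" "\<gamma> \<inter> support K' = {}" and a: "a \<in> rotations"
    and K': "periodic_collection \<Gamma> K'"
    and lev: "\<And>z. cover (z, \<theta>\<^sub>0) \<notin> support K'" and h: "\<theta>\<^sub>0 \<noteq> rot_angle \<gamma> a"
    and gen: "\<And>\<gamma>' a' \<tau> \<rho>. \<gamma>' \<in># K' \<Longrightarrow> a' \<in> rotations \<Longrightarrow> \<tau> \<noteq> 0 \<Longrightarrow> \<rho> \<in> {0, 1, \<tau>} \<Longrightarrow>
      rot_t \<gamma>' a' (rot_angle \<gamma> a + \<tau> * (\<theta>\<^sub>0 - rot_angle \<gamma> a)) \<in> \<int> \<Longrightarrow>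
      rot_y \<gamma>' a' (rot_base \<gamma> a + of_real \<tau> * (z\<^sub>0 - rot_base \<gamma> a) + of_real \<rho> * rot_vec \<gamma> a) \<notin> \<int>"
  shows "admissible K' (parallelogram q (rot_base \<gamma> a, rot_angle \<gamma> a) (rot_vec \<gamma> a, 0) (z\<^sub>0, \<theta>\<^sub>0))"
proof -
  define p \<theta> u where "p = rot_base \<gamma> a" and "\<theta> = rot_angle \<gamma> a" and "u = rot_vec \<gamma> a"
  let ?x = "(p, \<theta>)" and ?U = "(u, 0)" and ?o = "(z\<^sub>0, \<theta>\<^sub>0)"
  define pt where "pt \<tau> \<rho> = (p + of_real \<tau> * (z\<^sub>0 - p) + of_real \<rho> * u, \<theta> + \<tau> * (\<theta>\<^sub>0 - \<theta>))" for \<tau> \<rho>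
  have key: "\<tau> \<noteq> 0 \<and> \<tau> \<noteq> 1 \<and> \<rho> \<noteq> 0 \<and> \<rho> \<noteq> 1 \<and> \<rho> \<noteq> \<tau> \<and> wedge (cis (snd (pt \<tau> \<rho>))) u \<noteq> 0"
    if pt: "cover (pt \<tau> \<rho>) \<in> support K'" for \<tau> \<rho>
  proof -
    \<comment> \<open>The side \<open>\<tau> = 0\<close> runs along the orbit
      \<open>\<gamma>\<close> itself, which is disjoint from \<open>K'\<close>.\<close>
    have tau0: "\<tau> \<noteq> 0"
    proof
      assume "\<tau> = 0"
      then have "pt \<tau> \<rho> = (a * (base \<gamma> + of_real (\<rho> * len \<gamma>) * cis (angle \<gamma>)) + shift a, rot_angle \<gamma> a)"
        by (simp add: pt_def p_def \<theta>_def u_def rot_base_def rot_vec_def algebra_simps)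
      then have "cover (pt \<tau> \<rho>) = cover (base \<gamma> + of_real (\<rho> * len \<gamma>) * cis (angle \<gamma>), angle \<gamma>)"
        using cover_rot[OF a shift[OF a]] by simp
      also have "\<dots> = cover (orbit_path \<gamma> \<rho>)" by (simp add: orbit_path_def mult_ac)
      also have "\<dots> \<in> \<gamma>" by (rule orbit_path_mem[OF \<gamma>(1)])
      finally show False using pt \<gamma>(2) by blast
    qed
    have tau1: "\<tau> \<noteq> 1" using pt lev by (auto simp: pt_def)
    obtain \<gamma>' where \<gamma>': "\<gamma>' \<in># K'" "cover (pt \<tau> \<rho>) \<in> \<gamma>'" using pt by (auto simp: support_def)
    have po': "periodic_orbit \<Gamma> \<gamma>'" using K' \<gamma>'(1) by (simp add: periodic_collection_def)
    obtain a' where a': "a' \<in> rotations" "rot_factor \<gamma>' a' (pt \<tau> \<rho>) = 0"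
      using rot_factor_zero_ex[OF po' \<gamma>'(2)] by blast
    then have yt: "rot_y \<gamma>' a' (p + of_real \<tau> * (z\<^sub>0 - p) + of_real \<rho> * u) \<in> \<int>"
        "rot_t \<gamma>' a' (\<theta> + \<tau> * (\<theta>\<^sub>0 - \<theta>)) \<in> \<int>"
      by (simp_all add: rot_factor_def quasi_theta_eq_0 pt_def)
    note gen' = gen[OF \<gamma>'(1) a'(1) tau0, folded p_def \<theta>_def u_def, OF _ yt(2)]
    have rho: "\<rho> \<noteq> 0 \<and> \<rho> \<noteq> 1 \<and> \<rho> \<noteq> \<tau>" using gen'[of \<rho>] yt(1) by blast
    \<comment> \<open>If the line that is met were parallel to \<open>u\<close>, then
      \<open>rot_y\<close> would not depend on \<open>\<rho>\<close>, and the crossing could be slid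
      to \<open>\<rho> = 0\<close>, where \<open>gen\<close> forbids it.\<close>
    have "wedge (cis (snd (pt \<tau> \<rho>))) u \<noteq> 0"
    proof
      assume w: "wedge (cis (snd (pt \<tau> \<rho>))) u = 0"
      have "cis (snd (pt \<tau> \<rho>)) = a' * cis (angle \<gamma>')" by (rule rot_factor_zero_cis[OF a'])
      then have "rot_vec \<gamma>' a' = of_real (len \<gamma>') * cis (snd (pt \<tau> \<rho>))" by (simp add: rot_vec_def mult_ac)
      then have wu: "wedge (rot_vec \<gamma>' a') u = 0" using w by (simp add: wedge_simps)
      have "rot_y \<gamma>' a' (p + of_real \<tau> * (z\<^sub>0 - p) + of_real \<rho> * u) = rot_y \<gamma>' a' (p + of_real \<tau> * (z\<^sub>0 - p) + of_real 0 * u)"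
        unfolding rot_y_def by (simp only: wedge_simps wu mult_zero_right)
      then show False using gen'[of 0] yt(1) by simp
    qed
    with tau0 tau1 rho show ?thesis by blast
  qed
  have h': "\<theta>\<^sub>0 - \<theta> \<noteq> 0" using h by (simp add: \<theta>_def)
  have "admissible K' (triangle_chain q ?x (?x + ?U) (?o + ?U))"
  proof (rule admissible_triangle_chain)
    fix s assume s: "s \<in> standard_simplex 2"
      and m: "cover (?x + s 1 *\<^sub>R (?x + ?U - ?x) + s 2 *\<^sub>R (?o + ?U - ?x)) \<in> support K'"
    have sum: "s 0 + s 1 + s 2 = 1" "0 \<le> s 0" "0 \<le> s 1" "0 \<le> s 2"
      using s by (auto simp: standard_simplex_def numeral_2_eq_2)
    \<comment> \<open>Here \<open>\<tau> = s 2\<close> and \<open>\<rho> = s 1 + s 2\<close>, so the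
      sides opposite to the vertices 0, 1 and 2 are \<open>\<rho> = 1\<close>,
      \<open>\<rho> = \<tau>\<close> and \<open>\<tau> = 0\<close>.\<close>
    have eq: "?x + s 1 *\<^sub>R (?x + ?U - ?x) + s 2 *\<^sub>R (?o + ?U - ?x) = pt (s 2) (s 1 + s 2)"
      by (simp add: pt_def scaleR_conv_of_real algebra_simps)
    have k: "s 2 \<noteq> 0 \<and> s 1 + s 2 \<noteq> 1 \<and> s 1 + s 2 \<noteq> s 2 \<and> wedge (cis (snd (pt (s 2) (s 1 + s 2)))) u \<noteq> 0"
      using key[OF m[unfolded eq]] by blast
    then have "0 < s 0 \<and> 0 < s 1 \<and> 0 < s 2" using sum by auto
    then have "\<forall>i\<le>2. 0 < s i" by (simp add: numeral_2_eq_2 le_Suc_eq)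
    then have "s \<in> simplex_interior" using s by (simp add: simplex_interior_def)
    then show "transverse_at \<Gamma> (affine_triangle ?x (?x + ?U) (?o + ?U)) s"
      by (rule transverse_affine_triangle) (use k h' in \<open>unfold eq crossing_det_wedge, simp\<close>)
  qed
  moreover have det: "crossing_det (pt \<tau> \<rho>) (\<lambda>h. fst h *\<^sub>R (?o - ?x) + snd h *\<^sub>R (?o + ?U - ?x))
      = - ((\<theta>\<^sub>0 - \<theta>) * wedge (cis (snd (pt \<tau> \<rho>))) u)" for \<tau> \<rho>
    by (simp add: crossing_det_wedge wedge_simps algebra_simps)
  have "admissible K' (triangle_chain (- q) ?x ?o (?o + ?U))"
  proof (rule admissible_triangle_chain)
    fix s assume s: "s \<in> standard_simplex 2"
      and m: "cover (?x + s 1 *\<^sub>R (?o - ?x) + s 2 *\<^sub>R (?o + ?U - ?x)) \<in> support K'"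
    have sum: "s 0 + s 1 + s 2 = 1" "0 \<le> s 0" "0 \<le> s 1" "0 \<le> s 2"
      using s by (auto simp: standard_simplex_def numeral_2_eq_2)
    \<comment> \<open>Here \<open>\<tau> = s 1 + s 2\<close> and \<open>\<rho> = s 2\<close>, so the
      sides opposite to the vertices 0, 1 and 2 are \<open>\<tau> = 1\<close>,
      \<open>\<rho> = \<tau>\<close> and \<open>\<rho> = 0\<close>.\<close>
    have eq: "?x + s 1 *\<^sub>R (?o - ?x) + s 2 *\<^sub>R (?o + ?U - ?x) = pt (s 1 + s 2) (s 2)"
      by (simp add: pt_def scaleR_conv_of_real algebra_simps)
    have k: "s 2 \<noteq> 0 \<and> s 1 + s 2 \<noteq> 1 \<and> s 2 \<noteq> s 1 + s 2 \<and> wedge (cis (snd (pt (s 1 + s 2) (s 2)))) u \<noteq> 0"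
      using key[OF m[unfolded eq]] by blast
    then have "0 < s 0 \<and> 0 < s 1 \<and> 0 < s 2" using sum by auto
    then have "\<forall>i\<le>2. 0 < s i" by (simp add: numeral_2_eq_2 le_Suc_eq)
    then have "s \<in> simplex_interior" using s by (simp add: simplex_interior_def)
    then show "transverse_at \<Gamma> (affine_triangle ?x ?o (?o + ?U)) s"
      by (rule transverse_affine_triangle)
         (use k h' in \<open>unfold eq det, simp\<close>)
  qed
  ultimately show ?thesis
    unfolding parallelogram_def p_def[symmetric] \<theta>_def[symmetric] u_def[symmetric]
    by (rule admissible_add)
qed

section \<open>Generic position: the lifts occupy only countably many heights and lines\<close>

lemma generic_level:
  assumes K: "periodic_collection \<Gamma> K" and K': "periodic_collection \<Gamma> K'"
  obtains \<theta>\<^sub>0 where "\<And>z. cover (z, \<theta>\<^sub>0) \<notin> support K'"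
    "\<And>\<gamma> a. \<gamma> \<in># K \<Longrightarrow> a \<in> rotations \<Longrightarrow> \<theta>\<^sub>0 \<noteq> rot_angle \<gamma> a"
proof -
  define B where "B = (\<Union>\<gamma>\<in>set_mset (K + K'). \<Union>a\<in>rotations. \<Union>m::int. {rot_angle \<gamma> a + of_int m * (2 * pi)})"
  have B: "rot_angle \<gamma> a + of_int m * (2 * pi) \<in> B" if "\<gamma> \<in># K + K'" "a \<in> rotations" for \<gamma> a and m :: int
    unfolding B_def by (rule UN_I[OF that(1)], rule UN_I[OF that(2)], rule UN_I[OF UNIV_I], rule singletonI)
  have "countable B"
    unfolding B_def by (auto intro!: countable_UN simp: countable_finite finite_rotations)
  then obtain \<theta>\<^sub>0 where \<theta>\<^sub>0: "\<theta>\<^sub>0 \<notin> B" using uncountable_UNIV_real by (metis UNIV_I subsetI subset_antisym)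
  show thesis
  proof
    show "\<theta>\<^sub>0 \<noteq> rot_angle \<gamma> a" if "\<gamma> \<in># K" "a \<in> rotations" for \<gamma> a
    proof
      assume "\<theta>\<^sub>0 = rot_angle \<gamma> a"
      then show False using \<theta>\<^sub>0 B[of \<gamma> a 0] that by simp
    qed
    show "cover (z, \<theta>\<^sub>0) \<notin> support K'" for z
    proof
      assume "cover (z, \<theta>\<^sub>0) \<in> support K'"
      then obtain \<gamma>' where \<gamma>': "\<gamma>' \<in># K'" "cover (z, \<theta>\<^sub>0) \<in> \<gamma>'" by (auto simp: support_def)
      have "periodic_orbit \<Gamma> \<gamma>'" using K' \<gamma>'(1) by (simp add: periodic_collection_def)
      then obtain a' where a': "a' \<in> rotations" "rot_factor \<gamma>' a' (z, \<theta>\<^sub>0) = 0"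
        using rot_factor_zero_ex \<gamma>'(2) by blast
      then obtain m :: int where "rot_t \<gamma>' a' \<theta>\<^sub>0 = of_int m"
        by (auto simp: rot_factor_def quasi_theta_eq_0 elim: Ints_cases)
      then have "\<theta>\<^sub>0 = rot_angle \<gamma>' a' + of_int m * (2 * pi)" by (simp add: rot_t_def field_simps)
      then show False using \<theta>\<^sub>0 B[of \<gamma>' a' m] \<gamma>'(1) a'(1) by simp
    qed
  qed
qed

lemma sum_mset_minus: "(\<Sum>i\<in>#M. f i - g i) = (\<Sum>i\<in>#M. f i) - (\<Sum>i\<in>#M. g i :: 'b::ab_group_add)"
  by (induction M) simp_all

lemma of_real_of_rat_eq: "complex_of_real (of_rat x) = of_rat x"
  by (cases x) (simp add: of_rat_rat)

lemma of_real_sum_mset: "of_real (\<Sum>i\<in>#M. f i) = (\<Sum>i\<in>#M. of_real (f i))"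
  by (induction M) simp_all

lemma negligible_UN:
  "countable I \<Longrightarrow> (\<And>i. i \<in> I \<Longrightarrow> negligible (S i)) \<Longrightarrow> negligible (\<Union>i\<in>I. S i)"
  by (rule negligible_countable_Union) auto

lemma wedge_inner: "wedge u z = (\<i> * u) \<bullet> z"
  by (simp add: wedge_def inner_complex_def)

text \<open>As \<open>\<theta>\<^sub>0\<close> differs from the angle of the orbit, two rotated
  orbits and the integer value of \<open>rot_t\<close> determine \<open>\<tau>\<close>, namely as
  \<open>T\<close>. An integral value of \<open>rot_y\<close> then confines \<open>z\<^sub>0\<close>
  to one line, since \<open>\<tau> \<noteq> 0\<close>. Countably many lines do not cover the
  plane.\<close>

lemma generic_point:
  assumes K': "periodic_collection \<Gamma> K'"
    and \<theta>\<^sub>0: "\<And>\<gamma> a. \<gamma> \<in># K \<Longrightarrow> a \<in> rotations \<Longrightarrow> \<theta>\<^sub>0 \<noteq> rot_angle \<gamma> a"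
  obtains z\<^sub>0 :: complex where "\<And>\<gamma> a \<gamma>' a' \<tau> \<rho>. \<gamma> \<in># K \<Longrightarrow> a \<in> rotations \<Longrightarrow> \<gamma>' \<in># K' \<Longrightarrow> a' \<in> rotations \<Longrightarrow>
      \<tau> \<noteq> 0 \<Longrightarrow> \<rho> \<in> {0, 1, \<tau>} \<Longrightarrow>
      rot_t \<gamma>' a' (rot_angle \<gamma> a + \<tau> * (\<theta>\<^sub>0 - rot_angle \<gamma> a)) \<in> \<int> \<Longrightarrow>
      rot_y \<gamma>' a' (rot_base \<gamma> a + of_real \<tau> * (z\<^sub>0 - rot_base \<gamma> a) + of_real \<rho> * rot_vec \<gamma> a) \<notin> \<int>"
proof -
  define L where "L \<gamma> a \<gamma>' a' \<tau> \<rho> n = {z::complex. \<tau> \<noteq> 0 \<and>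
      rot_y \<gamma>' a' (rot_base \<gamma> a + of_real \<tau> * (z - rot_base \<gamma> a) + of_real \<rho> * rot_vec \<gamma> a) = of_int n}"
    for \<gamma> a \<gamma>' a' and \<tau> \<rho> :: real and n :: int
  define T where "T \<gamma> a \<gamma>' a' m = (rot_angle \<gamma>' a' + of_int m * (2 * pi) - rot_angle \<gamma> a) / (\<theta>\<^sub>0 - rot_angle \<gamma> a)"
    for \<gamma> a \<gamma>' a' and m :: int
  have neg: "negligible (L \<gamma> a \<gamma>' a' \<tau> \<rho> n)" if "\<gamma>' \<in># K'" "a' \<in> rotations" for \<gamma> a \<gamma>' a' \<tau> \<rho> n
  proof (cases "\<tau> = 0")
    case False
    let ?H = "{z. (\<i> * (of_real \<tau> * rot_vec \<gamma>' a')) \<bullet> z = of_int n * covolume -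
        wedge (rot_vec \<gamma>' a') (rot_base \<gamma> a - of_real \<tau> * rot_base \<gamma> a + of_real \<rho> * rot_vec \<gamma> a - rot_base \<gamma>' a')}"
    have po: "periodic_orbit \<Gamma> \<gamma>'" using K' that(1) by (simp add: periodic_collection_def)
    have "rot_vec \<gamma>' a' \<noteq> 0"
      using orbit_rep(1)[OF po] rotations_norm[OF that(2)] by (auto simp: rot_vec_def cis_neq_zero)
    then have "\<i> * (of_real \<tau> * rot_vec \<gamma>' a') \<noteq> 0" using False by simp
    then have "negligible ?H"
      by (intro negligible_hyperplane) simp
    moreover have "L \<gamma> a \<gamma>' a' \<tau> \<rho> n \<subseteq> ?H"
    proof
      fix z assume "z \<in> L \<gamma> a \<gamma>' a' \<tau> \<rho> n"
      then have "wedge (rot_vec \<gamma>' a') (rot_base \<gamma> a + of_real \<tau> * (z - rot_base \<gamma> a) + of_real \<rho> * rot_vec \<gamma> a - rot_base \<gamma>' a')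
          = of_int n * covolume"
        using basis(3) by (simp add: L_def rot_y_def field_simps)
      then show "z \<in> ?H"
        unfolding wedge_inner[symmetric] mem_Collect_eq wedge_simps by (simp only: right_diff_distrib)
    qed
    ultimately show ?thesis by (rule negligible_subset)
  qed (simp add: L_def)
  define B where "B = (\<Union>\<gamma>\<in>set_mset K. \<Union>a\<in>rotations. \<Union>\<gamma>'\<in>set_mset K'. \<Union>a'\<in>rotations. \<Union>m::int. \<Union>n::int.
     \<Union>\<rho>\<in>{0, 1, T \<gamma> a \<gamma>' a' m}. L \<gamma> a \<gamma>' a' (T \<gamma> a \<gamma>' a' m) \<rho> n)"
  have "negligible B"
    unfolding B_def by (intro negligible_UN neg) (simp_all add: countable_finite finite_rotations)
  then have "B \<noteq> UNIV" using open_not_negligible[of "UNIV :: complex set"] by auto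
  then obtain z\<^sub>0 where z\<^sub>0: "z\<^sub>0 \<notin> B" by blast
  show thesis
  proof (rule that, rule notI)
    fix \<gamma> a \<gamma>' a' \<tau> \<rho>
    assume mem: "\<gamma> \<in># K" "a \<in> rotations" "\<gamma>' \<in># K'" "a' \<in> rotations" "\<tau> \<noteq> 0" "\<rho> \<in> {0, 1, \<tau>}"
      and t: "rot_t \<gamma>' a' (rot_angle \<gamma> a + \<tau> * (\<theta>\<^sub>0 - rot_angle \<gamma> a)) \<in> \<int>"
      and y: "rot_y \<gamma>' a' (rot_base \<gamma> a + of_real \<tau> * (z\<^sub>0 - rot_base \<gamma> a) + of_real \<rho> * rot_vec \<gamma> a) \<in> \<int>"
    obtain m :: int where "rot_t \<gamma>' a' (rot_angle \<gamma> a + \<tau> * (\<theta>\<^sub>0 - rot_angle \<gamma> a)) = of_int m"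
      using t by (elim Ints_cases)
    then have \<tau>: "\<tau> = T \<gamma> a \<gamma>' a' m"
      using \<theta>\<^sub>0[OF mem(1,2)] by (simp add: T_def rot_t_def field_simps)
    obtain n :: int where "rot_y \<gamma>' a' (rot_base \<gamma> a + of_real \<tau> * (z\<^sub>0 - rot_base \<gamma> a) + of_real \<rho> * rot_vec \<gamma> a) = of_int n"
      using y by (elim Ints_cases)
    then have L: "z\<^sub>0 \<in> L \<gamma> a \<gamma>' a' (T \<gamma> a \<gamma>' a' m) \<rho> n" using mem(5) by (simp add: L_def \<tau>)
    have "z\<^sub>0 \<in> B"
      unfolding B_def
      by (rule UN_I[OF mem(1)], rule UN_I[OF mem(2)], rule UN_I[OF mem(3)], rule UN_I[OF mem(4)],
          rule UN_I[OF UNIV_I], rule UN_I[OF UNIV_I], rule UN_I[OF mem(6)[unfolded \<tau>]], rule L)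
    then show False using z\<^sub>0 by simp
  qed
qed

text \<open>Slanted parallelograms carry all rotated copies of the orbits to one base point at a
  generic height. There their vectors add up to \<open>total_vec K\<close>, which is 0, so that
  horizontal triangles close the chain without meeting \<open>K'\<close>.\<close>

theorem transverse_chain_ex:
  assumes K: "periodic_collection \<Gamma> K" and K': "periodic_collection \<Gamma> K'"
    and zero: "total_vec K = 0" and disj: "support K \<inter> support K' = {}"
  obtains c where "bounds \<Gamma> c K" "transverse \<Gamma> c K'"
proof -
  have po: "periodic_orbit \<Gamma> \<gamma>" if "\<gamma> \<in># K" for \<gamma> using K that by (simp add: periodic_collection_def)
  obtain \<theta>\<^sub>0 where \<theta>\<^sub>0: "\<And>z. cover (z, \<theta>\<^sub>0) \<notin> support K'"
    "\<And>\<gamma> a. \<gamma> \<in># K \<Longrightarrow> a \<in> rotations \<Longrightarrow> \<theta>\<^sub>0 \<noteq> rot_angle \<gamma> a"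
    by (rule generic_level[OF K K']) (rule that)
  obtain z\<^sub>0 where z\<^sub>0: "\<And>\<gamma> a \<gamma>' a' \<tau> \<rho>. \<gamma> \<in># K \<Longrightarrow> a \<in> rotations \<Longrightarrow> \<gamma>' \<in># K' \<Longrightarrow> a' \<in> rotations \<Longrightarrow>
      \<tau> \<noteq> 0 \<Longrightarrow> \<rho> \<in> {0, 1, \<tau>} \<Longrightarrow>
      rot_t \<gamma>' a' (rot_angle \<gamma> a + \<tau> * (\<theta>\<^sub>0 - rot_angle \<gamma> a)) \<in> \<int> \<Longrightarrow>
      rot_y \<gamma>' a' (rot_base \<gamma> a + of_real \<tau> * (z\<^sub>0 - rot_base \<gamma> a) + of_real \<rho> * rot_vec \<gamma> a) \<notin> \<int>"
    by (rule generic_point[OF K' \<theta>\<^sub>0(2)]) (assumption | rule that)+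
  \<comment> \<open>Every orbit is represented by all of its rotated copies with equal weight, since
    \<open>total_vec K = 0\<close> concerns the sum over all rotations.\<close>
  define q :: rat where "q = 1 / of_nat (card rotations)"
  let ?o = "(z\<^sub>0, \<theta>\<^sub>0)"
  define x where "x \<gamma> a = (rot_base \<gamma> a, rot_angle \<gamma> a)" for \<gamma> a
  define M where "M = (\<Sum>\<gamma>\<in>#K. image_mset (rot_vec \<gamma>) (mset_set rotations))"
  have M_mem: "u \<in> translation_vectors" if "u \<in># M" for u
    using that rot_vec_translation po finite_rotations by (auto simp: M_def)
  have M_sum: "(\<Sum>u\<in>#M. h u) = (\<Sum>\<gamma>\<in>#K. \<Sum>a\<in>rotations. h (rot_vec \<gamma> a))"
    for h :: "complex \<Rightarrow> (complex \<times> complex) set rat_chain"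
  proof -
    have "(\<Sum>u\<in>#(\<Sum>\<gamma>\<in>#N. image_mset (rot_vec \<gamma>) (mset_set rotations)). h u) = (\<Sum>\<gamma>\<in>#N. \<Sum>a\<in>rotations. h (rot_vec \<gamma> a))" for N
      by (induction N) (simp_all add: sum_unfold_sum_mset image_mset.compositionality o_def)
    then show ?thesis by (simp add: M_def)
  qed
  have M0: "\<Sum>\<^sub># M = 0"
  proof -
    have "\<Sum>\<^sub># (\<Sum>\<gamma>\<in>#N. image_mset (rot_vec \<gamma>) (mset_set rotations)) = total_vec N" for N
      unfolding total_vec_def by (induction N) (simp_all add: sum_unfold_sum_mset)
    then show ?thesis using zero by (simp add: M_def)
  qed
  obtain C where C: "\<forall>\<sigma>\<in>Poly_Mapping.keys C. \<exists>x y z. \<sigma> = affine_triangle x y z \<and>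
        snd x = snd ?o \<and> snd y = snd ?o \<and> snd z = snd ?o"
    "rat_chain_boundary 2 C = (\<Sum>u\<in>#M. edge_chain q ?o (?o + (u, 0))) - edge_chain q ?o (?o + (\<Sum>\<^sub># M, 0))"
    using cap_ex[of M ?o q] M_mem by blast
  \<comment> \<open>The last, constant triangle cancels the constant edge left over by the cap,
    whose total vector is 0.\<close>
  define c where "c = (\<Sum>\<gamma>\<in>#K. \<Sum>a\<in>rotations. parallelogram q (x \<gamma> a) (rot_vec \<gamma> a, 0) ?o) + C + triangle_chain q ?o ?o ?o"
  have level: "admissible K' (triangle_chain r x y z)" if "snd x = \<theta>\<^sub>0" "snd y = \<theta>\<^sub>0" "snd z = \<theta>\<^sub>0" for r x y z
  proof (rule admissible_triangle_chain)
    fix s :: "nat \<Rightarrow> real"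
    have "x + s 1 *\<^sub>R (y - x) + s 2 *\<^sub>R (z - x) = (fst (x + s 1 *\<^sub>R (y - x) + s 2 *\<^sub>R (z - x)), \<theta>\<^sub>0)"
      using that by (simp add: prod_eq_iff)
    moreover assume "cover (x + s 1 *\<^sub>R (y - x) + s 2 *\<^sub>R (z - x)) \<in> support K'"
    ultimately show "transverse_at \<Gamma> (affine_triangle x y z) s" using \<theta>\<^sub>0(1) by metis
  qed
  have adC: "admissible K' C"
    unfolding admissible_def rat_singular_chain_def transverse_def
  proof (intro conjI ballI impI subsetI)
    fix \<sigma> assume \<sigma>: "\<sigma> \<in> Poly_Mapping.keys C"
    then obtain x y z where xyz: "\<sigma> = affine_triangle x y z" "snd x = \<theta>\<^sub>0" "snd y = \<theta>\<^sub>0" "snd z = \<theta>\<^sub>0"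
      using C(1) by auto
    show "\<sigma> \<in> singular_simplex_set 2 (unit_tangent_bundle \<Gamma>)"
      using xyz(1) singular_simplex_affine_triangle by simp
    fix s assume "s \<in> standard_simplex 2" "\<sigma> s \<in> support K'"
    moreover have "\<sigma> \<in> Poly_Mapping.keys (triangle_chain 1 x y z)" by (simp add: triangle_chain_def xyz(1))
    ultimately show "transverse_at \<Gamma> \<sigma> s"
      using level[OF xyz(2-4), of 1] unfolding admissible_def transverse_def by blast
  qed
  have "admissible K' (parallelogram q (x \<gamma> a) (rot_vec \<gamma> a, 0) ?o)" if "\<gamma> \<in># K" "a \<in> rotations" for \<gamma> a
  proof -
    have "\<gamma> \<inter> support K' = {}" using disj that(1) by (auto simp: support_def)
    then show ?thesis
      unfolding x_def
      by (rule admissible_parallelogram[OF po[OF that(1)] _ that(2) K' \<theta>\<^sub>0(1) \<theta>\<^sub>0(2)[OF that] z\<^sub>0[OF that]])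
  qed
  then have "admissible K' c"
    unfolding c_def by (intro admissible_add admissible_sum_mset admissible_sum adC level) auto
  moreover have "rat_chain_boundary 2 c = fundamental_cycle K"
  proof -
    have "rat_chain_boundary 2 (\<Sum>\<gamma>\<in>#K. \<Sum>a\<in>rotations. parallelogram q (x \<gamma> a) (rot_vec \<gamma> a, 0) ?o)
      = (\<Sum>\<gamma>\<in>#K. \<Sum>a\<in>rotations. rat_chain_boundary 2 (parallelogram q (x \<gamma> a) (rot_vec \<gamma> a, 0) ?o))"
      by (simp add: rat_chain_boundary_pm_sum chain_boundary.pm_sum_sum_mset chain_boundary.pm_sum_sum)
    also have "\<dots> = (\<Sum>\<gamma>\<in>#K. \<Sum>a\<in>rotations. edge_chain q (x \<gamma> a) (x \<gamma> a + (rot_vec \<gamma> a, 0)) - edge_chain q ?o (?o + (rot_vec \<gamma> a, 0)))"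
      using rot_vec_translation po boundary_parallelogram
      by (intro arg_cong[of _ _ sum_mset] image_mset_cong sum.cong refl) blast
    also have "\<dots> = (\<Sum>\<gamma>\<in>#K. Poly_Mapping.single (orbit_loop (SOME X. X \<in> \<gamma>)) 1 - (\<Sum>a\<in>rotations. edge_chain q ?o (?o + (rot_vec \<gamma> a, 0))))"
    proof (intro arg_cong[of _ _ sum_mset] image_mset_cong)
      fix \<gamma> assume \<gamma>: "\<gamma> \<in># K"
      have "(\<Sum>a\<in>rotations. edge_chain q (x \<gamma> a) (x \<gamma> a + (rot_vec \<gamma> a, 0)))
          = (\<Sum>a\<in>rotations. Poly_Mapping.single (orbit_loop (SOME X. X \<in> \<gamma>)) q)"
        unfolding edge_chain_def x_def using affine_edge_orbit[OF po[OF \<gamma>]] by (intro sum.cong refl) simp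
      also have "\<dots> = Poly_Mapping.single (orbit_loop (SOME X. X \<in> \<gamma>)) (\<Sum>a\<in>rotations. q)"
      proof -
        have "(\<Sum>a\<in>A. Poly_Mapping.single k q) = Poly_Mapping.single k (\<Sum>a\<in>A. q)" for A :: "complex set" and k :: "(nat \<Rightarrow> real) \<Rightarrow> (complex \<times> complex) set"
          by (induction A rule: infinite_finite_induct) (simp_all add: single_add del: sum_constant)
        then show ?thesis .
      qed
      also have "(\<Sum>a\<in>rotations. q) = 1"
        using finite_rotations rotations_one by (auto simp: q_def)
      finally show "(\<Sum>a\<in>rotations. edge_chain q (x \<gamma> a) (x \<gamma> a + (rot_vec \<gamma> a, 0)) - edge_chain q ?o (?o + (rot_vec \<gamma> a, 0)))
          = Poly_Mapping.single (orbit_loop (SOME X. X \<in> \<gamma>)) 1 - (\<Sum>a\<in>rotations. edge_chain q ?o (?o + (rot_vec \<gamma> a, 0)))"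
        by (simp add: sum_subtractf)
    qed
    also have "\<dots> = fundamental_cycle K - (\<Sum>u\<in>#M. edge_chain q ?o (?o + (u, 0)))"
      unfolding M_sum fundamental_cycle_def by (rule sum_mset_minus)
    finally have P: "rat_chain_boundary 2 (\<Sum>\<gamma>\<in>#K. \<Sum>a\<in>rotations. parallelogram q (x \<gamma> a) (rot_vec \<gamma> a, 0) ?o)
        = fundamental_cycle K - (\<Sum>u\<in>#M. edge_chain q ?o (?o + (u, 0)))" .
    have "?o + (\<Sum>\<^sub># M, 0) = ?o" by (simp add: M0)
    then show ?thesis
      unfolding c_def by (simp add: boundary_add P C(2) boundary_triangle_chain)
  qed
  ultimately show thesis by (intro that[of c]) (simp_all add: bounds_def admissible_def)
qed

end

theorem theoremB:
  fixes \<Gamma> :: "(complex \<Rightarrow> complex) set" and \<gamma> \<gamma>' :: orbit_collection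
  assumes "flat_orbifold_group \<Gamma>"
    and "periodic_collection \<Gamma> \<gamma>" and "periodic_collection \<Gamma> \<gamma>'"
    and "null_homologous \<Gamma> \<gamma>" and "null_homologous \<Gamma> \<gamma>'"
    and "support \<gamma> \<inter> support \<gamma>' = {}"
    and "projections_cross \<gamma> \<gamma>'"
  shows "linking_number \<Gamma> \<gamma> \<gamma>' < 0"
proof -
  interpret flat_orbifold \<Gamma> by unfold_locales (rule assms(1))
  have po: "periodic_orbit \<Gamma> \<alpha>" if "\<alpha> \<in># \<gamma>" for \<alpha> using assms(2) that by (simp add: periodic_collection_def)
  have po': "periodic_orbit \<Gamma> \<alpha>" if "\<alpha> \<in># \<gamma>'" for \<alpha> using assms(3) that by (simp add: periodic_collection_def)
  have zero: "total_vec \<gamma> = 0" "total_vec \<gamma>' = 0"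
    using total_vec_eq_0[OF assms(2)] total_vec_eq_0[OF assms(3)] assms(4,5) by (auto simp: null_homologous_def)
  define N where "N = (\<Sum>\<alpha>\<in>#\<gamma>. \<Sum>\<alpha>'\<in>#\<gamma>'. \<Sum>a\<in>rotations. pair_linking \<alpha> \<alpha>' a)"
  have eq: "of_rat (intersection_number \<Gamma> c \<gamma>') = N" if "bounds \<Gamma> c \<gamma>" "transverse \<Gamma> c \<gamma>'" for c
  proof -
    have "complex_of_rat (intersection_number \<Gamma> c \<gamma>') = (\<Sum>\<alpha>\<in>#\<gamma>. winding \<gamma>' (orbit_path \<alpha>))"
      by (rule intersection_number_winding[OF assms(2,3) zero(2) assms(6) that])
    also have "\<dots> = (\<Sum>\<alpha>\<in>#\<gamma>. \<Sum>\<alpha>'\<in>#\<gamma>'. \<Sum>a\<in>rotations. of_real (pair_linking \<alpha> \<alpha>' a))"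
      unfolding winding_def
    proof (intro arg_cong[of _ _ sum_mset] image_mset_cong sum.cong refl)
      fix \<alpha> \<alpha>' a assume *: "\<alpha> \<in># \<gamma>" "\<alpha>' \<in># \<gamma>'" "a \<in> rotations"
      then have "\<alpha> \<inter> \<alpha>' = {}" using assms(6) by (auto simp: support_def)
      then show "winding_number (\<lambda>s. rot_factor \<alpha>' a (orbit_path \<alpha> s)) 0 = of_real (pair_linking \<alpha> \<alpha>' a)"
        by (intro winding_orbit_path po po' *)
    qed
    also have "\<dots> = of_real N"
      unfolding N_def by (simp add: of_real_sum_mset)
    finally have "complex_of_real (of_rat (intersection_number \<Gamma> c \<gamma>')) = of_real N"
      by (simp only: of_real_of_rat_eq)
    then show ?thesis by (simp only: of_real_eq_iff)
  qed
  have "N < 0"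
  proof -
    obtain X X' p v v' where X: "X \<in> support \<gamma>" "X' \<in> support \<gamma>'" "(p, v) \<in> X" "(p, v') \<in> X'" "v' \<noteq> v" "v' \<noteq> - v"
      using assms(7) unfolding projections_cross_def by blast
    obtain \<alpha> \<alpha>' where \<alpha>: "\<alpha> \<in># \<gamma>" "X \<in> \<alpha>" "\<alpha>' \<in># \<gamma>'" "X' \<in> \<alpha>'"
      using X(1,2) by (auto simp: support_def)
    have dir: "\<exists>b\<in>rotations. w = b * cis (angle \<beta>)" if Y: "periodic_orbit \<Gamma> \<beta>" "Y \<in> \<beta>" "(p, w) \<in> Y" for \<beta> Y w
    proof -
      have "Y \<in> range (\<lambda>t. cover (base \<beta> + of_real t * cis (angle \<beta>), angle \<beta>))"
        using Y(2) by (subst orbit_rep(4)[OF Y(1), symmetric])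
      then obtain t where "Y = cover (base \<beta> + of_real t * cis (angle \<beta>), angle \<beta>)" by blast
      then obtain a b where "(a, b) \<in> affine_group" "w = a * cis (angle \<beta>)"
        using Y(3) by (auto simp: tangent_cover_def tangent_class_affine)
      then show ?thesis by (force simp: rotations_def)
    qed
    obtain b b' where b: "b \<in> rotations" "v = b * cis (angle \<alpha>)" "b' \<in> rotations" "v' = b' * cis (angle \<alpha>')"
      using dir[OF po[OF \<alpha>(1)] \<alpha>(2) X(3)] dir[OF po'[OF \<alpha>(3)] \<alpha>(4) X(4)] by blast
    have nb: "cmod b = 1" "cmod b' = 1" using rotations_norm b(1,3) by auto
    have "wedge v' v \<noteq> 0"
    proof
      assume w: "wedge v' v = 0"
      have nv: "cmod v = 1" "cmod v' = 1" unfolding b(2,4) using nb by (simp_all add: norm_mult)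
      then have "v' \<noteq> 0" by auto
      obtain r :: real where r: "v = of_real r * v'"
        by (rule wedge_eq_0_imp[OF w \<open>v' \<noteq> 0\<close>]) (rule that)
      then have "\<bar>r\<bar> = 1" using nv by (simp add: norm_mult)
      then have "r = 1 \<or> r = - 1" by linarith
      then show False using r X(5,6) by auto
    qed
    \<comment> \<open>Rotating by \<open>1 / b\<close> brings the direction \<open>v\<close> back to
      that of the base lift of \<open>\<alpha>\<close>, so that the crossing is seen by the single
      rotation \<open>b' / b\<close> of \<open>\<alpha>'\<close>.\<close>
    moreover have "wedge v' v = wedge ((1 / b) * v') ((1 / b) * v)"
      by (rule wedge_rotate[symmetric]) (use nb in \<open>simp add: norm_divide\<close>)
    moreover have "b \<noteq> 0" using nb by auto
    ultimately have "wedge ((1 / b * b') * cis (angle \<alpha>')) (cis (angle \<alpha>)) \<noteq> 0"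
      by (simp add: b(2,4))
    moreover have a: "1 / b * b' \<in> rotations" by (intro rotations_mult rotations_inverse b)
    ultimately have lt: "pair_linking \<alpha> \<alpha>' (1 / b * b') < 0"
      by (intro pair_linking_neg po po' \<alpha>)
    have le: "(\<Sum>a\<in>rotations. pair_linking \<beta> \<beta>' a) \<le> 0" if "\<beta> \<in># \<gamma>" "\<beta>' \<in># \<gamma>'" for \<beta> \<beta>'
      using pair_linking_nonpos[OF po[OF that(1)] po'[OF that(2)]] by (intro sum_nonpos)
    have lt2: "(\<Sum>a\<in>rotations. pair_linking \<alpha> \<alpha>' a) < 0"
    proof -
      have "(\<Sum>a\<in>rotations. pair_linking \<alpha> \<alpha>' a) < (\<Sum>a\<in>rotations. 0)"
        using pair_linking_nonpos[OF po[OF \<alpha>(1)] po'[OF \<alpha>(3)]] lt a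
        by (intro sum_strict_mono_ex1 finite_rotations) auto
      then show ?thesis by simp
    qed
    have mset: "(\<Sum>i\<in>#M. h i) \<le> 0" "j \<in># M \<Longrightarrow> h j < 0 \<Longrightarrow> (\<Sum>i\<in>#M. h i) < 0"
      if "\<And>i. i \<in># M \<Longrightarrow> h i \<le> 0" for M :: orbit_collection and h :: "_ \<Rightarrow> real" and j
    proof -
      have np: "(\<Sum>i\<in>#M. h i) \<le> 0" if "\<And>i. i \<in># M \<Longrightarrow> h i \<le> 0" for M :: orbit_collection
        using that by (induction M) (auto intro: add_nonpos_nonpos)
      then show "(\<Sum>i\<in>#M. h i) \<le> 0" using that .
      assume j: "j \<in># M" "h j < 0"
      then obtain M' where M': "M = add_mset j M'" by (metis insert_DiffM)
      have "(\<Sum>i\<in>#M'. h i) \<le> 0" using that by (intro np) (auto simp: M')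
      then show "(\<Sum>i\<in>#M. h i) < 0" using j(2) by (simp add: M')
    qed
    have le2: "(\<Sum>\<beta>'\<in>#\<gamma>'. \<Sum>a\<in>rotations. pair_linking \<beta> \<beta>' a) \<le> 0" if "\<beta> \<in># \<gamma>" for \<beta>
      using le that by (intro mset(1)) auto
    have lt3: "(\<Sum>\<beta>'\<in>#\<gamma>'. \<Sum>a\<in>rotations. pair_linking \<alpha> \<beta>' a) < 0"
      using le \<alpha>(1) lt2 \<alpha>(3) by (intro mset(2)[where j = \<alpha>']) auto
    show ?thesis unfolding N_def
      by (rule mset(2)[where j = \<alpha>]) (use le2 lt3 \<alpha>(1) in auto)
  qed
  \<comment> \<open>The definite description denotes the common value of all intersection numbers
    only if there is a transverse chain at all.\<close>
  obtain c where c: "bounds \<Gamma> c \<gamma>" "transverse \<Gamma> c \<gamma>'"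
    by (rule transverse_chain_ex[OF assms(2,3) zero(1) assms(6)]) (rule that)
  have "linking_number \<Gamma> \<gamma> \<gamma>' = intersection_number \<Gamma> c \<gamma>'"
    unfolding linking_number_def
  proof (rule the_equality)
    show "\<exists>c'. bounds \<Gamma> c' \<gamma> \<and> transverse \<Gamma> c' \<gamma>' \<and> intersection_number \<Gamma> c \<gamma>' = intersection_number \<Gamma> c' \<gamma>'"
      using c by blast
    fix r assume "\<exists>c'. bounds \<Gamma> c' \<gamma> \<and> transverse \<Gamma> c' \<gamma>' \<and> r = intersection_number \<Gamma> c' \<gamma>'"
    then obtain c' where c': "bounds \<Gamma> c' \<gamma>" "transverse \<Gamma> c' \<gamma>'" "r = intersection_number \<Gamma> c' \<gamma>'" by blast
    have "(of_rat r :: real) = of_rat (intersection_number \<Gamma> c \<gamma>')"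
      using eq[OF c] eq[OF c'(1,2)] c'(3) by simp
    then show "r = intersection_number \<Gamma> c \<gamma>'" by (simp only: of_rat_eq_iff)
  qed
  then have "(of_rat (linking_number \<Gamma> \<gamma> \<gamma>') :: real) < 0" using eq[OF c] \<open>N < 0\<close> by simp
  then show ?thesis by simp
qed

end
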